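(* Let $X$ be a compact Kähler manifold of real dimension $n$ and let $G$ be a finite group of holomorphic isometries of $X$. Suppose that $\Gamma_1$ and $\Gamma_2$ are almost conjugate subgroups of $G$ that act freely on $X$, and let $X_i=\Gamma_i\backslash X$, $i=1,2$. Then for each pair of non-negative integers $(p,q)$ with $p+q\le n$, the Hodge Laplacians on $\mathscr{A}^{p,q}(\Gamma_1\backslash X)$ and $\mathscr{A}^{p,q}(\Gamma_2\backslash X)$ are isospectral.
   Context: Two subgroups $\Gamma_1,\Gamma_2$ of a finite group $G$ are almost conjugate if every $G$-conjugacy class intersects $\Gamma_1$ and $\Gamma_2$ in the same number of elements. The quotients $\Gamma_i\backslash X$ carry the Kähler structure (complex structure and metric) induced from $X$ via the covering map $X\to\Gamma_i\backslash X$. For a complex manifold $Y$, $\mathscr{A}^{p,q}(Y)$ denotes the space of smooth complex-valued differential forms of type $(p,q)$ on $Y$. On a Kähler manifold the Hodge Laplacian $\Delta=dd^*+d^*d$ on $k$-forms (extended complex-linearly to complex-valued forms) preserves $\mathscr{A}^{p,q}(Y)$ for each $p+q=k$. Two such operators are isospectral if they have the same eigenvalues with the same multiplicities. *)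

theory Defs
  imports
    "HOL-Analysis.Analysis"
    "HOL-Algebra.Group_Action"
    "HOL-Library.Function_Algebras"
    "HOL-Library.Extended_Nat"
begin

section \<open>Smooth and holomorphic maps between open sets\<close>

text \<open>\<open>C\<^sup>k\<close> maps on an open set, by iterated directional derivatives. The underlying real vector
  space of \<open>\<complex>\<^sup>m\<close> is \<^typ>\<open>complex^'m\<close> with its real scalar multiplication.\<close>

primrec Ck_on :: "nat \<Rightarrow> ('v::real_normed_vector \<Rightarrow> 'w::real_normed_vector) \<Rightarrow> 'v set \<Rightarrow> bool" where
  "Ck_on 0 f S \<longleftrightarrow> continuous_on S f"
| "Ck_on (Suc k) f S \<longleftrightarrow>
     (\<forall>x\<in>S. f differentiable (at x)) \<and> (\<forall>v. Ck_on k (\<lambda>x. frechet_derivative f (at x) v) S)"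

definition smooth_on :: "('v::real_normed_vector \<Rightarrow> 'w::real_normed_vector) \<Rightarrow> 'v set \<Rightarrow> bool" where
  "smooth_on f S \<longleftrightarrow> (\<forall>k. Ck_on k f S)"

text \<open>A holomorphic map of several variables is a smooth map satisfying the Cauchy-Riemann
  equations, that is, with complex-linear differential.\<close>

definition holomorphic_vec :: "(complex^'m \<Rightarrow> complex^'m) \<Rightarrow> (complex^'m) set \<Rightarrow> bool" where
  "holomorphic_vec f S \<longleftrightarrow> smooth_on f S \<and>
     (\<forall>z\<in>S. \<forall>v. frechet_derivative f (at z) (\<i> *s v) = \<i> *s frechet_derivative f (at z) v)"


section \<open>Exterior algebra of \<open>\<complex>\<^sup>m\<close>\<close>

text \<open>A complex-valued real-multilinear form of degree \<open>k\<close> is a function on argument lists which is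
  zero on lists of length other than \<open>k\<close>.\<close>

type_synonym 'v form_at = "'v list \<Rightarrow> complex"

definition alternating_form :: "nat \<Rightarrow> ('v::real_vector) form_at \<Rightarrow> bool" where
  "alternating_form k \<alpha> \<longleftrightarrow>
     (\<forall>vs. length vs \<noteq> k \<longrightarrow> \<alpha> vs = 0) \<and>
     (\<forall>vs j. length vs = k \<longrightarrow> j < k \<longrightarrow> linear (\<lambda>v. \<alpha> (vs[j := v]))) \<and>
     (\<forall>vs i j. length vs = k \<longrightarrow> i < j \<longrightarrow> j < k \<longrightarrow> vs ! i = vs ! j \<longrightarrow> \<alpha> vs = 0)"

text \<open>\<open>wedge [\<alpha>\<^sub>1, \<dots>, \<alpha>\<^sub>k]\<close> is \<open>\<alpha>\<^sub>1 \<and> \<dots> \<and> \<alpha>\<^sub>k\<close> for 1-forms \<open>\<alpha>\<^sub>j\<close>, in the determinant normalisation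
  \<open>(\<alpha>\<^sub>1 \<and> \<dots> \<and> \<alpha>\<^sub>k)(v\<^sub>1, \<dots>, v\<^sub>k) = det (\<alpha>\<^sub>i(v\<^sub>j))\<close>.\<close>

definition wedge :: "('v \<Rightarrow> complex) list \<Rightarrow> 'v form_at" where
  "wedge \<alpha>s vs =
     (if length vs = length \<alpha>s
      then \<Sum>\<sigma> | \<sigma> permutes {..<length vs}.
             of_int (sign \<sigma>) * (\<Prod>j<length vs. (\<alpha>s ! j) (vs ! \<sigma> j))
      else 0)"

definition dz :: "'m \<Rightarrow> complex^'m \<Rightarrow> complex" where
  "dz i v = v $ i"

definition dzbar :: "'m \<Rightarrow> complex^'m \<Rightarrow> complex" where
  "dzbar i v = cnj (v $ i)"

text \<open>Forms of type \<open>(p,q)\<close>: the complex span of the \<open>dz\<^sub>I \<and> dzbar\<^sub>J\<close> with \<open>|I| = p\<close>, \<open>|J| = q\<close>.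
  The multi-indices need not be increasing; this does not change the span.\<close>

definition forms_at_pq :: "nat \<Rightarrow> nat \<Rightarrow> (complex^'m) form_at set" where
  "forms_at_pq p q = {\<alpha>. \<exists>f. \<forall>vs.
     \<alpha> vs = (\<Sum>I | length I = p. \<Sum>J | length J = q. f I J * wedge (map dz I @ map dzbar J) vs)}"


section \<open>Hodge star of a real inner product on \<open>\<complex>\<^sup>m\<close>\<close>

text \<open>Real basis \<open>\<partial>/\<partial>x\<^sub>i\<close> (\<^term>\<open>Inl i\<close>), \<open>\<partial>/\<partial>y\<^sub>i\<close> (\<^term>\<open>Inr i\<close>) of \<open>\<complex>\<^sup>m\<close>, where \<open>z\<^sub>i = x\<^sub>i + \<i> y\<^sub>i\<close>.\<close>

definition real_axis :: "'m + 'm \<Rightarrow> complex^'m" where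
  "real_axis a = (case a of Inl i \<Rightarrow> axis i 1 | Inr i \<Rightarrow> axis i \<i>)"

definition gram :: "(complex^'m \<Rightarrow> complex^'m \<Rightarrow> real) \<Rightarrow> real^('m + 'm)^('m + 'm)" where
  "gram g = (\<chi> a b. g (real_axis a) (real_axis b))"

text \<open>The list \<open>dx\<^sub>1, dy\<^sub>1, dx\<^sub>2, dy\<^sub>2, \<dots>\<close>, which defines the complex orientation. Since the \<open>dx\<^sub>i, dy\<^sub>i\<close>
  come in pairs, the wedge product of the list does not depend on the enumeration of the index type.\<close>

definition real_coords :: "(complex^'m \<Rightarrow> complex) list" where
  "real_coords =
     concat (map (\<lambda>i. [\<lambda>v. of_real (Re (v $ i)), \<lambda>v. of_real (Im (v $ i))])
       (SOME is. distinct is \<and> set is = (UNIV :: 'm set)))"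

definition volume_form :: "(complex^'m \<Rightarrow> complex^'m \<Rightarrow> real) \<Rightarrow> (complex^'m) form_at" where
  "volume_form g vs = of_real (sqrt (det (gram g))) * wedge real_coords vs"

text \<open>The complex-linear Hodge star, in components
  \<open>(*\<alpha>)(w\<^sub>1, \<dots>, w\<^sub>n\<^sub>-\<^sub>k) = 1/k! \<Sum> g\<^sup>a\<^sup>1\<^sup>b\<^sup>1 \<dots> g\<^sup>a\<^sup>k\<^sup>b\<^sup>k \<alpha>(e\<^sub>a\<^sub>1, \<dots>, e\<^sub>a\<^sub>k) vol(e\<^sub>b\<^sub>1, \<dots>, e\<^sub>b\<^sub>k, w\<^sub>1, \<dots>, w\<^sub>n\<^sub>-\<^sub>k)\<close>
  with \<open>n = 2m\<close> the real dimension. The degree \<open>k\<close> is read off the number of arguments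
  (for more than \<open>n\<close> arguments the result is zero because the volume form is).\<close>

definition hodge_star ::
    "(complex^'m \<Rightarrow> complex^'m \<Rightarrow> real) \<Rightarrow> (complex^'m) form_at \<Rightarrow> (complex^'m) form_at" where
  "hodge_star g \<alpha> ws =
     (let k = 2 * CARD('m) - length ws in
       (\<Sum>as | length as = k. \<Sum>bs | length bs = k.
          of_real (\<Prod>j<k. matrix_inv (gram g) $ (as ! j) $ (bs ! j))
            * \<alpha> (map real_axis as) * volume_form g (map real_axis bs @ ws)) / fact k)"


section \<open>Differential forms on open subsets of \<open>\<complex>\<^sup>m\<close>\<close>

definition ext_deriv ::
    "('v::real_normed_vector \<Rightarrow> 'v form_at) \<Rightarrow> 'v \<Rightarrow> 'v form_at" where
  "ext_deriv \<alpha> z vs =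
     (\<Sum>j<length vs. (-1) ^ j *
        frechet_derivative (\<lambda>y. \<alpha> y (take j vs @ drop (Suc j) vs)) (at z) (vs ! j))"

text \<open>The real dimension is even, so \<open>d\<^sup>* = (-1)\<^sup>n\<^sup>(\<^sup>k\<^sup>+\<^sup>1\<^sup>)\<^sup>+\<^sup>1 * d *\<close> is \<open>- * d *\<close> in every degree.\<close>

definition codifferential ::
    "(complex^'m \<Rightarrow> complex^'m \<Rightarrow> complex^'m \<Rightarrow> real) \<Rightarrow>
     (complex^'m \<Rightarrow> (complex^'m) form_at) \<Rightarrow> complex^'m \<Rightarrow> (complex^'m) form_at" where
  "codifferential g \<alpha> z = - hodge_star (g z) (ext_deriv (\<lambda>y. hodge_star (g y) (\<alpha> y)) z)"


section \<open>Complex manifolds with a Hermitian metric\<close>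

text \<open>A complex manifold of complex dimension \<open>m = CARD('m)\<close>, real dimension \<open>2m\<close>, is given by a
  topology and an indexed atlas; the chart with index \<open>i\<close> is defined on \<open>chart_dom M i\<close>, and
  \<open>riem M i z\<close> is the expression in it of the Riemannian metric, at the point with coordinates \<open>z\<close>.
  As index types are nonempty, \<open>m\<close> is positive. Manifolds are not required to be connected.\<close>

record ('i, 'a, 'm) hermitian_data =
  mtop :: "'a topology"
  charts :: "'i set"
  chart_dom :: "'i \<Rightarrow> 'a set"
  chart_map :: "'i \<Rightarrow> 'a \<Rightarrow> complex^('m::finite)"
  riem :: "'i \<Rightarrow> complex^'m \<Rightarrow> complex^'m \<Rightarrow> complex^'m \<Rightarrow> real"

definition chart_image :: "('i, 'a, 'm::finite) hermitian_data \<Rightarrow> 'i \<Rightarrow> (complex^'m) set" where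
  "chart_image M i = chart_map M i ` chart_dom M i"

text \<open>Coordinate expression of a map \<open>F\<close> from \<open>M\<close> to \<open>N\<close>, and its domain. With \<^term>\<open>F = id\<close> these are
  the transition maps of \<open>M\<close>.\<close>

definition local_rep ::
    "('i, 'a, 'm::finite) hermitian_data \<Rightarrow> 'i \<Rightarrow> ('j, 'b, 'm) hermitian_data \<Rightarrow> 'j \<Rightarrow>
     ('a \<Rightarrow> 'b) \<Rightarrow> complex^'m \<Rightarrow> complex^'m" where
  "local_rep M i N j F = chart_map N j \<circ> F \<circ> inv_into (chart_dom M i) (chart_map M i)"

definition local_dom ::
    "('i, 'a, 'm::finite) hermitian_data \<Rightarrow> 'i \<Rightarrow> ('j, 'b, 'm) hermitian_data \<Rightarrow> 'j \<Rightarrow>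
     ('a \<Rightarrow> 'b) \<Rightarrow> (complex^'m) set" where
  "local_dom M i N j F = chart_map M i ` {x \<in> chart_dom M i. F x \<in> chart_dom N j}"

definition holomorphic_map ::
    "('i, 'a, 'm::finite) hermitian_data \<Rightarrow> ('j, 'b, 'm) hermitian_data \<Rightarrow> ('a \<Rightarrow> 'b) \<Rightarrow> bool" where
  "holomorphic_map M N F \<longleftrightarrow> continuous_map (mtop M) (mtop N) F \<and>
     (\<forall>i\<in>charts M. \<forall>j\<in>charts N. holomorphic_vec (local_rep M i N j F) (local_dom M i N j F))"

definition preserves_metric ::
    "('i, 'a, 'm::finite) hermitian_data \<Rightarrow> ('j, 'b, 'm) hermitian_data \<Rightarrow> ('a \<Rightarrow> 'b) \<Rightarrow> bool" where
  "preserves_metric M N F \<longleftrightarrow>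
     (\<forall>i\<in>charts M. \<forall>j\<in>charts N. \<forall>z\<in>local_dom M i N j F. \<forall>v w.
        let D = frechet_derivative (local_rep M i N j F) (at z)
        in riem N j (local_rep M i N j F z) (D v) (D w) = riem M i z v w)"

definition complex_manifold :: "('i, 'a, 'm::finite) hermitian_data \<Rightarrow> bool" where
  "complex_manifold M \<longleftrightarrow>
     Hausdorff_space (mtop M) \<and> second_countable (mtop M) \<and>
     (\<Union>i\<in>charts M. chart_dom M i) = topspace (mtop M) \<and>
     (\<forall>i\<in>charts M. openin (mtop M) (chart_dom M i) \<and> open (chart_image M i) \<and>
        homeomorphic_map (subtopology (mtop M) (chart_dom M i)) (top_of_set (chart_image M i))
          (chart_map M i)) \<and>
     (\<forall>i\<in>charts M. \<forall>j\<in>charts M. holomorphic_vec (local_rep M i M j id) (local_dom M i M j id))"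

definition hermitian_metric :: "('i, 'a, 'm::finite) hermitian_data \<Rightarrow> bool" where
  "hermitian_metric M \<longleftrightarrow>
     (\<forall>i\<in>charts M.
        (\<forall>z\<in>chart_image M i.
           bilinear (riem M i z) \<and>
           (\<forall>v w. riem M i z v w = riem M i z w v) \<and>
           (\<forall>v. v \<noteq> 0 \<longrightarrow> riem M i z v v > 0) \<and>
           (\<forall>v w. riem M i z (\<i> *s v) (\<i> *s w) = riem M i z v w)) \<and>
        (\<forall>v w. smooth_on (\<lambda>z. riem M i z v w) (chart_image M i))) \<and>
     preserves_metric M M id"

definition fundamental_form ::
    "('i, 'a, 'm::finite) hermitian_data \<Rightarrow> 'i \<Rightarrow> complex^'m \<Rightarrow> (complex^'m) form_at" where
  "fundamental_form M i z vs =
     (if length vs = 2 then of_real (riem M i z (\<i> *s (vs ! 0)) (vs ! 1)) else 0)"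

definition kahler_manifold :: "('i, 'a, 'm::finite) hermitian_data \<Rightarrow> bool" where
  "kahler_manifold M \<longleftrightarrow> complex_manifold M \<and> hermitian_metric M \<and>
     (\<forall>i\<in>charts M. \<forall>z\<in>chart_image M i. \<forall>vs. ext_deriv (fundamental_form M i) z vs = 0)"

definition holomorphic_isometry :: "('i, 'a, 'm::finite) hermitian_data \<Rightarrow> ('a \<Rightarrow> 'a) \<Rightarrow> bool" where
  "holomorphic_isometry M F \<longleftrightarrow>
     bij_betw F (topspace (mtop M)) (topspace (mtop M)) \<and>
     holomorphic_map M M F \<and> preserves_metric M M F"


section \<open>Differential forms and the Hodge Laplacian\<close>

text \<open>A differential form on \<open>M\<close> is the family of its coordinate expressions \<open>\<omega> i z\<close>, compatible with
  the transition maps and set to zero outside the coordinate domains, so that equality of forms is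
  equality of functions.\<close>

type_synonym ('i, 'v) diff_form = "'i \<Rightarrow> 'v \<Rightarrow> 'v form_at"

definition smooth_forms ::
    "('i, 'a, 'm::finite) hermitian_data \<Rightarrow> nat \<Rightarrow> ('i, complex^'m) diff_form set" where
  "smooth_forms M k = {\<omega>.
     (\<forall>i z. i \<notin> charts M \<or> z \<notin> chart_image M i \<longrightarrow> \<omega> i z = 0) \<and>
     (\<forall>i\<in>charts M. \<forall>z\<in>chart_image M i. alternating_form k (\<omega> i z)) \<and>
     (\<forall>i\<in>charts M. \<forall>vs. smooth_on (\<lambda>z. \<omega> i z vs) (chart_image M i)) \<and>
     (\<forall>i\<in>charts M. \<forall>j\<in>charts M. \<forall>z\<in>local_dom M i M j id. \<forall>vs.
        \<omega> j (local_rep M i M j id z) (map (frechet_derivative (local_rep M i M j id) (at z)) vs)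
          = \<omega> i z vs)}"

definition forms_pq ::
    "('i, 'a, 'm::finite) hermitian_data \<Rightarrow> nat \<Rightarrow> nat \<Rightarrow> ('i, complex^'m) diff_form set" where
  "forms_pq M p q =
     {\<omega> \<in> smooth_forms M (p + q). \<forall>i\<in>charts M. \<forall>z\<in>chart_image M i. \<omega> i z \<in> forms_at_pq p q}"

definition hodge_laplacian ::
    "('i, 'a, 'm::finite) hermitian_data \<Rightarrow>
     ('i, complex^'m) diff_form \<Rightarrow> ('i, complex^'m) diff_form" where
  "hodge_laplacian M \<omega> i z =
     (if i \<in> charts M \<and> z \<in> chart_image M i
      then ext_deriv (codifferential (riem M i) (\<omega> i)) z
         + codifferential (riem M i) (ext_deriv (\<omega> i)) z
      else 0)"


section \<open>Isospectrality\<close>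

definition scale_form :: "complex \<Rightarrow> ('i, 'v) diff_form \<Rightarrow> ('i, 'v) diff_form" where
  "scale_form c \<omega> = (\<lambda>i z vs. c * \<omega> i z vs)"

global_interpretation form_space: vector_space scale_form
  by unfold_locales (auto simp: scale_form_def fun_eq_iff algebra_simps)

definition eigenspace ::
    "(('i, 'v) diff_form \<Rightarrow> ('i, 'v) diff_form) \<Rightarrow> ('i, 'v) diff_form set \<Rightarrow> complex \<Rightarrow>
     ('i, 'v) diff_form set" where
  "eigenspace T A c = {\<omega> \<in> A. T \<omega> = scale_form c \<omega>}"

definition eigenvalues ::
    "(('i, 'v) diff_form \<Rightarrow> ('i, 'v) diff_form) \<Rightarrow> ('i, 'v) diff_form set \<Rightarrow> complex set" where
  "eigenvalues T A = {c. \<exists>\<omega> \<in> eigenspace T A c. \<omega> \<noteq> 0}"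

text \<open>The multiplicity is the complex dimension of the eigenspace. The library dimension of an
  infinite-dimensional space is \<open>0\<close>, so the value \<open>\<infinity>\<close> is assigned explicitly.\<close>

definition multiplicity_of ::
    "(('i, 'v) diff_form \<Rightarrow> ('i, 'v) diff_form) \<Rightarrow> ('i, 'v) diff_form set \<Rightarrow> complex \<Rightarrow> enat" where
  "multiplicity_of T A c =
     (if \<exists>B. finite B \<and> eigenspace T A c \<subseteq> form_space.span B
      then enat (form_space.dim (eigenspace T A c)) else \<infinity>)"

definition isospectral ::
    "(('i, 'v) diff_form \<Rightarrow> ('i, 'v) diff_form) \<Rightarrow> ('i, 'v) diff_form set \<Rightarrow>
     (('j, 'w) diff_form \<Rightarrow> ('j, 'w) diff_form) \<Rightarrow> ('j, 'w) diff_form set \<Rightarrow> bool" where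
  "isospectral S A T B \<longleftrightarrow>
     eigenvalues S A = eigenvalues T B \<and>
     (\<forall>c \<in> eigenvalues S A. multiplicity_of S A c = multiplicity_of T B c)"


section \<open>Group actions and quotients\<close>

definition conj_class :: "('g, 'r) monoid_scheme \<Rightarrow> 'g \<Rightarrow> 'g set" where
  "conj_class G x = {h \<otimes>\<^bsub>G\<^esub> x \<otimes>\<^bsub>G\<^esub> inv\<^bsub>G\<^esub> h | h. h \<in> carrier G}"

definition almost_conjugate :: "('g, 'r) monoid_scheme \<Rightarrow> 'g set \<Rightarrow> 'g set \<Rightarrow> bool" where
  "almost_conjugate G \<Gamma>1 \<Gamma>2 \<longleftrightarrow>
     (\<forall>x\<in>carrier G. card (conj_class G x \<inter> \<Gamma>1) = card (conj_class G x \<inter> \<Gamma>2))"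

definition transformation_group ::
    "('i, 'a, 'm::finite) hermitian_data \<Rightarrow> ('a \<Rightarrow> 'a) set \<Rightarrow> ('a \<Rightarrow> 'a) monoid" where
  "transformation_group M \<Gamma> = BijGroup (topspace (mtop M)) \<lparr>carrier := \<Gamma>\<rparr>"

definition acts_freely :: "('i, 'a, 'm::finite) hermitian_data \<Rightarrow> ('a \<Rightarrow> 'a) set \<Rightarrow> bool" where
  "acts_freely M \<Gamma> \<longleftrightarrow>
     (\<forall>\<gamma>\<in>\<Gamma>. \<forall>x\<in>topspace (mtop M). \<gamma> x = x \<longrightarrow> \<gamma> = \<one>\<^bsub>transformation_group M \<Gamma>\<^esub>)"

definition proj :: "('i, 'a, 'm::finite) hermitian_data \<Rightarrow> ('a \<Rightarrow> 'a) set \<Rightarrow> 'a \<Rightarrow> 'a set" where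
  "proj M \<Gamma> x = orbit (transformation_group M \<Gamma>) (\<lambda>\<gamma>. \<gamma>) x"

text \<open>The quotient \<open>\<Gamma>\<setminus>M\<close> with the structure induced by the covering map: its points are the orbits, and
  for every open set \<open>U\<close> inside a chart domain on which the projection is injective, the chart and
  the metric on \<open>U\<close> are transported to the image of \<open>U\<close>. Distinct pairs \<open>(i, U)\<close> are distinct indices
  even if they have the same image.\<close>

definition quotient_manifold ::
    "('i, 'a, 'm::finite) hermitian_data \<Rightarrow> ('a \<Rightarrow> 'a) set \<Rightarrow>
     ('i \<times> 'a set, 'a set, 'm) hermitian_data" where
  "quotient_manifold M \<Gamma> =
     \<lparr>mtop = topology (\<lambda>V. V \<subseteq> orbits (transformation_group M \<Gamma>) (topspace (mtop M)) (\<lambda>\<gamma>. \<gamma>) \<and>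
                openin (mtop M) {x \<in> topspace (mtop M). proj M \<Gamma> x \<in> V}),
      charts = {(i, U). i \<in> charts M \<and> openin (mtop M) U \<and> U \<subseteq> chart_dom M i \<and>
                  inj_on (proj M \<Gamma>) U},
      chart_dom = (\<lambda>(i, U). proj M \<Gamma> ` U),
      chart_map = (\<lambda>(i, U). chart_map M i \<circ> the_inv_into U (proj M \<Gamma>)),
      riem = (\<lambda>(i, U). riem M i)\<rparr>"

lemma openin_quotient_manifold:
  "openin (mtop (quotient_manifold M \<Gamma>)) V \<longleftrightarrow>
     V \<subseteq> orbits (transformation_group M \<Gamma>) (topspace (mtop M)) (\<lambda>\<gamma>. \<gamma>) \<and>
     openin (mtop M) {x \<in> topspace (mtop M). proj M \<Gamma> x \<in> V}"
proof -
  let ?P = "\<lambda>V. V \<subseteq> orbits (transformation_group M \<Gamma>) (topspace (mtop M)) (\<lambda>\<gamma>. \<gamma>) \<and>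
     openin (mtop M) {x \<in> topspace (mtop M). proj M \<Gamma> x \<in> V}"
  have int: "?P (S \<inter> T)" if "?P S" "?P T" for S T
  proof -
    have "{x \<in> topspace (mtop M). proj M \<Gamma> x \<in> S \<inter> T} =
        {x \<in> topspace (mtop M). proj M \<Gamma> x \<in> S} \<inter> {x \<in> topspace (mtop M). proj M \<Gamma> x \<in> T}"
      by blast
    with that show ?thesis by auto
  qed
  have un: "?P (\<Union>K)" if K: "\<forall>S\<in>K. ?P S" for K
  proof -
    have "{x \<in> topspace (mtop M). proj M \<Gamma> x \<in> \<Union>K} =
        (\<Union>S\<in>K. {x \<in> topspace (mtop M). proj M \<Gamma> x \<in> S})"
      by blast
    with K show ?thesis by auto
  qed
  have "istopology ?P"
    unfolding istopology_def using int un by blast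
  then show ?thesis
    by (simp add: quotient_manifold_def topology_inverse')
qed

end

theory Submission
  imports Defs
begin

text \<open>Sunada's argument for forms of type \<open>(p,q)\<close>. Let \<open>V\<close> be the space of eigenforms of \<open>X\<close> of type
  \<open>(p,q)\<close> for the eigenvalue \<open>c\<close>. The group \<open>G\<close> acts on \<open>V\<close> by pullback, because holomorphic isometries
  preserve the type and commute with the Laplacian (\<open>form_pullback_eigenforms\<close>). Pulling back along the
  covering \<open>X \<rightarrow> \<Gamma>\<setminus>X\<close> is a linear isomorphism from the eigenforms of \<open>\<Gamma>\<setminus>X\<close> onto the \<open>\<Gamma>\<close>-invariant
  elements of \<open>V\<close> (\<open>lift_eigenforms\<close>, \<open>descend_eigenforms\<close>): the covering is a local isometry, and the
  Laplacian is a local operator. It remains to compare the dimensions of the spaces \<open>V\<^sup>\<Gamma>\<close> for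
  \<open>\<Gamma> = \<Gamma>\<^sub>1, \<Gamma>\<^sub>2\<close>.

  On a representation \<open>W\<close> of \<open>G\<close> of finite dimension, averaging over \<open>\<Gamma>\<close> is a projection onto \<open>W\<^sup>\<Gamma>\<close>, so that
  \<open>dim W\<^sup>\<Gamma> = 1/|\<Gamma>| \<Sum>\<^sub>\<gamma> tr(\<gamma>|W)\<close>. The trace is a class function on \<open>G\<close>,
      and almost conjugate subgroups have
  equally many elements in each class; hence the two dimensions agree. Instead of proving by elliptic
  theory that \<open>V\<close> has finite dimension, the argument is applied to the span \<open>W\<close> of the \<open>G\<close>-translates of
  finitely many elements of \<open>V\<close>. This shows that \<open>V\<^sup>\<Gamma>\<close> contains \<open>n\<close> independent elements
      for \<open>\<Gamma> = \<Gamma>\<^sub>1\<close> if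
  and only if it does for \<open>\<Gamma> = \<Gamma>\<^sub>2\<close> (\<open>almost_conjugate_fixed_independent\<close>), which determines the
  multiplicities, finite or infinite (\<open>isospectralI\<close>).

  The analytic core is that the coordinate expression of the Laplacian is natural under a smooth local
  isometry \<open>\<phi>\<close> (\<open>laplacian_pullback\<close>). The exterior derivative commutes with \<open>\<phi>\<^sup>*\<close> since second derivatives
  are symmetric (\<open>ext_deriv_pullback\<close>). The Hodge star commutes with an isometry up to the sign of its
  determinant (\<open>hodge_star_isometry\<close>), and the codifferential contains two stars.\<close>

section \<open>Fixed spaces of almost conjugate subgroups\<close>

definition trace_on :: "('k::field \<Rightarrow> 'v::ab_group_add \<Rightarrow> 'v) \<Rightarrow> 'v set \<Rightarrow> ('v \<Rightarrow> 'v) \<Rightarrow> 'k" where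
  "trace_on s B T = (\<Sum>b\<in>B. module.representation s B (T b) b)"

context vector_space
begin

text \<open>Both sides expand to the sum, over \<open>b \<in> B\<close> and \<open>c \<in> C\<close>, of the products of the entries of
  the two rectangular matrices. With \<open>B = C\<close> this is the invariance of the trace under
  conjugation; with \<open>C\<close> spanning the image of a projection it computes the trace of the
  projection.\<close>

lemma trace_on_commute:
  assumes B: "finite B" "independent B" and C: "finite C" "independent C"
    and S: "Vector_Spaces.linear scale scale S" "S ` span B \<subseteq> span C"
    and T: "Vector_Spaces.linear scale scale T" "T ` span C \<subseteq> span B"
  shows "trace_on scale B (\<lambda>x. T (S x)) = trace_on scale C (\<lambda>x. S (T x))"
proof -
  have expand: "representation D (P (Q d)) d
      = (\<Sum>e\<in>E. representation E (Q d) e * representation D (P e) d)"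
    if D: "independent D" and E: "finite E" "independent E"
      and P: "Vector_Spaces.linear scale scale P" "P ` span E \<subseteq> span D" and Qd: "Q d \<in> span E"
          for D E P Q d
  proof -
    interpret P: Vector_Spaces.linear scale scale P by (rule P(1))
    have "Q d = (\<Sum>e\<in>E. scale (representation E (Q d) e) e)"
      using sum_representation_eq[OF E(2) Qd E(1)] by simp
    then have "P (Q d) = P (\<Sum>e\<in>E. scale (representation E (Q d) e) e)" by simp
    also have "\<dots> = (\<Sum>e\<in>E. scale (representation E (Q d) e) (P e))"
      by (simp add: P.sum P.scale)
    finally have *: "P (Q d) = (\<Sum>e\<in>E. scale (representation E (Q d) e) (P e))" .
    have in_D: "P e \<in> span D" if "e \<in> E" for e using P(2) span_base[OF that] by auto
    show ?thesis unfolding *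
      by (subst representation_sum[OF D]) (auto simp: in_D span_scale representation_scale[OF D])
  qed
  have "trace_on scale B (\<lambda>x. T (S x))
      = (\<Sum>b\<in>B. \<Sum>c\<in>C. representation C (S b) c * representation B (T c) b)"
    unfolding trace_on_def using S T B C
    by (intro sum.cong refl expand) (auto simp: span_base)
  also have "\<dots> = (\<Sum>c\<in>C. \<Sum>b\<in>B. representation B (T c) b * representation C (S b) c)"
    by (subst sum.swap) (simp add: mult.commute)
  also have "\<dots> = trace_on scale C (\<lambda>x. S (T x))"
    unfolding trace_on_def using S T B C
    by (intro sum.cong refl expand[symmetric]) (auto simp: span_base)
  finally show ?thesis .
qed

text \<open>Factoring a projection through its image and commuting the two factors turns its trace into
  the trace of an identity map.\<close>

lemma trace_on_projection:
  assumes B: "finite B" "independent B" and C: "finite C" "independent C"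
    and sub: "C \<subseteq> span B" and P: "Vector_Spaces.linear scale scale P" "P ` span B \<subseteq> span C"
    and fixed: "\<And>c. c \<in> C \<Longrightarrow> P c = c"
  shows "trace_on scale B P = of_nat (card C)"
proof -
  have "trace_on scale B P = trace_on scale C P"
    using trace_on_commute[OF B C P linear_ident] sub by (auto simp: span_minimal)
  also have "\<dots> = (\<Sum>c\<in>C. 1)"
    unfolding trace_on_def by (intro sum.cong refl) (simp add: fixed representation_basis[OF C(2)])
  finally show ?thesis by simp
qed

lemma trace_on_sum_scale:
  assumes B: "independent B" and T: "\<And>i b. i \<in> I \<Longrightarrow> b \<in> B \<Longrightarrow> T i b \<in> span B"
  shows "trace_on scale B (\<lambda>x. scale c (\<Sum>i\<in>I. T i x)) = c * (\<Sum>i\<in>I. trace_on scale B (T i))"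
proof -
  have "representation B (scale c (\<Sum>i\<in>I. T i b)) b = c * (\<Sum>i\<in>I. representation B (T i b) b)"
    if "b \<in> B" for b
    using T that by (simp add: representation_scale[OF B span_sum] representation_sum[OF B])
  then show ?thesis
    unfolding trace_on_def by (simp add: sum_distrib_left sum.swap[of _ B I])
qed

end

lemma conj_class_eq_iff:
  fixes G (structure)
  assumes "group G" "x \<in> carrier G" "y \<in> carrier G"
  shows "conj_class G x = conj_class G y \<longleftrightarrow> x \<in> conj_class G y"
proof -
  interpret group G by fact
  have self: "z \<in> conj_class G z" if "z \<in> carrier G" for z
    using that unfolding conj_class_def by (auto intro!: exI[of _ "\<one>"])
  have trans: "conj_class G u \<subseteq> conj_class G v" if "u \<in> conj_class G v" "v \<in> carrier G" for u v
  proof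
    fix w assume "w \<in> conj_class G u"
    then obtain h where h: "h \<in> carrier G" "w = h \<otimes> u \<otimes> inv h"
      by (auto simp: conj_class_def)
    from that obtain k where k: "k \<in> carrier G" "u = k \<otimes> v \<otimes> inv k"
      by (auto simp: conj_class_def)
    have "w = (h \<otimes> k) \<otimes> v \<otimes> inv (h \<otimes> k)"
      using h k that(2) by (simp add: m_assoc inv_mult_group)
    then show "w \<in> conj_class G v"
      unfolding conj_class_def using h(1) k(1) by blast
  qed
  have sym: "v \<in> conj_class G u" if "u \<in> conj_class G v" "v \<in> carrier G" for u v
  proof -
    from that obtain k where k: "k \<in> carrier G" "u = k \<otimes> v \<otimes> inv k"
      by (auto simp: conj_class_def)
    have "v = inv k \<otimes> u \<otimes> inv (inv k)"
      using k that(2) by (simp add: m_assoc) (simp add: m_assoc[symmetric])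
    then show ?thesis unfolding conj_class_def using k(1) by blast
  qed
  show ?thesis using assms(2,3) self trans sym by blast
qed

text \<open>A class function takes one value on each conjugacy class, and the classes meet both subgroups in
  equally many elements.\<close>

lemma almost_conjugate_sum_class_function:
  fixes G (structure)
  assumes G: "group G" "finite (carrier G)"
    and H: "H1 \<subseteq> carrier G" "H2 \<subseteq> carrier G" "almost_conjugate G H1 H2"
    and f: "\<And>h x. h \<in> carrier G \<Longrightarrow> x \<in> carrier G \<Longrightarrow>
      f (h \<otimes> x \<otimes> inv h) = (f x :: 'k::comm_ring_1)"
  shows "sum f H1 = sum f H2"
proof -
  have by_classes: "sum f H = (\<Sum>K \<in> conj_class G ` carrier G.
      of_nat (card (K \<inter> H)) * f (SOME x. x \<in> carrier G \<and> K = conj_class G x))"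
    if H: "H \<subseteq> carrier G" for H
  proof -
    have "sum f H = (\<Sum>K \<in> conj_class G ` carrier G. \<Sum>x | x \<in> H \<and> conj_class G x = K. f x)"
      using G(2) H by (intro sum.group[symmetric]) (auto intro: finite_subset)
    also have "\<dots> = (\<Sum>K \<in> conj_class G ` carrier G. \<Sum>x \<in> K \<inter> H.
        f (SOME x. x \<in> carrier G \<and> K = conj_class G x))"
    proof (intro sum.cong refl)
      fix K assume "K \<in> conj_class G ` carrier G"
      then obtain y where "y \<in> carrier G" "K = conj_class G y" by auto
      then have y: "(SOME x. x \<in> carrier G \<and> K = conj_class G x) \<in> carrier G"
        "K = conj_class G (SOME x. x \<in> carrier G \<and> K = conj_class G x)"
        by (metis (mono_tags, lifting) someI)+
      define z where "z = (SOME x. x \<in> carrier G \<and> K = conj_class G x)"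
      show "{x \<in> H. conj_class G x = K} = K \<inter> H"
        using conj_class_eq_iff[OF G(1)] y H by blast
      fix x assume "x \<in> K \<inter> H"
      then have "x \<in> conj_class G z" using y by (simp add: z_def)
      then show "f x = f (SOME x. x \<in> carrier G \<and> K = conj_class G x)"
        using f y(1)
        by (fold z_def) (auto simp: conj_class_def)
    qed
    finally show ?thesis by simp
  qed
  have "card (K \<inter> H1) = card (K \<inter> H2)" if "K \<in> conj_class G ` carrier G" for K
    using that H(3) by (auto simp: almost_conjugate_def)
  then show ?thesis by (simp add: by_classes H)
qed

text \<open>Averaging over \<open>H\<close> projects onto the fixed vectors of \<open>H\<close>, so on an invariant space of
  finite dimension the fixed space has dimension \<open>1/|H|\<close> times the sum of the character over \<open>H\<close>.
  An independent set of fixed vectors lies in such a space, the span of its translates.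
  The operators compose contravariantly, as pullbacks do.\<close>

lemma almost_conjugate_fixed_independent:
  fixes G (structure) and scale :: "'k::field_char_0 \<Rightarrow> 'v::ab_group_add \<Rightarrow> 'v"
  assumes vs: "vector_space scale"
    and G: "group G" "finite (carrier G)"
    and H1: "subgroup H1 G" and H2: "subgroup H2 G" and ac: "almost_conjugate G H1 H2"
    and V: "module.subspace scale V"
    and lin: "\<And>g. g \<in> carrier G \<Longrightarrow> Vector_Spaces.linear scale scale (\<rho> g)"
    and inv: "\<And>g v. g \<in> carrier G \<Longrightarrow> v \<in> V \<Longrightarrow> \<rho> g v \<in> V"
    and anti: "\<And>g h v. g \<in> carrier G \<Longrightarrow> h \<in> carrier G \<Longrightarrow> v \<in> V \<Longrightarrow>
      \<rho> (g \<otimes> h) v = \<rho> h (\<rho> g v)"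
    and one: "\<And>v. v \<in> V \<Longrightarrow> \<rho> \<one> v = v"
    and B1: "finite B1" "\<not> module.dependent scale B1" "B1 \<subseteq> {v \<in> V. \<forall>h\<in>H1. \<rho> h v = v}"
  obtains B2 where "finite B2" "card B2 = card B1" "\<not> module.dependent scale B2"
    "B2 \<subseteq> {v \<in> V. \<forall>h\<in>H2. \<rho> h v = v}"
proof -
  interpret vector_space scale by fact
  interpret G: group G by fact
  define Fix where "Fix H = {v \<in> V. \<forall>h\<in>H. \<rho> h v = v}" for H
  define S where "S = (\<Union>g\<in>carrier G. \<rho> g ` B1)"
  have B1V: "B1 \<subseteq> V" using B1 by auto
  have S: "finite S" "S \<subseteq> V"
    using B1V inv G(2) B1(1) unfolding S_def by auto
  have B1S: "B1 \<subseteq> S"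
    unfolding S_def using B1V one by (force intro!: bexI[of _ "\<one>"])
  have S_inv: "\<rho> g ` span S \<subseteq> span S" if g: "g \<in> carrier G" for g
  proof -
    interpret \<rho>g: Vector_Spaces.linear scale scale "\<rho> g" using lin[OF g] .
    have "\<rho> g ` S \<subseteq> S"
    proof safe
      fix x assume "x \<in> S"
      then obtain h b where hb: "h \<in> carrier G" "b \<in> B1" "x = \<rho> h b" by (auto simp: S_def)
      then have "\<rho> g x = \<rho> (h \<otimes> g) b" using anti[of h g b] g B1V by auto
      then show "\<rho> g x \<in> S" using hb g by (auto simp: S_def)
    qed
    then have "span (\<rho> g ` S) \<subseteq> span S" by (simp add: span_mono)
    then show ?thesis by (simp add: \<rho>g.span_image)
  qed
  have SV: "span S \<subseteq> V" using S V by (simp add: span_minimal)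
  obtain B where B: "B \<subseteq> span S" "independent B" "span S \<subseteq> span B"
    using basis_exists by metis
  then have finB: "finite B" using S(1) independent_span_bound by blast
  have spB: "span B = span S" using B by (metis order_antisym span_minimal subspace_span)
  have BV: "span B \<subseteq> V" using SV spB by simp
  define character where "character g = trace_on scale B (\<rho> g)" for g
  have class_fun: "character (h \<otimes> x \<otimes> inv h) = character x" if h: "h \<in> carrier G" and x: "x \<in> carrier G"
      for h x
  proof -
    let ?k = "inv h"
    have k: "?k \<in> carrier G" using h by simp
    have "character (h \<otimes> x \<otimes> ?k) = trace_on scale B (\<lambda>v. \<rho> ?k (\<rho> x (\<rho> h v)))"
      unfolding character_def trace_on_def
    proof (intro sum.cong refl)
      fix b assume "b \<in> B"
      then have b: "b \<in> V" using BV span_base by blast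
      then show "representation B (\<rho> (h \<otimes> x \<otimes> ?k) b) b
          = representation B (\<rho> ?k (\<rho> x (\<rho> h b))) b"
        using h x by (simp add: anti)
    qed
    also have "\<dots> = trace_on scale B (\<lambda>v. \<rho> x (\<rho> h (\<rho> ?k v)))"
      using trace_on_commute[of B B "\<lambda>v. \<rho> x (\<rho> h v)" "\<rho> ?k"] finB B(2) h x k lin
        S_inv[OF h] S_inv[OF x] S_inv[OF k] spB
        Vector_Spaces.linear_compose[OF lin[OF h] lin[OF x]] by (auto simp: o_def)
    also have "\<dots> = character x"
      unfolding character_def trace_on_def
    proof (intro sum.cong refl)
      fix b assume "b \<in> B"
      then have b: "b \<in> V" using BV span_base by blast
      have "\<rho> h (\<rho> ?k b) = \<rho> (?k \<otimes> h) b" using anti[OF k h b] by simp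
      then have "\<rho> h (\<rho> ?k b) = b" using h one[OF b] by simp
      then show "representation B (\<rho> x (\<rho> h (\<rho> ?k b))) b = representation B (\<rho> x b) b" by simp
    qed
    finally show ?thesis .
  qed
  have dim_fix: "of_nat (card C) = 1 / of_nat (card H) * (\<Sum>h\<in>H. character h)" "finite C"
    if H: "subgroup H G" and C: "C \<subseteq> Fix H \<inter> span B" "independent C" "Fix H \<inter> span B \<subseteq> span C"
    for H C
  proof -
    have HG: "H \<subseteq> carrier G" using H by (rule subgroup.subset)
    have finH: "finite H" using HG G(2) finite_subset by blast
    have H0: "card H \<noteq> 0" using finH subgroup.one_closed[OF H] by auto
    show finC: "finite C" using C finB independent_span_bound by (meson inf.boundedE)
    define P where "P v = scale (1 / of_nat (card H)) (\<Sum>h\<in>H. \<rho> h v)" for v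
    have linP: "Vector_Spaces.linear scale scale P"
      unfolding Vector_Spaces.linear_iff P_def using lin HG vs
      by (auto simp: Vector_Spaces.linear_iff scale_right_distrib sum.distrib scale_sum_right subset_iff mult.commute
          intro!: sum.cong)
    have in_span: "\<rho> h v \<in> span B" if "h \<in> H" "v \<in> span B" for h v
      using S_inv HG that spB by blast
    have Pfix: "P v = v" if "v \<in> Fix H" for v
      using that H0 by (simp add: P_def Fix_def sum_constant_scale)
    have Pimg: "P v \<in> Fix H" if v: "v \<in> V" for v
    proof -
      have "\<rho> k (P v) = P v" if k: "k \<in> H" for k
      proof -
        have kG: "k \<in> carrier G" using k HG by auto
        interpret \<rho>k: Vector_Spaces.linear scale scale "\<rho> k" using lin[OF kG] .
        have "\<rho> k (P v) = scale (1 / of_nat (card H)) (\<Sum>h\<in>H. \<rho> k (\<rho> h v))"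
          by (simp add: P_def \<rho>k.scale \<rho>k.sum)
        also have "(\<Sum>h\<in>H. \<rho> k (\<rho> h v)) = (\<Sum>h\<in>H. \<rho> (h \<otimes> k) v)"
          using anti kG HG v by (intro sum.cong) (auto simp: subset_iff)
        also have "\<dots> = (\<Sum>h\<in>H. \<rho> h v)"
        proof (rule sum.reindex_bij_witness[of _ "\<lambda>h. h \<otimes> inv k" "\<lambda>h. h \<otimes> k"])
          fix h assume h: "h \<in> H"
          then have "h \<in> carrier G" using HG by auto
          then show "h \<otimes> k \<otimes> inv k = h" "h \<otimes> inv k \<otimes> k = h"
            using kG by (simp_all add: G.m_assoc)
          show "h \<otimes> inv k \<in> H" "h \<otimes> k \<in> H"
            using h k H by (auto simp: subgroup.m_closed subgroup.m_inv_closed)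
        qed auto
        finally show ?thesis by (simp add: P_def)
      qed
      moreover have "P v \<in> V"
        unfolding P_def using inv HG v by (intro subspace_scale[OF V] subspace_sum[OF V]) auto
      ultimately show ?thesis by (simp add: Fix_def)
    qed
    have "P v \<in> span C" if "v \<in> span B" for v
    proof -
      have "P v \<in> span B" unfolding P_def using in_span that
        by (intro span_scale span_sum) auto
      then show ?thesis using Pimg C(3) BV that by blast
    qed
    then have "trace_on scale B P = of_nat (card C)"
      using C Pfix by (intro trace_on_projection finB B(2) finC linP) auto
    moreover have "trace_on scale B P = 1 / of_nat (card H) * (\<Sum>h\<in>H. character h)"
      unfolding P_def character_def using in_span
          by (intro trace_on_sum_scale B(2)) (auto simp: span_base)
    ultimately show "of_nat (card C) = 1 / of_nat (card H) * (\<Sum>h\<in>H. character h)" by simp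
  qed
  have HG: "H1 \<subseteq> carrier G" "H2 \<subseteq> carrier G" using H1 H2 by (auto dest: subgroup.subset)
  have "B1 \<subseteq> Fix H1 \<inter> span B" using B1 B1S spB span_base by (auto simp: Fix_def)
  then obtain C1 where C1: "B1 \<subseteq> C1" "C1 \<subseteq> Fix H1 \<inter> span B" "independent C1" "Fix H1 \<inter> span B \<subseteq> span C1"
    using B1(2) maximal_independent_subset_extend by metis
  obtain C2 where C2: "C2 \<subseteq> Fix H2 \<inter> span B" "independent C2" "Fix H2 \<inter> span B \<subseteq> span C2"
    using maximal_independent_subset by metis
  have "sum character H1 = sum character H2"
    using almost_conjugate_sum_class_function[OF G HG ac, of character] class_fun by simp
  moreover have "(\<Sum>h\<in>H1. 1 :: 'k) = (\<Sum>h\<in>H2. 1)"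
    by (rule almost_conjugate_sum_class_function[OF G HG ac]) simp
  ultimately have "(of_nat (card C1) :: 'k) = of_nat (card C2)"
    using dim_fix(1)[OF H1 C1(2-4)] dim_fix(1)[OF H2 C2] by simp
  then have "card C1 = card C2" by simp
  moreover have "card B1 \<le> card C1" using C1(1) dim_fix(2)[OF H1 C1(2-4)] by (rule card_mono[rotated])
  ultimately obtain B2 where B2: "B2 \<subseteq> C2" "card B2 = card B1"
    using obtain_subset_with_card_n by metis
  show ?thesis
  proof (rule that)
    show "finite B2" using B2(1) dim_fix(2)[OF H2 C2] finite_subset by blast
    show "independent B2" using B2(1) C2(2) independent_mono by blast
    show "B2 \<subseteq> {v \<in> V. \<forall>h\<in>H2. \<rho> h v = v}" using B2(1) C2(1) by (auto simp: Fix_def)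
  qed (rule B2(2))
qed

text \<open>A multiplicity, finite or infinite, is the supremum of the sizes of finite independent sets
  of eigenvectors, and \<open>c\<close> is an eigenvalue exactly if the size \<open>1\<close> occurs.\<close>

lemma isospectralI:
  assumes ST: "\<And>c D. finite D \<Longrightarrow> form_space.independent D \<Longrightarrow> D \<subseteq> eigenspace S A c \<Longrightarrow>
      \<exists>E. finite E \<and> card E = card D \<and> form_space.independent E \<and> E \<subseteq> eigenspace T B c"
    and TS: "\<And>c D. finite D \<Longrightarrow> form_space.independent D \<Longrightarrow> D \<subseteq> eigenspace T B c \<Longrightarrow>
      \<exists>E. finite E \<and> card E = card D \<and> form_space.independent E \<and> E \<subseteq> eigenspace S A c"
  shows "isospectral S A T B"
proof -
  have eigenvalue: "c \<in> eigenvalues T' B'"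
    if c: "c \<in> eigenvalues S' A'" and S'T': "\<And>D. finite D \<Longrightarrow> form_space.independent D \<Longrightarrow>
      D \<subseteq> eigenspace S' A' c \<Longrightarrow>
      \<exists>E. finite E \<and> card E = card D \<and> form_space.independent E \<and> E \<subseteq> eigenspace T' B' c"
    for c and S' :: "('i, 'v) diff_form \<Rightarrow> ('i, 'v) diff_form" and A'
      and T' :: "('j, 'w) diff_form \<Rightarrow> ('j, 'w) diff_form" and B'
  proof -
    obtain \<omega> where "\<omega> \<in> eigenspace S' A' c" "\<omega> \<noteq> 0" using c by (auto simp: eigenvalues_def)
    then obtain E where E: "card E = 1" "form_space.independent E" "E \<subseteq> eigenspace T' B' c"
      using S'T'[of "{\<omega>}"] by auto
    then obtain \<eta> where "E = {\<eta>}" by (metis card_1_singletonE)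
    then show ?thesis using E by (auto simp: eigenvalues_def)
  qed
  have finite_dim: "(\<exists>F. finite F \<and> eigenspace T' B' c \<subseteq> form_space.span F) \<and>
      form_space.dim (eigenspace T' B' c) \<le> form_space.dim (eigenspace S' A' c)"
    if F: "finite F" "eigenspace S' A' c \<subseteq> form_space.span F" and T'S': "\<And>D. finite D \<Longrightarrow>
      form_space.independent D \<Longrightarrow> D \<subseteq> eigenspace T' B' c \<Longrightarrow>
      \<exists>E. finite E \<and> card E = card D \<and> form_space.independent E \<and> E \<subseteq> eigenspace S' A' c"
    for c F and S' :: "('i, 'v) diff_form \<Rightarrow> ('i, 'v) diff_form" and A'
      and T' :: "('j, 'w) diff_form \<Rightarrow> ('j, 'w) diff_form" and B'
  proof -
    obtain D1 where D1: "D1 \<subseteq> eigenspace S' A' c" "form_space.independent D1"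
      "eigenspace S' A' c \<subseteq> form_space.span D1" "card D1 = form_space.dim (eigenspace S' A' c)"
      using form_space.basis_exists by blast
    obtain D2 where D2: "D2 \<subseteq> eigenspace T' B' c" "form_space.independent D2"
      "eigenspace T' B' c \<subseteq> form_space.span D2" "card D2 = form_space.dim (eigenspace T' B' c)"
      using form_space.basis_exists by blast
    have finD1: "finite D1" using form_space.independent_span_bound[OF F(1) D1(2)] D1(1) F(2) by auto
    have bound: "card D \<le> card D1" if D: "finite D" "D \<subseteq> D2" for D
    proof -
      have "form_space.independent D" using D D2(2) form_space.independent_mono by blast
      then obtain E where "card E = card D" "form_space.independent E" "E \<subseteq> eigenspace S' A' c"
        using T'S'[of D] D D2(1) by blast
      then show ?thesis using form_space.independent_span_bound[OF finD1, of E] D1(3) by auto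
    qed
    have "finite D2"
      using bound infinite_arbitrarily_large[of D2 "Suc (card D1)"] by fastforce
    then show ?thesis using D2 D1(4) bound[of D2] by auto
  qed
  have "multiplicity_of S A c = multiplicity_of T B c" for c
    unfolding multiplicity_of_def using finite_dim[OF _ _ TS] finite_dim[OF _ _ ST]
    by (smt (verit, best) order_antisym)
  then show ?thesis
    unfolding isospectral_def using eigenvalue[OF _ ST] eigenvalue[OF _ TS] by blast
qed

section \<open>Calculus of smooth functions\<close>

abbreviation fderiv :: "('u::real_normed_vector \<Rightarrow> 'v::real_normed_vector) \<Rightarrow> 'u \<Rightarrow> 'u \<Rightarrow> 'v" where
  "fderiv f x \<equiv> frechet_derivative f (at x)"

lemma frechet_derivative_eqI:
  "(f has_derivative f') (at x) \<Longrightarrow> fderiv f x = f'"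
  using frechet_derivative_at by metis

lemma frechet_derivative_cong_on_open:
  assumes "open S" "x \<in> S" "\<And>y. y \<in> S \<Longrightarrow> f y = g y"
  shows "fderiv f x = fderiv g x"
proof -
  have "(f has_derivative D) (at x) \<longleftrightarrow> (g has_derivative D) (at x)" for D
    using has_derivative_transform_within_open[of f D x UNIV S g]
      has_derivative_transform_within_open[of g D x UNIV S f] assms by auto
  then show ?thesis unfolding frechet_derivative_def by simp
qed

lemma differentiable_cong_on_open:
  assumes "open S" "x \<in> S" "\<And>y. y \<in> S \<Longrightarrow> f y = g y"
  shows "f differentiable (at x) \<longleftrightarrow> g differentiable (at x)"
  unfolding differentiable_def
  using has_derivative_transform_within_open[of f _ x UNIV S g]
      has_derivative_transform_within_open[of g _ x UNIV S f] assms by auto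

lemma Ck_on_cong:
  assumes "open S" "\<And>y. y \<in> S \<Longrightarrow> f y = g y"
  shows "Ck_on k f S \<longleftrightarrow> Ck_on k g S"
  using assms(2)
proof (induction k arbitrary: f g)
  case 0
  then show ?case by (simp cong: continuous_on_cong)
next
  case (Suc k)
  have "fderiv f y = fderiv g y" if "y \<in> S" for y
    using frechet_derivative_cong_on_open[OF assms(1) that] Suc.prems by auto
  then have "Ck_on k (\<lambda>x. fderiv f x v) S
      \<longleftrightarrow> Ck_on k (\<lambda>x. fderiv g x v) S" for v
    by (intro Suc.IH) simp
  moreover have "f differentiable (at y) \<longleftrightarrow> g differentiable (at y)" if "y \<in> S" for y
    using differentiable_cong_on_open[OF assms(1) that] Suc.prems by auto
  ultimately show ?case by simp
qed

lemma smooth_on_cong: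
  "open S \<Longrightarrow> (\<And>y. y \<in> S \<Longrightarrow> f y = g y) \<Longrightarrow> smooth_on f S \<longleftrightarrow> smooth_on g S"
  unfolding smooth_on_def using Ck_on_cong by blast

lemma Ck_on_subset: "Ck_on k f S \<Longrightarrow> T \<subseteq> S \<Longrightarrow> Ck_on k f T"
  by (induction k arbitrary: f) (auto intro: continuous_on_subset)

lemma smooth_on_subset: "smooth_on f S \<Longrightarrow> T \<subseteq> S \<Longrightarrow> smooth_on f T"
  unfolding smooth_on_def using Ck_on_subset by blast

lemma Ck_on_SucD: "Ck_on (Suc k) f S \<Longrightarrow> Ck_on k f S"
proof (induction k arbitrary: f)
  case 0
  then show ?case
    by (auto intro!: continuous_at_imp_continuous_on differentiable_imp_continuous_within)
next
  case (Suc k)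
  have "\<forall>x\<in>S. f differentiable (at x)"
    "\<And>v. Ck_on (Suc k) (\<lambda>x. fderiv f x v) S"
    using Suc.prems unfolding Ck_on.simps(2)[of "Suc k" f S] by blast+
  then show ?case unfolding Ck_on.simps(2)[of k f S] using Suc.IH by blast
qed

lemma Ck_on_add:
  "Ck_on k f S \<Longrightarrow> Ck_on k g S \<Longrightarrow> open S \<Longrightarrow> Ck_on k (\<lambda>x. f x + g x) S"
proof (induction k arbitrary: f g)
  case (Suc k)
  then have d: "f differentiable (at x)" "g differentiable (at x)" if "x \<in> S" for x
    using that by auto
  have "fderiv (\<lambda>x. f x + g x) x v
      = fderiv f x v + fderiv g x v" if "x \<in> S" for x v
    using frechet_derivative_eqI[OF has_derivative_add[OF d(1)[OF that, unfolded frechet_derivative_works]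
          d(2)[OF that, unfolded frechet_derivative_works]]] by simp
  then have "Ck_on k (\<lambda>x. fderiv (\<lambda>x. f x + g x) x v) S
      \<longleftrightarrow> Ck_on k (\<lambda>x. fderiv f x v + fderiv g x v) S" for v
    by (intro Ck_on_cong Suc.prems(3)) auto
  then show ?case using Suc d by (auto intro!: differentiable_add)
qed (auto intro: continuous_on_add)

lemma (in bounded_bilinear) Ck_on:
  "Ck_on k f S \<Longrightarrow> Ck_on k g S \<Longrightarrow> open S \<Longrightarrow> Ck_on k (\<lambda>x. prod (f x) (g x)) S"
proof (induction k arbitrary: f g)
  case (Suc k)
  then have d: "(f has_derivative fderiv f x) (at x)"
      "(g has_derivative fderiv g x) (at x)" if "x \<in> S" for x
    using that by (auto simp flip: frechet_derivative_works)
  have D: "((\<lambda>x. prod (f x) (g x)) has_derivative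
      (\<lambda>v. prod (f x) (fderiv g x v) + prod (fderiv f x v) (g x))) (at x)"
    if "x \<in> S" for x using FDERIV[OF d[OF that]] by simp
  have "Ck_on k f S" "Ck_on k g S" using Suc.prems Ck_on_SucD by blast+
  then have "Ck_on k (\<lambda>x. prod (f x) (fderiv g x v)
      + prod (fderiv f x v) (g x)) S" for v
    using Suc.prems by (intro Ck_on_add Suc.IH) auto
  moreover have "Ck_on k (\<lambda>x. fderiv (\<lambda>x. prod (f x) (g x)) x v) S
      \<longleftrightarrow> Ck_on k (\<lambda>x. prod (f x) (fderiv g x v)
      + prod (fderiv f x v) (g x)) S" for v
    using frechet_derivative_eqI[OF D] by (intro Ck_on_cong Suc.prems(3)) auto
  ultimately show ?case using D by (auto simp: differentiable_def)
qed (auto intro: continuous_on)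

lemma Ck_on_const: "Ck_on k (\<lambda>x. c) S"
  by (induction k arbitrary: c) (auto simp: frechet_derivative_const)

lemma smooth_on_const: "smooth_on (\<lambda>x. c) S"
  by (simp add: smooth_on_def Ck_on_const)

lemma smooth_on_add:
  "smooth_on f S \<Longrightarrow> smooth_on g S \<Longrightarrow> open S \<Longrightarrow> smooth_on (\<lambda>x. f x + g x) S"
  by (simp add: smooth_on_def Ck_on_add)

lemma (in bounded_bilinear) smooth_on:
  "smooth_on f S \<Longrightarrow> smooth_on g S \<Longrightarrow> open S \<Longrightarrow> smooth_on (\<lambda>x. prod (f x) (g x)) S"
  by (simp add: smooth_on_def Ck_on)

lemmas smooth_on_mult = bounded_bilinear.smooth_on[OF bounded_bilinear_mult]
lemmas smooth_on_scaleR = bounded_bilinear.smooth_on[OF bounded_bilinear_scaleR]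

lemma smooth_on_minus:
  fixes f :: "_ \<Rightarrow> 'b::real_normed_vector"
  shows "smooth_on f S \<Longrightarrow> open S \<Longrightarrow> smooth_on (\<lambda>x. - f x) S"
  using smooth_on_scaleR[OF smooth_on_const[of "-1"]] by fastforce

lemma smooth_on_sum:
  "(\<And>i. i \<in> I \<Longrightarrow> smooth_on (f i) S) \<Longrightarrow> open S \<Longrightarrow> smooth_on (\<lambda>x. \<Sum>i\<in>I. f i x) S"
  by (induction I rule: infinite_finite_induct) (auto intro: smooth_on_const smooth_on_add)

lemma smooth_on_prod:
  fixes f :: "_ \<Rightarrow> _ \<Rightarrow> 'b::{real_normed_algebra,comm_ring_1}"
  shows "(\<And>i. i \<in> I \<Longrightarrow> smooth_on (f i) S) \<Longrightarrow> open S \<Longrightarrow> smooth_on (\<lambda>x. \<Prod>i\<in>I. f i x) S"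
  by (induction I rule: infinite_finite_induct) (auto intro: smooth_on_const smooth_on_mult)

lemma smooth_on_differentiable: "smooth_on f S \<Longrightarrow> x \<in> S \<Longrightarrow> f differentiable (at x)"
  unfolding smooth_on_def using Ck_on.simps(2)[of 0 f S] by blast

lemma smooth_on_has_derivative:
  "smooth_on f S \<Longrightarrow> x \<in> S \<Longrightarrow> (f has_derivative fderiv f x) (at x)"
  using smooth_on_differentiable frechet_derivative_works by blast

lemma smooth_on_linear_derivative:
  "smooth_on f S \<Longrightarrow> x \<in> S \<Longrightarrow> linear (fderiv f x)"
  using smooth_on_has_derivative has_derivative_linear by blast

lemma smooth_on_continuous_on: "smooth_on f S \<Longrightarrow> continuous_on S f"
  unfolding smooth_on_def using Ck_on.simps(1)[of f S] by blast

lemma smooth_on_derivative: "smooth_on f S \<Longrightarrow> smooth_on (\<lambda>x. fderiv f x v) S"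
  unfolding smooth_on_def using Ck_on.simps(2)[of _ f S] by blast

lemma smooth_on_compose_linear:
  assumes L: "bounded_linear L" and f: "smooth_on f S" and S: "open S"
  shows "smooth_on (\<lambda>x. L (f x)) S"
proof -
  have "Ck_on k (\<lambda>x. L (f x)) S" if "smooth_on f S" for k f
    using that
  proof (induction k arbitrary: f)
    case 0
    then show ?case using bounded_linear.continuous_on[OF L smooth_on_continuous_on] by auto
  next
    case (Suc k)
    have D: "((\<lambda>x. L (f x)) has_derivative (\<lambda>v. L (fderiv f x v))) (at x)"
      if "x \<in> S" for x
      using bounded_linear.has_derivative[OF L smooth_on_has_derivative[OF Suc.prems that]] .
    have "Ck_on k (\<lambda>x. fderiv (\<lambda>x. L (f x)) x v) S
        \<longleftrightarrow> Ck_on k (\<lambda>x. L (fderiv f x v)) S" for v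
      using frechet_derivative_eqI[OF D] by (intro Ck_on_cong S) auto
    moreover have "Ck_on k (\<lambda>x. L (fderiv f x v)) S" for v
      by (rule Suc.IH[OF smooth_on_derivative[OF Suc.prems]])
    ultimately show ?case using D by (auto simp: differentiable_def)
  qed
  then show ?thesis using f by (simp add: smooth_on_def)
qed

lemma frechet_derivative_compose:
  assumes "f differentiable (at (\<phi> x))" "\<phi> differentiable (at x)"
  shows "((\<lambda>x. f (\<phi> x)) has_derivative
    (\<lambda>v. fderiv f (\<phi> x) (fderiv \<phi> x v))) (at x)"
  using diff_chain_at[of \<phi> _ x f] assms unfolding frechet_derivative_works o_def by blast

text \<open>In a basis, the chain rule writes a directional derivative of \<open>f \<circ> \<phi>\<close> as a sum of products
  of derivatives of \<open>\<phi>\<close> with derivatives of \<open>f\<close> composed with \<open>\<phi>\<close>, to which induction applies.\<close>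

lemma smooth_on_compose:
  fixes \<phi> :: "'u::real_normed_vector \<Rightarrow> 'v::euclidean_space"
    and f :: "'v \<Rightarrow> 'w::real_normed_vector"
  assumes f: "smooth_on f T" and \<phi>: "smooth_on \<phi> S" and S: "open S" and sub: "\<phi> ` S \<subseteq> T"
  shows "smooth_on (\<lambda>x. f (\<phi> x)) S"
proof -
  have "Ck_on k (\<lambda>x. f (\<phi> x)) S" if "smooth_on f T" for k and f :: "'v \<Rightarrow> 'w"
    using that
  proof (induction k arbitrary: f)
    case 0
    then show ?case
      using continuous_on_compose2[OF smooth_on_continuous_on smooth_on_continuous_on[OF \<phi>] sub] by auto
  next
    case (Suc k)
    have D: "((\<lambda>x. f (\<phi> x)) has_derivative
        (\<lambda>v. fderiv f (\<phi> x) (fderiv \<phi> x v))) (at x)"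
      if "x \<in> S" for x
      using that sub smooth_on_differentiable[OF Suc.prems, of "\<phi> x"] smooth_on_differentiable[OF \<phi>]
      by (intro frechet_derivative_compose) auto
    have expand: "fderiv (\<lambda>x. f (\<phi> x)) x v = (\<Sum>b\<in>Basis.
        (fderiv \<phi> x v \<bullet> b) *\<^sub>R fderiv f (\<phi> x) b)" if "x \<in> S" for x v
    proof -
      have "\<phi> x \<in> T" using that sub by auto
      then interpret linear "fderiv f (\<phi> x)"
        by (rule smooth_on_linear_derivative[OF Suc.prems])
      show ?thesis
        unfolding frechet_derivative_eqI[OF D[OF that]]
        by (subst euclidean_representation[symmetric, of "fderiv \<phi> x v"])
          (simp only: sum scaleR)
    qed
    have "Ck_on k (\<lambda>x. \<Sum>b\<in>Basis.
        (fderiv \<phi> x v \<bullet> b) *\<^sub>R fderiv f (\<phi> x) b) S" for v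
    proof -
      have Ck_sum: "Ck_on k (\<lambda>x. \<Sum>b\<in>I. g b x) S" if "\<And>b. b \<in> I \<Longrightarrow> Ck_on k (g b) S"
        for I :: "'v set" and g :: "'v \<Rightarrow> 'u \<Rightarrow> 'w"
        using that by (induction I rule: infinite_finite_induct) (auto intro: Ck_on_const Ck_on_add S)
      have "smooth_on (\<lambda>x. fderiv \<phi> x v \<bullet> b) S" for b
        using smooth_on_compose_linear[OF bounded_linear_inner_left smooth_on_derivative[OF \<phi>] S] .
      then have "Ck_on k (\<lambda>x. fderiv \<phi> x v \<bullet> b) S" for b
        by (simp add: smooth_on_def)
      then have "Ck_on k (\<lambda>x. (fderiv \<phi> x v \<bullet> b)
          *\<^sub>R fderiv f (\<phi> x) b) S" for b
        using bounded_bilinear.Ck_on[OF bounded_bilinear_scaleR _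
            Suc.IH[OF smooth_on_derivative[OF Suc.prems]] S] by blast
      then show ?thesis using Ck_sum by simp
    qed
    then have "Ck_on k (\<lambda>x. fderiv (\<lambda>x. f (\<phi> x)) x v) S" for v
      by (subst Ck_on_cong[OF S expand])
    then show ?case using D by (auto simp: differentiable_def)
  qed
  then show ?thesis using f by (simp add: smooth_on_def)
qed

lemma smooth_on_inverse:
  fixes f :: "'u::real_normed_vector \<Rightarrow> real"
  assumes f: "smooth_on f S" and S: "open S" and nz: "\<And>x. x \<in> S \<Longrightarrow> f x \<noteq> 0"
  shows "smooth_on (\<lambda>x. inverse (f x)) S"
proof -
  have "Ck_on k (\<lambda>x. inverse (f x)) S" for k
  proof (induction k)
    case 0
    then show ?case using smooth_on_continuous_on[OF f] nz by (auto intro!: continuous_on_inverse)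
  next
    case (Suc k)
    have D: "((\<lambda>x. inverse (f x)) has_derivative
        (\<lambda>v. - (inverse (f x) * fderiv f x v * inverse (f x)))) (at x)" if "x \<in> S" for x
      using Deriv.has_derivative_inverse[OF nz[OF that] smooth_on_has_derivative[OF f that]] .
    have "Ck_on k (\<lambda>x. (-1) * (inverse (f x) * fderiv f x v * inverse (f x))) S" for v
      using Suc smooth_on_derivative[OF f]
      by (intro bounded_bilinear.Ck_on[OF bounded_bilinear_mult] S Ck_on_const) (auto simp: smooth_on_def)
    then have "Ck_on k (\<lambda>x. fderiv (\<lambda>x. inverse (f x)) x v) S" for v
      by (subst Ck_on_cong[OF S]) (auto simp: frechet_derivative_eqI[OF D])
    then show ?case using D by (auto simp: differentiable_def)
  qed
  then show ?thesis by (simp add: smooth_on_def)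
qed

text \<open>The real square root is an odd function, so \<open>sqrt' y = sqrt y / (2 y)\<close> on both half-lines.\<close>

lemma smooth_on_sqrt:
  fixes f :: "'u::real_normed_vector \<Rightarrow> real"
  assumes f: "smooth_on f S" and S: "open S" and nz: "\<And>x. x \<in> S \<Longrightarrow> f x \<noteq> 0"
  shows "smooth_on (\<lambda>x. sqrt (f x)) S"
proof -
  have "Ck_on k (\<lambda>x. sqrt (f x)) S" for k
  proof (induction k)
    case 0
    then show ?case using smooth_on_continuous_on[OF f] by (auto intro!: continuous_on_real_sqrt)
  next
    case (Suc k)
    have D: "((\<lambda>x. sqrt (f x)) has_derivative
        (\<lambda>v. fderiv f x v * (sqrt (f x) * inverse (2 * f x)))) (at x)"
      if "x \<in> S" for x
    proof -
      have "sqrt y * inverse (2 * y) = inverse (sqrt \<bar>y\<bar>) / 2" if "y \<noteq> 0" for y :: real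
        using that real_sqrt_mult_self[of y]
        by (cases "y > 0") (auto simp: field_simps real_sqrt_minus abs_if)
      then have "DERIV sqrt (f x) :> sqrt (f x) * inverse (2 * f x)"
        using nz[OF that] by (intro DERIV_real_sqrt_generic) (simp_all add: real_sqrt_minus)
      from DERIV_compose_FDERIV[OF this smooth_on_has_derivative[OF f that]]
      show ?thesis by simp
    qed
    have "smooth_on (\<lambda>x. inverse (2 * f x)) S"
      using nz by (intro smooth_on_inverse smooth_on_mult smooth_on_const f S) simp
    then have "Ck_on k (\<lambda>x. fderiv f x v * (sqrt (f x) * inverse (2 * f x))) S" for v
      using Suc smooth_on_derivative[OF f]
      by (intro bounded_bilinear.Ck_on[OF bounded_bilinear_mult] S) (auto simp: smooth_on_def)
    then have "Ck_on k (\<lambda>x. fderiv (\<lambda>x. sqrt (f x)) x v) S" for v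
      by (subst Ck_on_cong[OF S]) (auto simp: frechet_derivative_eqI[OF D])
    then show ?case using D by (auto simp: differentiable_def)
  qed
  then show ?thesis by (simp add: smooth_on_def)
qed

text \<open>Applying the mean value theorem in the direction \<open>u\<close> and then in the direction \<open>v\<close> turns the
  second difference into a mixed derivative at a nearby point. The second difference is symmetric
  in \<open>u\<close> and \<open>v\<close>, and the mixed derivatives are continuous.\<close>

lemma second_difference_eq_mixed_derivative:
  fixes f :: "'u::real_normed_vector \<Rightarrow> real"
  assumes f: "smooth_on f (ball z e)" and s: "s > 0" "s * (norm u + norm v) < e"
  obtains x where "x \<in> ball z e"
    "f (z + s *\<^sub>R u + s *\<^sub>R v) - f (z + s *\<^sub>R u) - f (z + s *\<^sub>R v) + f z
      = s * s * fderiv (\<lambda>x. fderiv f x u) x v"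
proof -
  have in_ball: "z + r *\<^sub>R u + t *\<^sub>R v \<in> ball z e" if "0 \<le> r" "r \<le> s" "0 \<le> t" "t \<le> s" for r t
  proof -
    have "norm (r *\<^sub>R u + t *\<^sub>R v) \<le> r * norm u + t * norm v"
      using norm_triangle_ineq[of "r *\<^sub>R u" "t *\<^sub>R v"] that by simp
    also have "\<dots> \<le> s * norm u + s * norm v"
      using that by (intro add_mono mult_right_mono) auto
    finally have "norm (r *\<^sub>R u + t *\<^sub>R v) < e" using s by (simp add: distrib_left)
    moreover have "dist z (z + r *\<^sub>R u + t *\<^sub>R v) = norm (r *\<^sub>R u + t *\<^sub>R v)"
      using norm_minus_cancel[of "r *\<^sub>R u + t *\<^sub>R v"] by (simp add: dist_norm add.assoc)
    ultimately show ?thesis by simp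
  qed
  let ?Du = "\<lambda>x. fderiv f x u"
  let ?g = "\<lambda>r. f (z + r *\<^sub>R u + s *\<^sub>R v) - f (z + r *\<^sub>R u)"
  have line: "((\<lambda>r. h (w + r *\<^sub>R d)) has_derivative (\<lambda>x. x * fderiv h (w + r *\<^sub>R d) d)) (at r)"
    if "smooth_on h (ball z e)" "w + r *\<^sub>R d \<in> ball z e" for h :: "'u \<Rightarrow> real" and w d r
  proof -
    interpret linear "fderiv h (w + r *\<^sub>R d)"
      by (rule smooth_on_linear_derivative[OF that])
    have "((\<lambda>r. w + r *\<^sub>R d) has_derivative (\<lambda>x. x *\<^sub>R d)) (at r)"
      by (auto intro!: derivative_eq_intros)
    from diff_chain_at[OF this smooth_on_has_derivative[OF that]]
    show ?thesis by (simp add: o_def scaleR)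
  qed
  have "(?g has_derivative (\<lambda>x. x
      * (?Du (z + r *\<^sub>R u + s *\<^sub>R v) - ?Du (z + r *\<^sub>R u)))) (at r within {0..s})"
    if "0 \<le> r" "r \<le> s" for r
  proof (rule has_derivative_at_withinI)
    have "z + r *\<^sub>R u \<in> ball z e" "(z + s *\<^sub>R v) + r *\<^sub>R u \<in> ball z e"
      using in_ball[of r 0] in_ball[of r s] that s by (auto simp: add.assoc add.commute[of "s *\<^sub>R v"])
    then show "(?g has_derivative (\<lambda>x. x * (?Du (z + r *\<^sub>R u + s *\<^sub>R v) - ?Du (z + r *\<^sub>R u)))) (at r)"
      using has_derivative_diff[OF line[OF f, of "z + s *\<^sub>R v"] line[OF f, of z]]
      by (simp add: algebra_simps)
  qed
  from mvt_simple[OF s(1) this] obtain r where r: "r \<in> {0<..<s}"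
    "?g s - ?g 0 = s * (?Du (z + r *\<^sub>R u + s *\<^sub>R v) - ?Du (z + r *\<^sub>R u))" by auto
  have "((\<lambda>t. ?Du (z + r *\<^sub>R u + t *\<^sub>R v)) has_derivative
      (\<lambda>x. x * fderiv ?Du (z + r *\<^sub>R u + t *\<^sub>R v) v)) (at t within {0..s})"
    if "0 \<le> t" "t \<le> s" for t
    using in_ball[of r t] that r(1)
    by (intro has_derivative_at_withinI[OF line[OF smooth_on_derivative[OF f]]]) simp
  from mvt_simple[OF s(1) this] obtain t where t: "t \<in> {0<..<s}"
    "?Du (z + r *\<^sub>R u + s *\<^sub>R v) - ?Du (z + r *\<^sub>R u)
      = s * fderiv ?Du (z + r *\<^sub>R u + t *\<^sub>R v) v" by auto
  show ?thesis
  proof (rule that)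
    show "z + r *\<^sub>R u + t *\<^sub>R v \<in> ball z e" using in_ball[of r t] r(1) t(1) by auto
    show "f (z + s *\<^sub>R u + s *\<^sub>R v) - f (z + s *\<^sub>R u) - f (z + s *\<^sub>R v) + f z
        = s * s * fderiv ?Du (z + r *\<^sub>R u + t *\<^sub>R v) v"
      using r(2) unfolding t(2) by simp
  qed
qed

lemma mixed_derivatives_commute_real:
  fixes f :: "'u::real_normed_vector \<Rightarrow> real"
  assumes f: "smooth_on f S" and S: "open S" and z: "z \<in> S"
  shows "fderiv (\<lambda>x. fderiv f x u) z v
    = fderiv (\<lambda>x. fderiv f x v) z u" (is "?P z = ?Q z")
proof (rule ccontr)
  assume neq: "?P z \<noteq> ?Q z"
  define \<delta> where "\<delta> = dist (?P z) (?Q z) / 2"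
  have \<delta>: "\<delta> > 0" using neq by (simp add: \<delta>_def)
  have "continuous_on S ?P" "continuous_on S ?Q"
    using f by (auto intro: smooth_on_continuous_on smooth_on_derivative)
  then have "isCont ?P z" "isCont ?Q z"
    using S z continuous_on_eq_continuous_at by blast+
  then obtain e1 e2 where e: "e1 > 0" "\<And>x. dist x z < e1 \<Longrightarrow> dist (?P x) (?P z) < \<delta>"
      "e2 > 0" "\<And>x. dist x z < e2 \<Longrightarrow> dist (?Q x) (?Q z) < \<delta>"
    unfolding continuous_at_eps_delta using \<delta> by blast
  obtain e3 where e3: "e3 > 0" "ball z e3 \<subseteq> S" using S z openE by blast
  define e where "e = min e1 (min e2 e3)"
  have e0: "e > 0" using e e3 by (simp add: e_def)
  define s where "s = e / (norm u + norm v + 1)"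
  have n: "norm u + norm v + 1 > 0" by (simp add: add_nonneg_pos)
  then have s0: "s > 0" using e0 by (simp add: s_def)
  have "s * (norm u + norm v) < s * (norm u + norm v + 1)" using s0 by simp
  also have "\<dots> = e" using n by (simp add: s_def)
  finally have s: "s * (norm u + norm v) < e" .
  have f': "smooth_on f (ball z e)" using e3 by (intro smooth_on_subset[OF f]) (auto simp: e_def)
  obtain x where x: "x \<in> ball z e"
    "f (z + s *\<^sub>R u + s *\<^sub>R v) - f (z + s *\<^sub>R u) - f (z + s *\<^sub>R v) + f z = s * s * ?P x"
    using second_difference_eq_mixed_derivative[OF f' s0 s] by blast
  obtain y where y: "y \<in> ball z e"
    "f (z + s *\<^sub>R v + s *\<^sub>R u) - f (z + s *\<^sub>R v) - f (z + s *\<^sub>R u) + f z = s * s * ?Q y"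
    using second_difference_eq_mixed_derivative[OF f' s0, of v u] s by (auto simp: add.commute)
  have "z + s *\<^sub>R u + s *\<^sub>R v = z + s *\<^sub>R v + s *\<^sub>R u" by (simp add: add.assoc add.commute)
  then have "s * s * ?P x = s * s * ?Q y" by (simp only: x(2)[symmetric] y(2)[symmetric])
  then have "?P x = ?Q y" using s0 by simp
  moreover have "dist (?P x) (?P z) < \<delta>" "dist (?Q y) (?Q z) < \<delta>"
    using x(1) y(1) e by (auto simp: e_def dist_commute)
  ultimately have "dist (?P z) (?Q z) < 2 * \<delta>"
    using dist_triangle3[of "?P z" "?Q z" "?P x"] by (simp add: dist_commute)
  then show False by (simp add: \<delta>_def)
qed

lemma mixed_derivatives_commute:
  fixes f :: "'u::real_normed_vector \<Rightarrow> 'w::euclidean_space"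
  assumes f: "smooth_on f S" and S: "open S" and z: "z \<in> S"
  shows "fderiv (\<lambda>x. fderiv f x u) z v
    = fderiv (\<lambda>x. fderiv f x v) z u"
proof (rule euclidean_eqI)
  fix b :: 'w
  have first: "fderiv (\<lambda>x. g x \<bullet> b) x u = fderiv g x u \<bullet> b"
    if "smooth_on g S" "x \<in> S" for g :: "'u \<Rightarrow> 'w" and x u
    using frechet_derivative_eqI[OF bounded_linear.has_derivative[OF bounded_linear_inner_left
          smooth_on_has_derivative[OF that]]] by simp
  have second: "fderiv (\<lambda>x. fderiv (\<lambda>x. f x \<bullet> b) x u) z v
      = fderiv (\<lambda>x. fderiv f x u) z v \<bullet> b" for u v
    using frechet_derivative_cong_on_open[OF S z first[OF f]] first[OF smooth_on_derivative[OF f] z]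
    by simp
  show "fderiv (\<lambda>x. fderiv f x u) z v \<bullet> b
      = fderiv (\<lambda>x. fderiv f x v) z u \<bullet> b"
    using mixed_derivatives_commute_real[OF
        smooth_on_compose_linear[OF bounded_linear_inner_left f S] S z, of b u v]
    by (simp add: second)
qed

section \<open>Multilinear fields and the exterior derivative\<close>

text \<open>Degrees are left open, because the operators of the exterior calculus read the degree off
  the number of arguments and act on functions which are multilinear on the lists of each length.\<close>

definition multilinear_form :: "'v::real_vector form_at \<Rightarrow> bool" where
  "multilinear_form \<alpha> \<longleftrightarrow> (\<forall>vs j. j < length vs \<longrightarrow> linear (\<lambda>v. \<alpha> (vs[j := v])))"

definition alternating :: "'v::real_vector form_at \<Rightarrow> bool" where
  "alternating \<alpha> \<longleftrightarrow> multilinear_form \<alpha> \<and>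
     (\<forall>vs i j. i < j \<longrightarrow> j < length vs \<longrightarrow> vs ! i = vs ! j \<longrightarrow> \<alpha> vs = 0)"

definition smooth_field :: "('u::real_normed_vector \<Rightarrow> 'v::real_vector form_at) \<Rightarrow> 'u set \<Rightarrow> bool" where
  "smooth_field \<alpha> S \<longleftrightarrow> (\<forall>y\<in>S. multilinear_form (\<alpha> y)) \<and> (\<forall>vs. smooth_on (\<lambda>y. \<alpha> y vs) S)"

definition pullback :: "('u::real_normed_vector \<Rightarrow> 'v::real_normed_vector) \<Rightarrow> ('v \<Rightarrow> 'v form_at) \<Rightarrow> 'u
    \<Rightarrow> 'u form_at" where
  "pullback \<phi> \<alpha> z vs = \<alpha> (\<phi> z) (map (fderiv \<phi> z) vs)"

abbreviation remove_nth :: "nat \<Rightarrow> 'v list \<Rightarrow> 'v list" where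
  "remove_nth j vs \<equiv> take j vs @ drop (Suc j) vs"

lemma multilinear_form_slot:
  assumes "multilinear_form \<alpha>" shows "linear (\<lambda>v. \<alpha> (xs @ v # zs))"
proof -
  have "linear (\<lambda>v. \<alpha> ((xs @ undefined # zs)[length xs := v]))"
    using assms unfolding multilinear_form_def
    by (metis length_append length_Cons less_add_Suc1 add_Suc_right)
  then show ?thesis by simp
qed

lemma multilinear_formI:
  assumes "\<And>xs zs. linear (\<lambda>v. \<alpha> (xs @ v # zs))" shows "multilinear_form \<alpha>"
  unfolding multilinear_form_def by (simp add: upd_conv_take_nth_drop assms)

lemma multilinear_form_Cons:
  assumes "multilinear_form \<alpha>" shows "multilinear_form (\<lambda>vs. \<alpha> (v # vs))"
  using multilinear_form_slot[OF assms, of "v # _"] by (intro multilinear_formI) simp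

lemma multilinear_form_expand_head:
  fixes \<alpha> :: "'v::euclidean_space form_at"
  assumes "multilinear_form \<alpha>"
  shows "\<alpha> (v # vs) = (\<Sum>b\<in>Basis. (v \<bullet> b) *\<^sub>R \<alpha> (b # vs))"
proof -
  interpret linear "\<lambda>v. \<alpha> (v # vs)" using multilinear_form_slot[OF assms, of "[]"] by simp
  show ?thesis
    by (subst (1) euclidean_representation[of v, symmetric]) (simp only: sum scaleR)
qed

lemma alternating_form_imp_alternating:
  assumes "alternating_form k \<alpha>" shows "alternating \<alpha>"
proof -
  have "linear (\<lambda>v. \<alpha> (vs[j := v]))" if "j < length vs" for vs j
    using assms that module_hom_zero
    by (cases "length vs = k") (auto simp: alternating_form_def)
  moreover have "\<alpha> vs = 0" if "i < j" "j < length vs" "vs ! i = vs ! j" for vs i j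
    using assms that by (cases "length vs = k") (auto simp: alternating_form_def)
  ultimately show ?thesis by (simp add: alternating_def multilinear_form_def)
qed

lemma alternating_swap_adjacent:
  assumes "alternating \<alpha>" shows "\<alpha> (xs @ a # b # zs) = - \<alpha> (xs @ b # a # zs)"
proof -
  have mult: "multilinear_form \<alpha>" using assms by (simp add: alternating_def)
  have eq0: "\<alpha> (xs @ c # c # zs) = 0" for c
  proof -
    have "(xs @ c # c # zs) ! length xs = (xs @ c # c # zs) ! Suc (length xs)"
      by (simp add: nth_append)
    then show ?thesis using assms unfolding alternating_def
      by (metis add_Suc_right length_Cons length_append lessI less_add_Suc1 Suc_less_eq)
  qed
  have first: "\<alpha> (xs @ (c + d) # e # zs) = \<alpha> (xs @ c # e # zs) + \<alpha> (xs @ d # e # zs)" for c d e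
    by (rule linear_add[OF multilinear_form_slot[OF mult]])
  have second: "\<alpha> (xs @ e # (c + d) # zs) = \<alpha> (xs @ e # c # zs) + \<alpha> (xs @ e # d # zs)" for c d e
    using linear_add[OF multilinear_form_slot[OF mult, of "xs @ [e]"]] by simp
  show ?thesis
    using eq0[of "a + b", unfolded first second] by (simp add: eq0 eq_neg_iff_add_eq_0 add.commute)
qed

lemma alternating_move:
  assumes "alternating \<alpha>"
  shows "\<alpha> (xs @ b # ys @ zs) = (-1) ^ length ys * \<alpha> (xs @ ys @ b # zs)"
proof (induction ys arbitrary: xs)
  case (Cons y ys)
  then show ?case
    using alternating_swap_adjacent[OF assms, of xs b y "ys @ zs"] Cons[of "xs @ [y]"] by simp
qed simp

text \<open>By induction on the argument list: expanding the first argument in a basis turns it into scalar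
  coefficients and leaves a form in the remaining arguments. The Leibniz rule below has the same proof.\<close>

lemma smooth_on_multilinear:
  fixes F :: "'u::real_normed_vector \<Rightarrow> 'v::euclidean_space form_at"
  assumes S: "open S" and "smooth_field F S"
    and "\<And>w. w \<in> set ws \<Longrightarrow> smooth_on w S"
  shows "smooth_on (\<lambda>y. F y (map (\<lambda>w. w y) ws)) S"
  using assms(2,3)
proof (induction ws arbitrary: F)
  case Nil
  then show ?case by (simp add: smooth_field_def)
next
  case (Cons w ws)
  have "smooth_on (\<lambda>y. \<Sum>b\<in>Basis. (w y \<bullet> b) *\<^sub>R F y (b # map (\<lambda>w. w y) ws)) S"
  proof (intro smooth_on_sum smooth_on_scaleR S)
    fix b :: 'v
    show "smooth_on (\<lambda>y. w y \<bullet> b) S"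
      using Cons.prems(2) by (intro smooth_on_compose_linear[OF bounded_linear_inner_left] S) simp
    show "smooth_on (\<lambda>y. F y (b # map (\<lambda>w. w y) ws)) S"
      using Cons.prems by (intro Cons.IH)
        (auto simp: smooth_field_def intro: multilinear_form_Cons)
  qed
  moreover have "F y (map (\<lambda>w. w y) (w # ws)) = (\<Sum>b\<in>Basis. (w y \<bullet> b) *\<^sub>R F y (b # map (\<lambda>w. w y) ws))"
    if "y \<in> S" for y
    using Cons.prems(1) that multilinear_form_expand_head[of "F y" "w y" "map (\<lambda>w. w y) ws"]
    by (simp add: smooth_field_def)
  ultimately show ?case by (subst smooth_on_cong[OF S])
qed

lemma frechet_derivative_slot:
  assumes S: "open S" "z \<in> S" and F: "smooth_field F S"
  shows "linear (\<lambda>v. fderiv (\<lambda>y. F y (xs @ v # zs)) z u)"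
proof (rule linearI)
  have D: "((\<lambda>y. F y vs) has_derivative fderiv (\<lambda>y. F y vs) z) (at z)" for vs
    using F S smooth_on_has_derivative unfolding smooth_field_def by blast
  have lin: "linear (\<lambda>v. F y (xs @ v # zs))" if "y \<in> S" for y
    using F that by (intro multilinear_form_slot) (simp add: smooth_field_def)
  show "fderiv (\<lambda>y. F y (xs @ (a + b) # zs)) z u
      = fderiv (\<lambda>y. F y (xs @ a # zs)) z u + fderiv (\<lambda>y. F y (xs @ b # zs)) z u"
    for a b
    using frechet_derivative_eqI[OF has_derivative_add[OF D D]]
      frechet_derivative_cong_on_open[OF S linear_add[OF lin]] by simp
  show "fderiv (\<lambda>y. F y (xs @ (r *\<^sub>R a) # zs)) z u
      = r *\<^sub>R fderiv (\<lambda>y. F y (xs @ a # zs)) z u" for r a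
    using frechet_derivative_eqI[OF has_derivative_scaleR_right[OF D]]
      frechet_derivative_cong_on_open[OF S linear_scale[OF lin]] by simp
qed

lemma has_derivative_multilinear:
  fixes F :: "'u::real_normed_vector \<Rightarrow> 'v::euclidean_space form_at"
  assumes S: "open S" "z \<in> S" and "smooth_field F S"
    and "\<And>w. w \<in> set ws \<Longrightarrow> w differentiable (at z)"
  shows "((\<lambda>y. F y (map (\<lambda>w. w y) ws)) has_derivative
    (\<lambda>v. fderiv (\<lambda>y. F y (map (\<lambda>w. w z) ws)) z v
      + (\<Sum>i<length ws. F z ((map (\<lambda>w. w z) ws)[i := fderiv (ws ! i) z v])))) (at z)"
  using assms(3,4)
proof (induction ws arbitrary: F)
  case Nil
  then show ?case
    using smooth_on_has_derivative[OF _ S(2)] by (auto simp: smooth_field_def)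
next
  case (Cons w ws)
  let ?us = "map (\<lambda>w. w z) ws"
  let ?D = "\<lambda>us v. fderiv (\<lambda>y. F y us) z v"
  let ?R = "\<lambda>b v. ?D (b # ?us) v + (\<Sum>i<length ws. F z (b # ?us[i := fderiv (ws ! i) z v]))"
  have Fz: "multilinear_form (F y)" if "y \<in> S" for y
    using Cons.prems(1) that by (simp add: smooth_field_def)
  have w: "(w has_derivative fderiv w z) (at z)"
    by (rule Cons.prems(2)[unfolded frechet_derivative_works]) simp
  have "((\<lambda>y. F y (b # map (\<lambda>w. w y) ws)) has_derivative ?R b) (at z)" for b
    using Cons.prems by (intro Cons.IH)
      (auto simp: smooth_field_def intro: multilinear_form_Cons)
  then have "((\<lambda>y. \<Sum>b\<in>Basis. (w y \<bullet> b) *\<^sub>R F y (b # map (\<lambda>w. w y) ws)) has_derivative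
      (\<lambda>v. \<Sum>b\<in>Basis. (w z \<bullet> b) *\<^sub>R ?R b v
        + (fderiv w z v \<bullet> b) *\<^sub>R F z (b # ?us))) (at z)"
    by (intro has_derivative_sum has_derivative_scaleR has_derivative_inner_left w)
  then have D: "((\<lambda>y. F y (map (\<lambda>w. w y) (w # ws))) has_derivative
      (\<lambda>v. \<Sum>b\<in>Basis. (w z \<bullet> b) *\<^sub>R ?R b v
        + (fderiv w z v \<bullet> b) *\<^sub>R F z (b # ?us))) (at z)"
    using S
  proof (rule has_derivative_transform_within_open)
    fix y assume "y \<in> S"
    from multilinear_form_expand_head[OF Fz[OF this], of "w y" "map (\<lambda>w. w y) ws"]
    show "(\<Sum>b\<in>Basis. (w y \<bullet> b) *\<^sub>R F y (b # map (\<lambda>w. w y) ws)) = F y (map (\<lambda>w. w y) (w # ws))"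
      by simp
  qed
  interpret D: linear "\<lambda>a. ?D (a # ?us) v" for v
    using frechet_derivative_slot[OF S Cons.prems(1), of "[]"] by simp
  have head: "?D (w z # ?us) v = (\<Sum>b\<in>Basis. (w z \<bullet> b) *\<^sub>R ?D (b # ?us) v)" for v
    by (subst (1) euclidean_representation[of "w z", symmetric]) (simp only: D.sum D.scaleR)
  have "(\<Sum>b\<in>Basis. (w z \<bullet> b) *\<^sub>R ?R b v + (fderiv w z v \<bullet> b) *\<^sub>R F z (b # ?us))
      = ?D (w z # ?us) v + (F z (fderiv w z v # ?us)
        + (\<Sum>i<length ws. F z (w z # ?us[i := fderiv (ws ! i) z v])))" for v
    unfolding head multilinear_form_expand_head[OF Fz[OF S(2)], of "w z"]
      multilinear_form_expand_head[OF Fz[OF S(2)], of "fderiv w z v"]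
    by (simp add: sum.distrib scaleR_add_right scaleR_sum_right sum.swap[of _ "{..<length ws}" Basis])
  with D show ?case
    by (simp add: sum.lessThan_Suc_shift del: sum.lessThan_Suc)
qed

lemma remove_nth_update:
  assumes "j < length vs" "i < length vs - 1"
  shows "(remove_nth j vs)[i := b] = remove_nth j (vs[(if i < j then i else Suc i) := b])"
    and "remove_nth j vs ! i = vs ! (if i < j then i else Suc i)"
  using assms by (auto intro!: nth_equalityI simp: nth_append nth_list_update min_def)

text \<open>The position in a list of the \<open>i\<close>-th entry which remains when entry \<open>j\<close> is removed.\<close>

lemma bij_betw_skip:
  assumes "j < n"
  shows "bij_betw (\<lambda>i. if i < j then i else Suc i) {..<n - 1} ({..<n} - {j})"
  by (rule bij_betw_byWitness[where f' = "\<lambda>i. if i < j then i else i - 1"]) (use assms in auto)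

lemma ext_deriv_cong_on_open:
  assumes "open S" "z \<in> S" "\<And>y. y \<in> S \<Longrightarrow> \<alpha> y = \<beta> y"
  shows "ext_deriv \<alpha> z = ext_deriv \<beta> z"
proof
  fix vs
  have "fderiv (\<lambda>y. \<alpha> y us) z = fderiv (\<lambda>y. \<beta> y us) z" for us
    using assms by (intro frechet_derivative_cong_on_open) auto
  then show "ext_deriv \<alpha> z vs = ext_deriv \<beta> z vs" by (simp add: ext_deriv_def)
qed

lemma smooth_field_ext_deriv:
  fixes \<alpha> :: "'v::real_normed_vector \<Rightarrow> 'v form_at"
  assumes S: "open S" and \<alpha>: "smooth_field \<alpha> S"
  shows "smooth_field (ext_deriv \<alpha>) S"
  unfolding smooth_field_def
proof (intro conjI ballI allI)
  fix vs show "smooth_on (\<lambda>y. ext_deriv \<alpha> y vs) S"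
    unfolding ext_deriv_def using \<alpha>
    by (intro smooth_on_sum smooth_on_mult smooth_on_const smooth_on_derivative S)
      (simp add: smooth_field_def)
next
  fix z assume z: "z \<in> S"
  have "linear (\<lambda>v. (-1) ^ j *
      fderiv (\<lambda>y. \<alpha> y (remove_nth j (vs[m := v]))) z (vs[m := v] ! j))"
    if m: "m < length vs" and j: "j < length vs" for vs m j
  proof -
    have "linear (\<lambda>v. fderiv (\<lambda>y. \<alpha> y (remove_nth j (vs[m := v]))) z (vs[m := v] ! j))"
    proof (cases "j = m")
      case True
      have "remove_nth m (vs[m := v]) = remove_nth m vs" for v by simp
      moreover have "linear (fderiv (\<lambda>y. \<alpha> y (remove_nth m vs)) z)"
        using \<alpha> by (intro smooth_on_linear_derivative[OF _ z]) (simp add: smooth_field_def)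
      ultimately show ?thesis using True m by simp
    next
      case False
      define i where "i = (if m < j then m else m - 1)"
      have i: "i < length vs - 1" "(if i < j then i else Suc i) = m"
        using False m j by (auto simp: i_def)
      have "remove_nth j (vs[m := v]) = take i (remove_nth j vs) @ v # drop (Suc i) (remove_nth j vs)"
          for v
        using remove_nth_update(1)[OF j i(1), of v] i j
            by (simp add: upd_conv_take_nth_drop del: take_append drop_append)
      then obtain xs zs where "remove_nth j (vs[m := v]) = xs @ v # zs" for v by blast
      then show ?thesis
        using False frechet_derivative_slot[OF S z \<alpha>, of xs zs] by (simp only: nth_list_update_neq)
    qed
    then show ?thesis by (rule linear_compose[OF _ linear_times, unfolded o_def])
  qed
  then show "multilinear_form (ext_deriv \<alpha> z)"
    unfolding multilinear_form_def ext_deriv_def by (auto intro!: linear_compose_sum)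
qed

text \<open>The derivative of \<open>\<phi>\<^sup>*\<alpha>\<close> has, besides the derivative of \<open>\<alpha>\<close>, a second derivative of \<open>\<phi>\<close> in
  each argument. In the alternating sum these cancel in pairs: exchanging the roles of the two
  indices leaves the second derivative unchanged and reverses the sign of the alternating form.\<close>

lemma ext_deriv_pullback:
  fixes \<phi> :: "'u::euclidean_space \<Rightarrow> 'v::euclidean_space"
  assumes S: "open S" "z \<in> S" and T: "open T" "\<phi> ` S \<subseteq> T" and \<phi>: "smooth_on \<phi> S"
    and \<alpha>: "smooth_field \<alpha> T" "alternating (\<alpha> (\<phi> z))"
  shows "ext_deriv (pullback \<phi> \<alpha>) z = pullback \<phi> (ext_deriv \<alpha>) z"
proof
  fix vs :: "'u list"
  define n where "n = length vs"
  define A where "A = fderiv \<phi> z"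
  define H where "H u v = fderiv (\<lambda>y. fderiv \<phi> y u) z v" for u v
  \<comment> \<open>The summand in which the derivative in direction \<open>vs ! j\<close> falls on the argument with index \<open>i\<close>.\<close>
  define E where "E j i = (-1) ^ j * \<alpha> (\<phi> z) (remove_nth j ((map A vs)[i := H (vs ! i) (vs ! j)]))"
      for j i
  have H_sym: "H u v = H v u" for u v
    unfolding H_def by (rule mixed_derivatives_commute[OF \<phi> S])
  have \<phi>z: "\<phi> z \<in> T" using S T by auto
  have \<alpha>\<phi>: "smooth_field (\<lambda>y. \<alpha> (\<phi> y)) S"
    using \<alpha>(1) T \<phi> S smooth_on_compose unfolding smooth_field_def by blast
  have D: "fderiv (\<lambda>y. pullback \<phi> \<alpha> y (remove_nth j vs)) z (vs ! j)
      = fderiv (\<lambda>y. \<alpha> y (remove_nth j (map A vs))) (\<phi> z) (map A vs ! j)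
        + (\<Sum>i\<in>{..<n} - {j}. \<alpha> (\<phi> z) (remove_nth j ((map A vs)[i := H (vs ! i) (vs ! j)])))"
    if j: "j < n" for j
  proof -
    let ?us = "remove_nth j vs"
    let ?ws = "map (\<lambda>u y. fderiv \<phi> y u) ?us"
    have len: "length ?us = n - 1" "j < length vs" using j by (simp_all add: n_def)
    have us: "map (\<lambda>w. w z) ?ws = remove_nth j (map A vs)"
      by (simp add: A_def take_map drop_map)
    have h: "((\<lambda>y. \<alpha> (\<phi> y) (map (\<lambda>w. w y) ?ws)) has_derivative
      (\<lambda>v. fderiv (\<lambda>y. \<alpha> (\<phi> y) (map (\<lambda>w. w z) ?ws)) z v
        + (\<Sum>i<length ?ws. \<alpha> (\<phi> z) ((map (\<lambda>w. w z) ?ws)[i := fderiv (?ws ! i) z v])))) (at z)"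
      using smooth_on_differentiable[OF smooth_on_derivative[OF \<phi>] S(2)]
      by (intro has_derivative_multilinear[OF S \<alpha>\<phi>]) (auto simp del: map_append)
    have pb: "(\<lambda>y. \<alpha> (\<phi> y) (map (\<lambda>w. w y) ?ws)) = (\<lambda>y. pullback \<phi> \<alpha> y ?us)"
      by (simp add: pullback_def fun_eq_iff o_def)
    have deriv: "fderiv (\<lambda>y. pullback \<phi> \<alpha> y ?us) z (vs ! j)
        = fderiv (\<lambda>y. \<alpha> (\<phi> y) (map (\<lambda>w. w z) ?ws)) z (vs ! j)
        + (\<Sum>i<length ?ws. \<alpha> (\<phi> z) ((map (\<lambda>w. w z) ?ws)[i := fderiv (?ws ! i) z (vs ! j)]))"
      by (rule fun_cong[OF frechet_derivative_eqI[OF h[unfolded pb]]])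
    have lenws: "length ?ws = n - 1" using len by simp
    have nth_ws: "?ws ! i = (\<lambda>y. fderiv \<phi> y (?us ! i))" if "i < n - 1" for i
      by (rule nth_map) (use that len(1) in simp)
    have "fderiv (\<lambda>y. pullback \<phi> \<alpha> y ?us) z (vs ! j)
        = fderiv (\<lambda>y. \<alpha> (\<phi> y) (remove_nth j (map A vs))) z (vs ! j)
        + (\<Sum>i<n - 1. \<alpha> (\<phi> z) ((remove_nth j (map A vs))[i := H (?us ! i) (vs ! j)]))"
      unfolding deriv us lenws H_def using nth_ws
      by (intro arg_cong2[where f="(+)"] refl sum.cong) (simp only: lessThan_iff)
    also have "fderiv (\<lambda>y. \<alpha> (\<phi> y) (remove_nth j (map A vs))) z (vs ! j)
        = fderiv (\<lambda>y. \<alpha> y (remove_nth j (map A vs))) (\<phi> z) (map A vs ! j)"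
    proof -
      have "(\<lambda>y. \<alpha> y us) differentiable (at (\<phi> z))" for us
        using \<alpha>(1) \<phi>z smooth_on_differentiable unfolding smooth_field_def by blast
      from frechet_derivative_eqI[OF frechet_derivative_compose[OF this smooth_on_differentiable[OF \<phi> S(2)]]]
      show ?thesis using len by (simp add: A_def)
    qed
    also have "(\<Sum>i<n - 1. \<alpha> (\<phi> z) ((remove_nth j (map A vs))[i := H (?us ! i) (vs ! j)]))
        = (\<Sum>i<n - 1. (\<lambda>i. \<alpha> (\<phi> z) (remove_nth j ((map A vs)[i := H (vs ! i) (vs ! j)])))
            (if i < j then i else Suc i))"
      using len remove_nth_update[of j "map A vs"] remove_nth_update(2)[of j vs]
      by (intro sum.cong refl) (simp add: n_def)
    also have "\<dots> = (\<Sum>i\<in>{..<n} - {j}. \<alpha> (\<phi> z) (remove_nth j ((map A vs)[i := H (vs ! i) (vs ! j)])))"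
      by (rule sum.reindex_bij_betw[OF bij_betw_skip[OF j]])
    finally show ?thesis .
  qed
  have antisym: "E j i = - E i j" if ij: "j < i" "i < n" for i j
  proof -
    define L where "L = map A vs"
    have L: "length L = n" by (simp add: L_def n_def)
    define xs ys zs where "xs = take j L" and "ys = take (i - Suc j) (drop (Suc j) L)"
        and "zs = drop (Suc i) L"
    define b where "b = H (vs ! i) (vs ! j)"
    have Leq: "L = xs @ L ! j # ys @ L ! i # zs"
      using ij L unfolding xs_def ys_def zs_def
      by (metis id_take_nth_drop less_trans append_take_drop_id Cons_nth_drop_Suc drop_drop
          Suc_leI le_add_diff_inverse2)
    have len: "length xs = j" "length ys = i - Suc j" using ij L by (auto simp: xs_def ys_def)
    \<comment> \<open>Only the positions \<open>j\<close> and \<open>i\<close> matter; their entries are replaced or removed.\<close>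
    obtain p q where pq: "L = xs @ p # ys @ q # zs" using Leq by blast
    have i: "i = length xs + Suc (length ys)" using ij len by simp
    have "remove_nth j (L[i := b]) = xs @ ys @ b # zs" "remove_nth i (L[j := b]) = xs @ b # ys @ zs"
      unfolding pq i len(1)[symmetric] by (simp_all add: list_update_append)
    moreover have "\<alpha> (\<phi> z) (xs @ ys @ b # zs) = (-1) ^ length ys * \<alpha> (\<phi> z) (xs @ b # ys @ zs)"
      by (simp add: alternating_move[OF \<alpha>(2), of xs b ys zs] flip: power_mult_distrib mult.assoc)
    ultimately show ?thesis
      unfolding E_def H_sym[of "vs ! j" "vs ! i"] b_def[symmetric] L_def[symmetric]
      by (simp add: i len(1) power_add)
  qed
  define E0 where "E0 j i = (if i = j then 0 else E j i)" for j i
  have E0: "E0 j i = - E0 i j" if "i < n" "j < n" for i j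
  proof (cases i j rule: linorder_cases)
    case less then show ?thesis using antisym[of i j] that by (simp add: E0_def)
  next
    case greater then show ?thesis using antisym[of j i] that by (simp add: E0_def)
  qed (simp add: E0_def)
  have "(\<Sum>j<n. \<Sum>i<n. E0 j i) = (\<Sum>j<n. \<Sum>i<n. - E0 i j)"
    by (intro sum.cong refl) (use E0 in blast)
  also have "\<dots> = - (\<Sum>j<n. \<Sum>i<n. E0 j i)"
    by (subst sum.swap) (simp add: sum_negf)
  finally have "(\<Sum>j<n. \<Sum>i<n. E0 j i) = 0" by simp
  moreover have "(\<Sum>i\<in>{..<n} - {j}. E j i) = (\<Sum>i<n. E0 j i)" for j
    by (rule sum.mono_neutral_cong_left) (auto simp: E0_def)
  ultimately have zero: "(\<Sum>j<n. \<Sum>i\<in>{..<n} - {j}. E j i) = 0" by simp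
  have "ext_deriv (pullback \<phi> \<alpha>) z vs = ext_deriv \<alpha> (\<phi> z) (map A vs) + (\<Sum>j<n. \<Sum>i\<in>{..<n} - {j}. E j i)"
    unfolding ext_deriv_def E_def using D
    by (simp add: n_def[symmetric] distrib_left sum.distrib sum_distrib_left)
  then show "ext_deriv (pullback \<phi> \<alpha>) z vs = pullback \<phi> (ext_deriv \<alpha>) z vs"
    by (simp add: zero pullback_def A_def)
qed

section \<open>Naturality of the Hodge star\<close>

definition real_coord :: "'m + 'm \<Rightarrow> complex^'m \<Rightarrow> real" where
  "real_coord a v = (case a of Inl i \<Rightarrow> Re (v $ i) | Inr i \<Rightarrow> Im (v $ i))"

definition real_matrix :: "(complex^'m \<Rightarrow> complex^'m) \<Rightarrow> real^('m + 'm)^('m + 'm)" where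
  "real_matrix A = (\<chi> a b. real_coord a (A (real_axis b)))"

lemma bounded_linear_real_coord: "bounded_linear (real_coord a :: complex^'m::finite \<Rightarrow> real)"
proof -
  have "linear (real_coord a :: complex^'m \<Rightarrow> real)"
    by (rule linearI) (auto simp: real_coord_def split: sum.split)
  then show ?thesis by (rule linear_conv_bounded_linear[THEN iffD1])
qed

lemma sum_UNIV_plus:
  "(\<Sum>a\<in>(UNIV :: ('m::finite + 'm) set). f a) = (\<Sum>i\<in>UNIV. f (Inl i)) + (\<Sum>i\<in>UNIV. f (Inr i))"
  by (simp add: sum.Plus flip: UNIV_Plus_UNIV)

lemma real_axis_expansion:
  fixes v :: "complex^'m::finite"
  shows "(\<Sum>a\<in>UNIV. real_coord a v *\<^sub>R real_axis a) = v"
proof -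
  have "(\<Sum>i\<in>UNIV. Re (v $ i) *\<^sub>R (axis i 1 :: complex^'m) $ k)
      + (\<Sum>i\<in>UNIV. Im (v $ i) *\<^sub>R (axis i \<i> :: complex^'m) $ k) = v $ k" for k
  proof -
    have "(\<Sum>i\<in>UNIV. c i *\<^sub>R (axis i d :: complex^'m) $ k) = c k *\<^sub>R d" for c d
      by (simp add: axis_def if_distrib[of "\<lambda>x. _ *\<^sub>R x"] cong: if_cong)
    then show ?thesis by (simp add: complex_eq_iff)
  qed
  then show ?thesis
    by (simp add: vec_eq_iff sum_UNIV_plus real_coord_def real_axis_def)
qed

lemma linear_expansion:
  fixes L :: "complex^'m::finite \<Rightarrow> 'w::real_vector"
  assumes "linear L"
  shows "L v = (\<Sum>a\<in>UNIV. real_coord a v *\<^sub>R L (real_axis a))"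
proof -
  interpret linear L by fact
  show ?thesis by (subst (1) real_axis_expansion[of v, symmetric]) (simp only: sum scaleR)
qed

lemma real_coord_linear_image:
  assumes "linear A"
  shows "real_coord a (A v) = (\<Sum>b\<in>UNIV. real_matrix A $ a $ b * real_coord b v)"
proof -
  have "linear (\<lambda>v. real_coord a (A v))"
    using linear_compose[OF assms bounded_linear.linear[OF bounded_linear_real_coord]]
        by (simp add: o_def)
  from linear_expansion[OF this, of v] show ?thesis by (simp add: real_matrix_def mult.commute)
qed

lemma bilinear_expansion:
  fixes g :: "complex^'m::finite \<Rightarrow> complex^'m \<Rightarrow> real"
  assumes "bilinear g"
  shows "g v w = (\<Sum>a\<in>UNIV. \<Sum>b\<in>UNIV. real_coord a v * real_coord b w * gram g $ a $ b)"
proof -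
  have "linear (\<lambda>v. g v w)" "\<And>v. linear (g v)" using assms by (auto simp: bilinear_def)
  then show ?thesis
    using linear_expansion[of "\<lambda>v. g v w" v] linear_expansion[of "g (real_axis _)" w]
    by (simp add: gram_def sum_distrib_left mult.assoc)
qed

definition positive_form :: "(complex^'m \<Rightarrow> complex^'m \<Rightarrow> real) \<Rightarrow> bool" where
  "positive_form g \<longleftrightarrow> bilinear g \<and> (\<forall>v. v \<noteq> 0 \<longrightarrow> g v v > 0)"

text \<open>The coordinates in the kernel of the Gram matrix are those of a vector \<open>v\<close> with \<open>g v v = 0\<close>.\<close>

lemma det_gram_nonzero:
  fixes g :: "complex^'m::finite \<Rightarrow> complex^'m \<Rightarrow> real"
  assumes "positive_form g" shows "det (gram g) \<noteq> 0"
proof -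
  have "x = 0" if x: "gram g *v x = 0" for x
  proof -
    define v :: "complex^'m" where "v = (\<Sum>b\<in>UNIV. (x $ b) *\<^sub>R real_axis b)"
    have bil: "bilinear g" using assms by (simp add: positive_form_def)
    have "g (real_axis a) v = 0" for a
    proof -
      have l: "linear (g (real_axis a))" using bil by (simp add: bilinear_def)
      have "g (real_axis a) v = (gram g *v x) $ a"
        by (simp add: v_def linear_sum[OF l] linear_scale[OF l] matrix_vector_mult_def gram_def mult.commute)
      then show ?thesis using x by simp
    qed
    then have "g v v = 0"
      using linear_expansion[of "\<lambda>u. g u v" v] bil by (simp add: bilinear_def)
    then have v: "v = 0" using assms by (force simp: positive_form_def)
    have "x $ a = real_coord a v" for a
    proof -
      have r: "real_coord a (real_axis b :: complex^'m) = (if a = b then 1 else 0)" for b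
        by (auto simp: real_coord_def real_axis_def axis_def split: sum.splits)
      show ?thesis
        unfolding v_def using bounded_linear.linear[OF bounded_linear_real_coord[of a]]
        by (simp add: linear_sum linear_scale r if_distrib[of "\<lambda>y. _ * y"] cong: if_cong)
    qed
    then have "x $ a = 0" for a
      using v linear_0[OF bounded_linear.linear[OF bounded_linear_real_coord]] by metis
    then show ?thesis by (simp add: vec_eq_iff)
  qed
  then have "\<exists>B. B ** gram g = mat 1" unfolding matrix_left_invertible_ker by blast
  then show ?thesis by (simp add: invertible_det_nz[symmetric] invertible_left_inverse)
qed

lemma gram_isometry:
  assumes "bilinear g'" "linear A" "\<And>v w. g' (A v) (A w) = g v w"
  shows "gram g = transpose (real_matrix A) ** gram g' ** real_matrix A"
proof -
  have "gram g $ a $ b = (\<Sum>d\<in>UNIV. (\<Sum>c\<in>UNIV. real_matrix A $ c $ a * gram g' $ c $ d)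
      * real_matrix A $ d $ b)"
    for a b
  proof -
    have "gram g $ a $ b = g' (A (real_axis a)) (A (real_axis b))" by (simp add: gram_def assms(3))
    also have "\<dots> = (\<Sum>c\<in>UNIV. \<Sum>d\<in>UNIV. real_matrix A $ c $ a * real_matrix A $ d $ b * gram g' $ c $ d)"
      by (subst bilinear_expansion[OF assms(1)]) (simp add: real_matrix_def)
    also have "\<dots> = (\<Sum>d\<in>UNIV. \<Sum>c\<in>UNIV. real_matrix A $ c $ a * real_matrix A $ d $ b * gram g' $ c $ d)"
      by (rule sum.swap)
    finally show ?thesis unfolding sum_distrib_right by (simp add: mult_ac)
  qed
  then show ?thesis by (simp add: vec_eq_iff matrix_matrix_mult_def transpose_def)
qed

lemma matrix_inv_eqI:
  fixes A B :: "real^'n^'n"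
  assumes "A ** B = mat 1" shows "matrix_inv A = B"
proof -
  have "A ** matrix_inv A = mat 1"
    using assms matrix_left_right_inverse1[OF assms] unfolding matrix_inv_def
    by (metis (mono_tags, lifting) someI_ex)
  moreover have "B ** (A ** matrix_inv A) = matrix_inv A"
    unfolding matrix_mul_assoc using matrix_left_right_inverse1[OF assms] by simp
  ultimately show ?thesis by simp
qed

text \<open>The inverse Gram matrix represents the metric on covectors, which is pushed forward by an
  isometry.\<close>

lemma matrix_inv_gram_isometry:
  assumes "positive_form g" "positive_form g'" "linear A" "\<And>v w. g' (A v) (A w) = g v w"
  shows "real_matrix A ** matrix_inv (gram g) ** transpose (real_matrix A) = matrix_inv (gram g')"
    and "det (real_matrix A) \<noteq> 0"
proof -
  define M where "M = real_matrix A"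
  have eq: "gram g = transpose M ** gram g' ** M"
    using gram_isometry assms by (auto simp: positive_form_def M_def)
  have "det (gram g) = det M * det M * det (gram g')" unfolding eq by (simp add: det_mul)
  then have M0: "det M \<noteq> 0" using det_gram_nonzero[OF assms(1)] by auto
  then show "det (real_matrix A) \<noteq> 0" by (simp add: M_def)
  obtain N where N: "M ** N = mat 1" "N ** M = mat 1"
    using M0 invertible_det_nz[of M] by (auto simp: invertible_def)
  obtain P where P: "gram g ** P = mat 1"
    using det_gram_nonzero[OF assms(1)] invertible_det_nz[of "gram g"] by (auto simp: invertible_def)
  have TN: "transpose N ** transpose M = mat 1"
    by (metis N(1) matrix_transpose_mul transpose_mat)
  have "gram g' = transpose N ** gram g ** N"
    unfolding eq by (metis N(1) TN matrix_mul_assoc matrix_mul_lid matrix_mul_rid)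
  then have "gram g' ** (M ** P ** transpose M)
      = transpose N ** (gram g ** ((N ** M) ** P)) ** transpose M"
    by (simp add: matrix_mul_assoc)
  also have "\<dots> = mat 1" by (simp add: N(2) P TN)
  finally have "matrix_inv (gram g') = M ** P ** transpose M" by (rule matrix_inv_eqI)
  moreover have "matrix_inv (gram g) = P" by (rule matrix_inv_eqI[OF P])
  ultimately show "real_matrix A ** matrix_inv (gram g) ** transpose (real_matrix A)
      = matrix_inv (gram g')"
    by (simp add: M_def)
qed

subsection \<open>The volume form\<close>

text \<open>The order of the coordinates in \<^const>\<open>real_coords\<close>. It identifies the positions of a list of
  \<open>2m\<close> vectors with the index type of the real matrices, which makes the wedge product of the
  coordinate forms a determinant.\<close>

definition axis_enum :: "('m + 'm) list" where
  "axis_enum = concat (map (\<lambda>i. [Inl i, Inr i]) (SOME is. distinct is \<and> set is = (UNIV :: 'm set)))"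

lemma axis_enum:
  shows "distinct (axis_enum :: ('m::finite + 'm) list)" "set axis_enum = (UNIV :: ('m + 'm) set)"
    and "real_coords = map (\<lambda>a (v :: complex^'m). of_real (real_coord a v)) axis_enum"
    and "length (axis_enum :: ('m + 'm) list) = 2 * CARD('m)"
proof -
  define L where "L = (SOME is. distinct is \<and> set is = (UNIV :: 'm set))"
  have "\<exists>is. distinct is \<and> set is = (UNIV :: 'm set)"
    using finite_distinct_list[of "UNIV :: 'm set"] by auto
  then have L: "distinct L" "set L = UNIV" unfolding L_def by (metis (mono_tags, lifting) someI_ex)+
  have e: "axis_enum = concat (map (\<lambda>i. [Inl i, Inr i]) L)" by (simp add: axis_enum_def L_def)
  have dc: "distinct (concat (map (\<lambda>i. [Inl i, Inr i]) is) :: ('m + 'm) list)" if "distinct is" for "is"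
    using that by (induction "is") auto
  show d: "distinct (axis_enum :: ('m + 'm) list)" unfolding e by (rule dc[OF L(1)])
  have "x \<in> set (concat (map (\<lambda>i. [Inl i, Inr i]) L))" for x :: "'m + 'm"
    using L(2) by (cases x) auto
  then show s: "set axis_enum = (UNIV :: ('m + 'm) set)" using e by auto
  show "real_coords = map (\<lambda>a (v :: complex^'m). of_real (real_coord a v)) axis_enum"
    unfolding real_coords_def e L_def[symmetric] by (simp add: map_concat o_def real_coord_def)
  show "length (axis_enum :: ('m + 'm) list) = 2 * CARD('m)"
    using distinct_card[OF d] unfolding s
    by (simp add: UNIV_Plus_UNIV[symmetric] card_Plus del: UNIV_Plus_UNIV)
qed

definition axis_pos :: "'m::finite + 'm \<Rightarrow> nat" where
  "axis_pos = inv_into {..<length (axis_enum :: ('m + 'm) list)} ((!) axis_enum)"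

definition coord_matrix :: "(complex^'m::finite) list \<Rightarrow> real^('m + 'm)^('m + 'm)" where
  "coord_matrix vs = (\<chi> a b. real_coord a (vs ! axis_pos b))"

lemma axis_bij:
  "bij_betw ((!) (axis_enum :: ('m::finite + 'm) list)) {..<2 * CARD('m)} UNIV"
  using bij_betw_nth[OF axis_enum(1) refl refl] axis_enum(2,4) by (metis lessThan_atLeast0)

lemma axis_pos:
  shows "axis_pos (a :: 'm::finite + 'm) < 2 * CARD('m)" "axis_enum ! axis_pos a = a"
    and "j < 2 * CARD('m) \<Longrightarrow> axis_pos (axis_enum ! j :: 'm + 'm) = j"
proof -
  have a: "a \<in> (!) axis_enum ` {..<2 * CARD('m)}"
    using axis_bij[where 'm = 'm] by (simp add: bij_betw_def)
  show "axis_pos a < 2 * CARD('m)" "axis_enum ! axis_pos a = a"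
    using inv_into_into[OF a] f_inv_into_f[OF a] by (simp_all add: axis_pos_def axis_enum(4))
  show "j < 2 * CARD('m) \<Longrightarrow> axis_pos (axis_enum ! j :: 'm + 'm) = j"
    using inv_into_f_f[OF bij_betw_imp_inj_on[OF axis_bij[where 'm = 'm]], of j]
    by (simp add: axis_pos_def axis_enum(4))
qed

lemma wedge_real_coords:
  fixes vs :: "(complex^'m::finite) list"
  assumes len: "length vs = 2 * CARD('m)"
  shows "wedge real_coords vs = of_real (det (coord_matrix vs))"
proof -
  let ?n = "2 * CARD('m)"
  let ?f = "\<lambda>\<sigma> (x :: 'm + 'm). axis_enum ! \<sigma> (axis_pos x) :: 'm + 'm"
  have bij: "bij_betw ?f {\<sigma>. \<sigma> permutes {..<?n}} {p. p permutes UNIV}"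
    using bij_betw_permutations[OF axis_bij[where 'm = 'm]]
    by (simp add: axis_pos_def axis_enum(4))
  have "wedge real_coords vs = (\<Sum>\<sigma> | \<sigma> permutes {..<?n}.
      of_int (sign \<sigma>) * (\<Prod>j<?n. of_real (real_coord (axis_enum ! j) (vs ! \<sigma> j))))"
    unfolding wedge_def axis_enum(3) using len
    by (intro trans[OF if_P] sum.cong arg_cong2[where f = "(*)"] prod.cong) (auto simp: axis_enum(4))
  also have "\<dots> = (\<Sum>\<sigma> | \<sigma> permutes {..<?n}.
      of_int (sign (?f \<sigma>)) * (\<Prod>a\<in>UNIV. of_real (coord_matrix vs $ a $ ?f \<sigma> a)))"
  proof (intro sum.cong refl arg_cong2[where f = "(*)"])
    fix \<sigma> assume "\<sigma> \<in> {\<sigma>. \<sigma> permutes {..<?n}}"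
    then have \<sigma>: "\<sigma> permutes {..<?n}" by simp
    have "?f \<sigma> = map_permutation {..<?n} ((!) axis_enum) \<sigma>"
      using axis_bij[where 'm = 'm]
      by (auto simp: map_permutation_def restrict_id_def bij_betw_def axis_pos_def axis_enum(4))
    then show "of_int (sign \<sigma>) = (of_int (sign (?f \<sigma>)) :: complex)"
      using sign_map_permutation[OF bij_betw_imp_inj_on[OF axis_bij[where 'm = 'm]] \<sigma>] by simp
    have "(\<Prod>j<?n. complex_of_real (real_coord (axis_enum ! j) (vs ! \<sigma> j)))
        = (\<Prod>j<?n. (\<lambda>a. of_real (coord_matrix vs $ a $ ?f \<sigma> a)) (axis_enum ! j))"
    proof (intro prod.cong refl)
      fix j assume j: "j \<in> {..<?n}"
      then have "\<sigma> j < ?n" using permutes_in_image[OF \<sigma>] by auto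
      then show "complex_of_real (real_coord (axis_enum ! j) (vs ! \<sigma> j))
          = of_real (coord_matrix vs $ (axis_enum ! j) $ ?f \<sigma> (axis_enum ! j))"
        using j by (simp add: coord_matrix_def axis_pos(3))
    qed
    also have "\<dots> = (\<Prod>a\<in>UNIV. of_real (coord_matrix vs $ a $ ?f \<sigma> a))"
      by (rule prod.reindex_bij_betw[OF axis_bij])
    finally show "(\<Prod>j<?n. complex_of_real (real_coord (axis_enum ! j) (vs ! \<sigma> j)))
        = (\<Prod>a\<in>UNIV. of_real (coord_matrix vs $ a $ ?f \<sigma> a))" .
  qed
  also have "\<dots> = (\<Sum>p | p permutes UNIV. of_int (sign p)
      * (\<Prod>a\<in>UNIV. of_real (coord_matrix vs $ a $ p a)))"
    by (rule sum.reindex_bij_betw[OF bij, of "\<lambda>p. of_int (sign p)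
        * (\<Prod>a\<in>UNIV. of_real (coord_matrix vs $ a $ p a))"])
  finally show ?thesis by (simp add: det_def)
qed

lemma wedge_real_coords_map:
  fixes vs :: "(complex^'m::finite) list"
  assumes "linear A"
  shows "wedge real_coords (map A vs) = of_real (det (real_matrix A)) * wedge real_coords vs"
proof (cases "length vs = 2 * CARD('m)")
  case True
  have "coord_matrix (map A vs) = real_matrix A ** coord_matrix vs"
    using axis_pos(1)[where 'm = 'm] True
    by (simp add: vec_eq_iff coord_matrix_def matrix_matrix_mult_def real_coord_linear_image[OF assms])
  then show ?thesis using True by (simp add: wedge_real_coords det_mul)
qed (simp add: wedge_def axis_enum)

lemma alternating_volume_form:
  "alternating (volume_form (g :: complex^'m::finite \<Rightarrow> complex^'m \<Rightarrow> real))"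
proof -
  have lin: "linear (\<lambda>v. volume_form g (vs[j := v]))" if j: "j < length vs" for vs j
  proof (cases "length vs = 2 * CARD('m)")
    case True
    let ?row = "\<lambda>v. \<chi> a. real_coord a v"
    have t: "transpose (coord_matrix (vs[j := v])) = (\<chi> b. if b = axis_enum ! j then ?row v
        else (\<chi> a. real_coord a (vs ! axis_pos b)))" for v
    proof -
      have nth: "vs[j := v] ! axis_pos b = (if b = axis_enum ! j then v else vs ! axis_pos b)"
          for b :: "'m + 'm"
        using j True axis_pos(2)[of b] axis_pos(3)[where 'm = 'm, of j] by (cases "axis_pos b = j") auto
      show ?thesis by (simp add: vec_eq_iff[where 'b = "'m + 'm"] transpose_def coord_matrix_def nth)
    qed
    have l: "linear (real_coord a :: complex^'m \<Rightarrow> real)" for a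
      by (rule bounded_linear.linear[OF bounded_linear_real_coord])
    have row: "?row (v + w) = ?row v + ?row w" "?row (r *\<^sub>R v) = r *s ?row v"
      for v w :: "complex^'m" and r
      by (simp_all add: vec_eq_iff linear_add[OF l] linear_scale[OF l])
    have "linear (\<lambda>v. det (coord_matrix (vs[j := v])))"
      unfolding det_transpose[of "coord_matrix (vs[j := _])", symmetric] t row det_row_add det_row_mul
      by (rule linearI) (unfold row det_row_add det_row_mul, simp_all)
    then have "linear (\<lambda>v. complex_of_real (sqrt (det (gram g)))
        * of_real (det (coord_matrix (vs[j := v]))))"
      by (auto simp: linear_iff scaleR_conv_of_real algebra_simps)
    then show ?thesis using True by (simp add: volume_form_def wedge_real_coords)
  next
    case False
    then show ?thesis by (simp add: volume_form_def wedge_def axis_enum module_hom_zero)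
  qed
  have "volume_form g vs = 0" if ij: "i < j" "j < length vs" "vs ! i = vs ! j" for vs i j
  proof (cases "length vs = 2 * CARD('m)")
    case True
    have "axis_enum ! i \<noteq> (axis_enum ! j :: 'm + 'm)"
      using ij True by (simp add: nth_eq_iff_index_eq axis_enum)
    moreover have "column (axis_enum ! i) (coord_matrix vs) = column (axis_enum ! j) (coord_matrix vs)"
      using ij True by (simp add: column_def coord_matrix_def axis_pos(3))
    ultimately have "det (coord_matrix vs) = 0" by (rule det_identical_columns)
    then show ?thesis using True by (simp add: volume_form_def wedge_real_coords)
  qed (simp add: volume_form_def wedge_def axis_enum)
  then show ?thesis using lin by (simp add: alternating_def multilinear_form_def)
qed

text \<open>The Gram determinants contribute the absolute value of \<open>det A\<close> and the coordinate forms
  contribute \<open>det A\<close>, which leaves the sign.\<close>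

lemma volume_form_isometry:
  assumes "positive_form g" "positive_form g'" "linear A" "\<And>v w. g' (A v) (A w) = g v w"
  shows "volume_form g vs = of_real (sgn (det (real_matrix A))) * volume_form g' (map A vs)"
proof -
  have "det (gram g) = (det (real_matrix A))\<^sup>2 * det (gram g')"
    using gram_isometry[of g' A g] assms by (simp add: positive_form_def det_mul power2_eq_square)
  then have "sqrt (det (gram g)) = \<bar>det (real_matrix A)\<bar> * sqrt (det (gram g'))"
    by (simp add: real_sqrt_mult)
  then show ?thesis
    by (simp add: volume_form_def wedge_real_coords_map[OF assms(3)] abs_sgn flip: of_real_mult)
qed

lemma sum_swap_pairs:
  "(\<Sum>a\<in>A. \<Sum>b\<in>B. \<Sum>c\<in>C. \<Sum>d\<in>D. h a b c d) = (\<Sum>c\<in>C. \<Sum>d\<in>D. \<Sum>a\<in>A. \<Sum>b\<in>B. h a b c d)"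
  by (simp only: sum.swap[of _ C B] sum.swap[of _ C A] sum.swap[of _ D B] sum.swap[of _ D A])

subsection \<open>Contractions and the star\<close>

lemma sum_lists_Suc:
  fixes h :: "'a::finite list \<Rightarrow> 'b::comm_monoid_add"
  shows "(\<Sum>as | length as = Suc k. h as) = (\<Sum>a\<in>UNIV. \<Sum>as | length as = k. h (a # as))"
proof -
  have "{as. length as = Suc k} = (\<lambda>(a, as). a # as) ` (UNIV \<times> {as :: 'a list. length as = k})"
    by (auto simp: length_Suc_conv)
  then show ?thesis
    by (simp add: sum.reindex inj_on_def split_beta sum.cartesian_product prod_eq_iff)
qed

lemma linear_mult_left: "linear f \<Longrightarrow> linear (\<lambda>v. c * f v)" for f :: "'v::real_vector \<Rightarrow> complex" and c
  by (auto simp: linear_iff algebra_simps)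

lemma linear_mult_right: "linear f \<Longrightarrow> linear (\<lambda>v. f v * c)" for f :: "'v::real_vector \<Rightarrow> complex" and c
  by (auto simp: linear_iff algebra_simps)

text \<open>One contracted pair of arguments at a time, a linear change of the frame moves from the
  arguments of \<open>F\<close> to the coefficients of the contraction.\<close>

lemma contraction_change_frame:
  fixes F :: "(complex^'m::finite) list \<Rightarrow> (complex^'m) list \<Rightarrow> complex"
    and P :: "real^('m + 'm)^('m + 'm)"
  assumes A: "linear A"
    and F: "\<And>ws. multilinear_form (\<lambda>us. F us ws)" "\<And>us. multilinear_form (\<lambda>ws. F us ws)"
  shows "(\<Sum>as | length as = k. \<Sum>bs | length bs = k. of_real (\<Prod>j<k. P $ (as ! j) $ (bs ! j))
            * F (map (\<lambda>a. A (real_axis a)) as) (map (\<lambda>a. A (real_axis a)) bs))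
    = (\<Sum>as | length as = k. \<Sum>bs | length bs = k.
        of_real (\<Prod>j<k. (real_matrix A ** P ** transpose (real_matrix A)) $ (as ! j) $ (bs ! j))
            * F (map real_axis as) (map real_axis bs))"
  using F
proof (induction k arbitrary: F)
  case 0
  then show ?case by simp
next
  case (Suc k)
  let ?M = "real_matrix A" and ?e = "real_axis :: _ \<Rightarrow> complex^'m"
  let ?Q = "?M ** P ** transpose ?M"
  let ?f = "\<lambda>a. A (?e a)"
  define C where "C R u w = (\<Sum>as | length as = k. \<Sum>bs | length bs = k.
      of_real (\<Prod>j<k. R $ (as ! j) $ (bs ! j)) * F (u # map ?e as) (w # map ?e bs))"
    for R :: "real^('m + 'm)^('m + 'm)" and u w
  have Fhead: "linear (\<lambda>u. F (u # us) ws)" "linear (\<lambda>w. F us (w # ws))" for us ws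
    using multilinear_form_slot[OF Suc.prems(1), of "[]"] multilinear_form_slot[OF Suc.prems(2), of _ "[]"] by auto
  have lin: "linear (\<lambda>u. C ?Q u w)" "linear (C ?Q u)" for u w
    unfolding C_def by (intro linear_compose_sum ballI linear_mult_left Fhead)+
  have split: "(\<Sum>as | length as = Suc k. \<Sum>bs | length bs
      = Suc k. of_real (\<Prod>j<Suc k. R $ (as ! j) $ (bs ! j))
        * F (map h as) (map h bs))
      = (\<Sum>a\<in>UNIV. \<Sum>b\<in>UNIV. of_real (R $ a $ b) * (\<Sum>as | length as = k. \<Sum>bs | length bs = k.
          of_real (\<Prod>j<k. R $ (as ! j) $ (bs ! j)) * F (h a # map h as) (h b # map h bs)))" for R h
    by (simp add: sum_lists_Suc prod.lessThan_Suc_shift sum_distrib_left mult.assoc del: prod.lessThan_Suc)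
      (simp add: sum.swap[of _ "{as. length as = k}" UNIV])
  have IH: "(\<Sum>as | length as = k. \<Sum>bs | length bs = k. of_real (\<Prod>j<k. P $ (as ! j) $ (bs ! j))
      * F (u # map ?f as) (w # map ?f bs)) = C ?Q u w" for u w
    unfolding C_def using Suc.prems by (intro Suc.IH multilinear_form_Cons)
  have "(\<Sum>a\<in>UNIV. \<Sum>b\<in>UNIV. of_real (P $ a $ b) * C ?Q (?f a) (?f b))
      = (\<Sum>a\<in>UNIV. \<Sum>b\<in>UNIV. \<Sum>c\<in>UNIV. \<Sum>d\<in>UNIV. of_real (?M $ c $ a * P $ a $ b * ?M $ d $ b) * C ?Q (?e c) (?e d))"
  proof (intro sum.cong refl)
    fix a b
    have "C ?Q (?f a) (?f b) = (\<Sum>c\<in>UNIV. \<Sum>d\<in>UNIV. of_real (?M $ c $ a * ?M $ d $ b)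
        * C ?Q (?e c) (?e d))"
      unfolding linear_expansion[OF lin(1)[of "?f b"], of "?f a"]
      by (subst linear_expansion[OF lin(2), of _ "?f b"])
        (simp add: real_matrix_def scaleR_conv_of_real sum_distrib_left mult.assoc)
    then show "of_real (P $ a $ b) * C ?Q (?f a) (?f b)
        = (\<Sum>c\<in>UNIV. \<Sum>d\<in>UNIV. of_real (?M $ c $ a * P $ a $ b * ?M $ d $ b) * C ?Q (?e c) (?e d))"
      by (simp add: sum_distrib_left mult_ac)
  qed
  also have "\<dots> = (\<Sum>c\<in>UNIV. \<Sum>d\<in>UNIV. \<Sum>a\<in>UNIV. \<Sum>b\<in>UNIV. of_real (?M $ c $ a * P $ a $ b * ?M $ d $ b)
      * C ?Q (?e c) (?e d))"
    by (rule sum_swap_pairs)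
  also have "\<dots> = (\<Sum>c\<in>UNIV. \<Sum>d\<in>UNIV. of_real (?Q $ c $ d) * C ?Q (?e c) (?e d))"
  proof (intro sum.cong refl)
    fix c d
    have "?Q $ c $ d = (\<Sum>b\<in>UNIV. \<Sum>a\<in>UNIV. ?M $ c $ a * P $ a $ b * ?M $ d $ b)"
      by (simp add: matrix_matrix_mult_def transpose_def sum_distrib_right)
    also have "\<dots> = (\<Sum>a\<in>UNIV. \<Sum>b\<in>UNIV. ?M $ c $ a * P $ a $ b * ?M $ d $ b)"
      by (rule sum.swap)
    finally show "(\<Sum>a\<in>UNIV. \<Sum>b\<in>UNIV. of_real (?M $ c $ a * P $ a $ b * ?M $ d $ b) * C ?Q (?e c) (?e d))
        = of_real (?Q $ c $ d) * C ?Q (?e c) (?e d)"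
      by (simp add: sum_distrib_right)
  qed
  finally show ?case
    unfolding split IH by (simp only: C_def)
qed

lemma multilinear_form_append_right:
  "multilinear_form \<alpha> \<Longrightarrow> multilinear_form (\<lambda>us. \<alpha> (us @ ws))"
  using multilinear_form_slot by (intro multilinear_formI) (simp, blast)

lemma hodge_star_isometry:
  fixes g g' :: "complex^'m::finite \<Rightarrow> complex^'m \<Rightarrow> real"
  assumes g: "positive_form g" "positive_form g'" "linear A" "\<And>v w. g' (A v) (A w) = g v w"
    and \<alpha>: "multilinear_form \<alpha>"
  shows "hodge_star g (\<lambda>vs. \<alpha> (map A vs)) ws = of_real (sgn (det (real_matrix A)))
      * hodge_star g' \<alpha> (map A ws)"
proof -
  define k where "k = 2 * CARD('m) - length ws"
  define F where "F us vs = \<alpha> us * volume_form g' (vs @ map A ws)" for us vs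
  have vol: "multilinear_form (volume_form g')"
    using alternating_volume_form by (auto simp: alternating_def)
  have F: "multilinear_form (\<lambda>us. F us vs)" "multilinear_form (F us)" for us vs
    using \<alpha> multilinear_form_append_right[OF vol]
    by (auto simp: F_def multilinear_form_def intro: linear_mult_left linear_mult_right)
  let ?s = "complex_of_real (sgn (det (real_matrix A)))"
  have "hodge_star g (\<lambda>vs. \<alpha> (map A vs)) ws = ?s *
      (\<Sum>as | length as = k. \<Sum>bs | length bs = k. of_real (\<Prod>j<k. matrix_inv (gram g) $ (as ! j) $ (bs ! j))
        * F (map (\<lambda>a. A (real_axis a)) as) (map (\<lambda>a. A (real_axis a)) bs)) / fact k"
    unfolding hodge_star_def Let_def k_def[symmetric]
    by (simp add: F_def volume_form_isometry[OF g] o_def sum_distrib_left mult_ac)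
  also have "\<dots> = ?s * hodge_star g' \<alpha> (map A ws)"
    unfolding contraction_change_frame[OF g(3) F] matrix_inv_gram_isometry(1)[OF g]
    by (simp add: hodge_star_def Let_def k_def F_def mult.assoc)
  finally show ?thesis .
qed

lemma alternating_sum:
  "(\<And>i. i \<in> I \<Longrightarrow> alternating (\<alpha> i)) \<Longrightarrow> alternating (\<lambda>vs. \<Sum>i\<in>I. \<alpha> i vs)"
  by (auto simp: alternating_def multilinear_form_def intro: linear_compose_sum)

lemma alternating_mult_left: "alternating \<alpha> \<Longrightarrow> alternating (\<lambda>vs. c * \<alpha> vs)"
  by (auto simp: alternating_def multilinear_form_def intro: linear_mult_left)

lemma alternating_append_right:
  fixes \<alpha> :: "'a::real_vector form_at"
  assumes "alternating \<alpha>" shows "alternating (\<lambda>ws. \<alpha> (us @ ws))"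
  unfolding alternating_def
proof (intro conjI allI impI)
  have m: "multilinear_form \<alpha>" using assms by (simp add: alternating_def)
  show "multilinear_form (\<lambda>ws. \<alpha> (us @ ws))"
    using multilinear_form_slot[OF m, of "us @ _"] by (intro multilinear_formI) simp
  fix vs :: "'a list" and i j assume "i < j" "j < length vs" "vs ! i = vs ! j"
  then show "\<alpha> (us @ vs) = 0"
    using assms unfolding alternating_def
    by (metis add_less_cancel_left length_append nth_append_length_plus)
qed

text \<open>The Hodge star selects, by the number of its arguments, a form from a family indexed by the
  degree.\<close>

lemma alternating_length_graded:
  assumes "\<And>k. alternating (\<alpha> k)" shows "alternating (\<lambda>vs. \<alpha> (length vs) vs)"
  using assms by (auto simp: alternating_def multilinear_form_def)

lemma alternating_hodge_star:
  fixes g :: "complex^'m::finite \<Rightarrow> complex^'m \<Rightarrow> real"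
  shows "alternating (hodge_star g \<alpha>)"
proof -
  define \<beta> where "\<beta> k ws = (\<Sum>as | length as = k. \<Sum>bs | length bs = k.
      (of_real (\<Prod>j<k. matrix_inv (gram g) $ (as ! j) $ (bs ! j)) * \<alpha> (map real_axis as) / fact k)
        * volume_form g (map real_axis bs @ ws))" for k ws
  have "alternating (\<beta> k)" for k
    unfolding \<beta>_def[abs_def]
    by (intro alternating_sum alternating_mult_left alternating_append_right alternating_volume_form)
  then have "alternating (\<lambda>ws. \<beta> (2 * CARD('m) - length ws) ws)"
    by (rule alternating_length_graded)
  then show ?thesis
    unfolding hodge_star_def[abs_def] Let_def sum_divide_distrib by (simp add: \<beta>_def field_simps)
qed

section \<open>Naturality of the Hodge Laplacian in coordinates\<close>

definition metric_field :: "(complex^'m \<Rightarrow> complex^'m \<Rightarrow> complex^'m \<Rightarrow> real) \<Rightarrow> (complex^'m) set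
    \<Rightarrow> bool" where
  "metric_field g S \<longleftrightarrow> (\<forall>z\<in>S. positive_form (g z)) \<and> (\<forall>v w. smooth_on (\<lambda>z. g z v w) S)"

lemma smooth_on_det:
  fixes f :: "'u::real_normed_vector \<Rightarrow> real^'n^'n"
  assumes "open S" "\<And>a b. smooth_on (\<lambda>y. f y $ a $ b) S"
  shows "smooth_on (\<lambda>y. det (f y)) S"
  unfolding det_def using assms by (intro smooth_on_sum smooth_on_mult smooth_on_prod smooth_on_const)

text \<open>By Cramer's rule the entries of the inverse are quotients of determinants.\<close>

lemma smooth_on_matrix_inv:
  fixes f :: "'u::real_normed_vector \<Rightarrow> real^'n^'n"
  assumes S: "open S" and f: "\<And>a b. smooth_on (\<lambda>y. f y $ a $ b) S" and nz: "\<And>y. y \<in> S \<Longrightarrow> det (f y) \<noteq> 0"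
  shows "smooth_on (\<lambda>y. matrix_inv (f y) $ a $ b) S"
proof -
  let ?c = "\<lambda>y. \<chi> i j. if j = a then axis b 1 $ i else f y $ i $ j"
  have "matrix_inv (f y) $ a $ b = det (?c y) * inverse (det (f y))" if y: "y \<in> S" for y
  proof -
    obtain B where B: "f y ** B = mat 1"
      using nz[OF y] invertible_det_nz[of "f y"] by (auto simp: invertible_def)
    have "f y *v (B *v axis b 1) = axis b 1" by (simp add: matrix_vector_mul_assoc B)
    then have "B *v axis b 1 = (\<chi> k. det (\<chi> i j. if j
        = k then axis b 1 $ i else f y $ i $ j) / det (f y))"
      using cramer[OF nz[OF y]] by blast
    then have "(B *v axis b 1) $ a = det (?c y) / det (f y)" by simp
    moreover have "(B *v axis b 1) $ a = B $ a $ b"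
      by (simp add: matrix_vector_mult_def axis_def if_distrib[of "\<lambda>x. _ * x"] cong: if_cong)
    ultimately show ?thesis by (simp add: matrix_inv_eqI[OF B] field_simps)
  qed
  moreover have "smooth_on (\<lambda>y. det (?c y) * inverse (det (f y))) S"
  proof (intro smooth_on_mult smooth_on_inverse smooth_on_det S f nz)
    show "smooth_on (\<lambda>y. ?c y $ i $ j) S" for i j
      using f smooth_on_const by (cases "j = a") simp_all
  qed
  ultimately show ?thesis by (subst smooth_on_cong[OF S])
qed

lemma smooth_field_hodge_star:
  fixes g :: "complex^'m::finite \<Rightarrow> complex^'m \<Rightarrow> complex^'m \<Rightarrow> real"
  assumes S: "open S" and g: "metric_field g S" and \<alpha>: "\<And>vs. smooth_on (\<lambda>y. \<alpha> y vs) S"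
  shows "smooth_field (\<lambda>y. hodge_star (g y) (\<alpha> y)) S"
proof -
  have gram: "smooth_on (\<lambda>y. gram (g y) $ a $ b) S" for a b
    using g by (simp add: gram_def metric_field_def)
  have nz: "det (gram (g y)) \<noteq> 0" if "y \<in> S" for y
    using g that by (intro det_gram_nonzero) (simp add: metric_field_def)
  have of_real: "smooth_on (\<lambda>y. complex_of_real (f y)) S" if "smooth_on f S" for f
    by (rule smooth_on_compose_linear[OF bounded_linear_of_real that S])
  have "smooth_on (\<lambda>y. hodge_star (g y) (\<alpha> y) ws) S" for ws
    unfolding hodge_star_def Let_def volume_form_def divide_inverse
    by (intro smooth_on_sum smooth_on_mult smooth_on_const of_real smooth_on_prod smooth_on_matrix_inv
        smooth_on_sqrt smooth_on_det gram nz \<alpha> S)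
  then show ?thesis
    using alternating_hodge_star by (auto simp: smooth_field_def alternating_def)
qed

lemma smooth_field_codifferential:
  fixes g :: "complex^'m::finite \<Rightarrow> complex^'m \<Rightarrow> complex^'m \<Rightarrow> real"
  assumes S: "open S" and g: "metric_field g S" and \<alpha>: "\<And>vs. smooth_on (\<lambda>y. \<alpha> y vs) S"
  shows "smooth_field (codifferential g \<alpha>) S" "alternating (codifferential g \<alpha> z)"
proof -
  have d: "smooth_field (ext_deriv (\<lambda>y. hodge_star (g y) (\<alpha> y))) S"
    using assms by (intro smooth_field_ext_deriv smooth_field_hodge_star)
  then have "smooth_on (\<lambda>y. - hodge_star (g y) (ext_deriv (\<lambda>y. hodge_star (g y) (\<alpha> y)) y) vs) S" for vs
    using smooth_field_hodge_star[OF S g] S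
    by (intro smooth_on_minus) (auto simp: smooth_field_def)
  moreover have alt: "alternating (codifferential g \<alpha> z)" for z
    using alternating_mult_left[OF alternating_hodge_star, of "-1"]
    by (simp add: codifferential_def fun_Compl_def)
  ultimately show "smooth_field (codifferential g \<alpha>) S"
    by (auto simp: smooth_field_def codifferential_def alternating_def)
  show "alternating (codifferential g \<alpha> z)" by (rule alt)
qed

lemma codifferential_cong_on_open:
  assumes "open S" "z \<in> S" "\<And>y. y \<in> S \<Longrightarrow> \<alpha> y = \<beta> y"
  shows "codifferential g \<alpha> z = codifferential g \<beta> z"
proof -
  have "ext_deriv (\<lambda>y. hodge_star (g y) (\<alpha> y)) z = ext_deriv (\<lambda>y. hodge_star (g y) (\<beta> y)) z"
    using assms by (intro ext_deriv_cong_on_open[OF assms(1,2)]) simp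
  then show ?thesis by (simp add: codifferential_def)
qed

text \<open>The expression of the Hodge Laplacian in one coordinate domain.\<close>

definition laplacian :: "(complex^'m \<Rightarrow> complex^'m \<Rightarrow> complex^'m \<Rightarrow> real) \<Rightarrow>
    (complex^'m \<Rightarrow> (complex^'m) form_at) \<Rightarrow> complex^'m \<Rightarrow> (complex^'m) form_at" where
  "laplacian g \<alpha> z = ext_deriv (codifferential g \<alpha>) z + codifferential g (ext_deriv \<alpha>) z"

lemma laplacian_cong_on_open:
  assumes "open S" "z \<in> S" "\<And>y. y \<in> S \<Longrightarrow> \<alpha> y = \<beta> y"
  shows "laplacian g \<alpha> z = laplacian g \<beta> z"
  unfolding laplacian_def
      using assms codifferential_cong_on_open[OF assms(1)] ext_deriv_cong_on_open[OF assms(1)]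
  by (intro arg_cong2[where f = "(+)"] ext_deriv_cong_on_open[OF assms(1,2)] codifferential_cong_on_open[OF assms(1,2)])
    blast+

locale local_isometry =
  fixes \<phi> :: "complex^'m::finite \<Rightarrow> complex^'m" and S T g g'
  assumes S: "open S" and T: "open T" and \<phi>: "smooth_on \<phi> S" and \<phi>_ST: "\<phi> ` S \<subseteq> T"
    and g: "metric_field g S" and g': "metric_field g' T"
    and isometry: "\<And>z v w. z \<in> S \<Longrightarrow>
      g' (\<phi> z) (fderiv \<phi> z v) (fderiv \<phi> z w) = g z v w"
begin

lemma hodge_star_pullback:
  assumes z: "z \<in> S" and \<alpha>: "multilinear_form (\<alpha> (\<phi> z))"
  shows "hodge_star (g z) (pullback \<phi> \<alpha> z)
    = (\<lambda>vs. of_real (sgn (det (real_matrix (fderiv \<phi> z))))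
        * pullback \<phi> (\<lambda>w. hodge_star (g' w) (\<alpha> w)) z vs)"
  unfolding pullback_def using g g' z \<phi>_ST \<alpha> isometry smooth_on_linear_derivative[OF \<phi> z]
  by (intro ext hodge_star_isometry) (auto simp: metric_field_def)

text \<open>The star is natural only up to the sign of the Jacobian determinant. That sign is locally constant
  and enters the codifferential twice.\<close>

lemma codifferential_pullback:
  assumes z: "z \<in> S" and \<alpha>: "smooth_field \<alpha> T"
  shows "codifferential g (pullback \<phi> \<alpha>) z = pullback \<phi> (codifferential g' \<alpha>) z"
proof -
  define J where "J y = det (real_matrix (fderiv \<phi> y))" for y
  define \<beta> where "\<beta> w = hodge_star (g' w) (\<alpha> w)" for w
  have \<beta>: "smooth_field \<beta> T" "alternating (\<beta> w)" for w
    using smooth_field_hodge_star[OF T g'] \<alpha> alternating_hodge_star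
    by (auto simp: \<beta>_def[abs_def] smooth_field_def)
  have \<phi>z: "\<phi> y \<in> T" if "y \<in> S" for y using that \<phi>_ST by auto
  have J0: "J y \<noteq> 0" if "y \<in> S" for y
    unfolding J_def using g g' that \<phi>_ST isometry smooth_on_linear_derivative[OF \<phi> that]
    by (intro matrix_inv_gram_isometry(2)[of "g y" "g' (\<phi> y)"]) (auto simp: metric_field_def)
  have "smooth_on J S"
    unfolding J_def
  proof (rule smooth_on_det[OF S])
    show "smooth_on (\<lambda>y. real_matrix (fderiv \<phi> y) $ a $ b) S" for a b
      using smooth_on_compose_linear[OF bounded_linear_real_coord smooth_on_derivative[OF \<phi>] S]
      by (simp add: real_matrix_def)
  qed
  then have cont: "continuous_on S J" by (rule smooth_on_continuous_on)
  define N where "N = (\<lambda>y. J z * J y) -` {0<..} \<inter> S"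
  have "open N"
    unfolding N_def using S cont
    by (intro continuous_on_open_vimage[THEN iffD1, rule_format]) (auto intro!: continuous_intros)
  have zN: "z \<in> N" using z J0[OF z] by (simp add: N_def zero_less_mult_iff) linarith
  have sgn_J: "sgn (J y) = sgn (J z)" if "y \<in> N" for y
    using that by (auto simp: N_def zero_less_mult_iff sgn_if)
  let ?s = "complex_of_real (sgn (J z))"
  have star: "hodge_star (g y) (pullback \<phi> \<alpha> y) = (\<lambda>vs. ?s * pullback \<phi> \<beta> y vs)" if y: "y \<in> N" for y
    using hodge_star_pullback[of y \<alpha>] y \<alpha> \<phi>z sgn_J[OF y]
    by (simp add: N_def J_def \<beta>_def[abs_def] smooth_field_def)
  have "ext_deriv (\<lambda>y. hodge_star (g y) (pullback \<phi> \<alpha> y)) z = ext_deriv (\<lambda>y vs. ?s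
      * pullback \<phi> \<beta> y vs) z"
    by (rule ext_deriv_cong_on_open[OF \<open>open N\<close> zN star])
  also have "\<dots> = (\<lambda>vs. ?s * ext_deriv (pullback \<phi> \<beta>) z vs)"
  proof -
    have "smooth_on (\<lambda>y. pullback \<phi> \<beta> y us) S" for us
    proof -
      have "smooth_field (\<lambda>y. \<beta> (\<phi> y)) S"
        using \<beta> \<phi>_ST \<phi> S smooth_on_compose unfolding smooth_field_def by blast
      then have "smooth_on (\<lambda>y. \<beta> (\<phi> y) (map (\<lambda>w. w y) (map (\<lambda>u y. fderiv \<phi> y u) us))) S"
        by (rule smooth_on_multilinear[OF S]) (auto intro: smooth_on_derivative[OF \<phi>])
      then show ?thesis by (simp add: pullback_def o_def)
    qed
    then have "((\<lambda>y. ?s * pullback \<phi> \<beta> y us) has_derivative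
        (\<lambda>v. ?s * fderiv (\<lambda>y. pullback \<phi> \<beta> y us) z v)) (at z)" for us
      by (intro has_derivative_mult_right smooth_on_has_derivative[OF _ z])
    note frechet_derivative_eqI[OF this]
    then show ?thesis
      by (simp add: ext_deriv_def fun_eq_iff sum_distrib_left mult_ac del: take_append drop_append)
  qed
  also have "\<dots> = (\<lambda>vs. ?s * pullback \<phi> (ext_deriv \<beta>) z vs)"
    using ext_deriv_pullback[OF S z T \<phi>_ST \<phi> \<beta>] by simp
  finally have d: "ext_deriv (\<lambda>y. hodge_star (g y) (pullback \<phi> \<alpha> y)) z
      = (\<lambda>vs. ?s * pullback \<phi> (ext_deriv \<beta>) z vs)" .
  have "codifferential g (pullback \<phi> \<alpha>) z
      = - hodge_star (g z) (\<lambda>vs. ?s * pullback \<phi> (ext_deriv \<beta>) z vs)"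
    by (simp add: codifferential_def d)
  also have "hodge_star (g z) (\<lambda>vs. ?s * pullback \<phi> (ext_deriv \<beta>) z vs)
      = (\<lambda>vs. ?s * hodge_star (g z) (pullback \<phi> (ext_deriv \<beta>) z) vs)"
    by (simp add: hodge_star_def Let_def fun_eq_iff sum_distrib_left mult_ac)
  also have "\<dots> = (\<lambda>vs. (?s * ?s) * pullback \<phi> (\<lambda>w. hodge_star (g' w) (ext_deriv \<beta> w)) z vs)"
    using hodge_star_pullback[OF z, of "ext_deriv \<beta>"] smooth_field_ext_deriv[OF T \<beta>(1)] \<phi>z[OF z]
    by (simp add: smooth_field_def J_def mult.assoc)
  also have "?s * ?s = 1" using J0[OF z] by (simp add: sgn_if)
  finally have eq: "codifferential g (pullback \<phi> \<alpha>) z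
      = - (\<lambda>vs. 1 * pullback \<phi> (\<lambda>w. hodge_star (g' w) (ext_deriv \<beta> w)) z vs)" .
  show ?thesis
    unfolding eq by (simp add: codifferential_def pullback_def fun_eq_iff \<beta>_def[abs_def])
qed

lemma laplacian_pullback:
  assumes z: "z \<in> S" and \<alpha>: "smooth_field \<alpha> T" "\<And>w. w \<in> T \<Longrightarrow> alternating (\<alpha> w)"
  shows "laplacian g (pullback \<phi> \<alpha>) z = pullback \<phi> (laplacian g' \<alpha>) z"
proof -
  have \<alpha>_smooth: "smooth_on (\<lambda>y. \<alpha> y vs) T" for vs
    using \<alpha> by (simp add: smooth_field_def)
  have "ext_deriv (codifferential g (pullback \<phi> \<alpha>)) z = ext_deriv (pullback \<phi> (codifferential g' \<alpha>)) z"
    by (rule ext_deriv_cong_on_open[OF S z codifferential_pullback[OF _ \<alpha>(1)]])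
  also have "\<dots> = pullback \<phi> (ext_deriv (codifferential g' \<alpha>)) z"
    using smooth_field_codifferential[OF T g' \<alpha>_smooth]
    by (intro ext_deriv_pullback[OF S z T \<phi>_ST \<phi>])
  finally have 1: "ext_deriv (codifferential g (pullback \<phi> \<alpha>)) z
      = pullback \<phi> (ext_deriv (codifferential g' \<alpha>)) z" .
  have "codifferential g (ext_deriv (pullback \<phi> \<alpha>)) z = codifferential g (pullback \<phi> (ext_deriv \<alpha>)) z"
    using \<phi>_ST \<alpha> by (intro codifferential_cong_on_open[OF S z] ext_deriv_pullback[OF S _ T \<phi>_ST \<phi>]) auto
  also have "\<dots> = pullback \<phi> (codifferential g' (ext_deriv \<alpha>)) z"
    by (rule codifferential_pullback[OF z smooth_field_ext_deriv[OF T \<alpha>(1)]])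
  finally show ?thesis
    unfolding laplacian_def 1 by (simp add: pullback_def fun_eq_iff laplacian_def)
qed

end

section \<open>Forms of type (p,q)\<close>

lemma wedge_slot_sum:
  fixes e :: "'k \<Rightarrow> 'v \<Rightarrow> complex"
  shows "wedge (xs @ (\<lambda>v. \<Sum>k\<in>K. a k * e k v) # ys) vs = (\<Sum>k\<in>K. a k * wedge (xs @ e k # ys) vs)"
proof (cases "length vs = Suc (length xs + length ys)")
  case True
  let ?n = "length vs" and ?j = "length xs"
  have split: "(\<Prod>j<?n. ((xs @ \<alpha> # ys) ! j) (vs ! \<sigma> j))
      = \<alpha> (vs ! \<sigma> ?j) * (\<Prod>j\<in>{..<?n} - {?j}. ((xs @ undefined # ys) ! j) (vs ! \<sigma> j))" for \<alpha> \<sigma>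
  proof -
    have "(\<Prod>j<?n. ((xs @ \<alpha> # ys) ! j) (vs ! \<sigma> j))
        = \<alpha> (vs ! \<sigma> ?j) * (\<Prod>j\<in>{..<?n} - {?j}. ((xs @ \<alpha> # ys) ! j) (vs ! \<sigma> j))"
      using True by (subst prod.remove[of _ ?j]) auto
    also have "(\<Prod>j\<in>{..<?n} - {?j}. ((xs @ \<alpha> # ys) ! j) (vs ! \<sigma> j))
        = (\<Prod>j\<in>{..<?n} - {?j}. ((xs @ undefined # ys) ! j) (vs ! \<sigma> j))"
      by (intro prod.cong refl) (auto simp: nth_append nth_Cons split: nat.splits)
    finally show ?thesis .
  qed
  show ?thesis
    using True unfolding wedge_def split
    by (simp add: sum_distrib_left sum_distrib_right mult_ac sum.swap[of _ K])
qed (simp add: wedge_def)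

lemma wedge_list_sum:
  fixes e :: "'k::finite \<Rightarrow> 'v \<Rightarrow> complex"
  shows "wedge (xs @ map (\<lambda>i v. \<Sum>k\<in>UNIV. a i k * e k v) is @ ys) vs
    = (\<Sum>ks | length ks = length is. (\<Prod>j<length is. a (is ! j) (ks ! j)) * wedge (xs @ map e ks @ ys) vs)"
proof (induction "is" arbitrary: xs)
  case (Cons i "is")
  have "wedge (xs @ map (\<lambda>i v. \<Sum>k\<in>UNIV. a i k * e k v) (i # is) @ ys) vs
      = (\<Sum>k\<in>UNIV. a i k * wedge ((xs @ [e k]) @ map (\<lambda>i v. \<Sum>k\<in>UNIV. a i k * e k v) is @ ys) vs)"
    by (simp add: wedge_slot_sum)
  then show ?case
    unfolding Cons.IH
    by (simp add: sum_lists_Suc prod.lessThan_Suc_shift sum_distrib_left mult.assoc del: prod.lessThan_Suc)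
qed simp

lemma wedge_map: "wedge \<alpha>s (map A vs) = wedge (map (\<lambda>\<alpha> v. \<alpha> (A v)) \<alpha>s) vs"
proof (cases "length vs = length \<alpha>s")
  case True
  have "\<sigma> j < length vs" if "\<sigma> permutes {..<length vs}" "j < length vs" for \<sigma> j
    using permutes_in_image[OF that(1)] that(2) by auto
  then show ?thesis using True unfolding wedge_def
    by (auto intro!: sum.cong prod.cong)
qed (simp add: wedge_def)

lemma complex_linear_expansion:
  fixes A :: "complex^'m::finite \<Rightarrow> complex^'m"
  assumes A: "linear A" and i: "\<And>v. A (\<i> *s v) = \<i> *s A v"
  shows "A v $ k = (\<Sum>l\<in>UNIV. A (axis l 1) $ k * v $ l)"
proof -
  have scale: "A (c *s w) = c *s A w" for c w
  proof -
    have eq: "d *s u = Re d *\<^sub>R u + Im d *\<^sub>R (\<i> *s u)" for d and u :: "complex^'m"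
      by (simp add: vec_eq_iff complex_eq_iff)
    show ?thesis
      unfolding eq[of c] by (simp add: linear_add[OF A] linear_scale[OF A] i)
  qed
  have "v = (\<Sum>l\<in>UNIV. v $ l *s axis l 1)" by (simp add: basis_expansion)
  then have "A v = (\<Sum>l\<in>UNIV. A (v $ l *s axis l 1))" using linear_sum[OF A] by metis
  then show ?thesis by (simp add: scale mult.commute)
qed

text \<open>A complex-linear map pulls the \<open>dz\<^sub>i\<close> back to combinations of the \<open>dz\<^sub>k\<close>, and the \<open>dzbar\<^sub>i\<close>
  to combinations of the \<open>dzbar\<^sub>k\<close>. Expanding the wedge product keeps both numbers of factors.\<close>

lemma forms_at_pq_pullback:
  fixes A :: "complex^'m::finite \<Rightarrow> complex^'m"
  assumes A: "linear A" "\<And>v. A (\<i> *s v) = \<i> *s A v" and \<alpha>: "\<alpha> \<in> forms_at_pq p q"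
  shows "(\<lambda>vs. \<alpha> (map A vs)) \<in> forms_at_pq p q"
proof -
  obtain f where f: "\<And>vs. \<alpha> vs = (\<Sum>I | length I = p. \<Sum>J | length J = q. f I J
      * wedge (map dz I @ map dzbar J) vs)"
    using \<alpha> by (auto simp: forms_at_pq_def)
  define a where "a i k = A (axis k 1) $ i" for i k
  define b where "b i k = cnj (a i k)" for i k
  define cI where "cI I K = (\<Prod>j<p. a (I ! j) (K ! j))" for I K
  define cJ where "cJ J L = (\<Prod>j<q. b (J ! j) (L ! j))" for J L
  have dz: "(\<lambda>v. dz i (A v)) = (\<lambda>v. \<Sum>k\<in>UNIV. a i k * dz k v)" for i
    unfolding dz_def a_def by (rule ext) (rule complex_linear_expansion[OF A])
  have dzbar: "(\<lambda>v. dzbar i (A v)) = (\<lambda>v. \<Sum>k\<in>UNIV. b i k * dzbar k v)" for i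
    unfolding dzbar_def b_def a_def by (rule ext) (subst complex_linear_expansion[OF A], simp)
  have w: "wedge (map dz I @ map dzbar J) (map A vs)
      = (\<Sum>K | length K = p. \<Sum>L | length L = q. cI I K * cJ J L * wedge (map dz K @ map dzbar L) vs)"
    if "length I = p" "length J = q" for I J vs
  proof -
    have "wedge (map dz I @ map dzbar J) (map A vs) = wedge ([] @ map (\<lambda>i v. \<Sum>k\<in>UNIV. a i k * dz k v) I
        @ map (\<lambda>i v. \<Sum>k\<in>UNIV. b i k * dzbar k v) J) vs"
      unfolding wedge_map by (simp add: o_def dz dzbar)
    also have "\<dots> = (\<Sum>K | length K = p. cI I K *
        wedge (map dz K @ map (\<lambda>i v. \<Sum>k\<in>UNIV. b i k * dzbar k v) J @ []) vs)"
      by (subst wedge_list_sum) (simp add: cI_def that)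
    also have "\<dots> = (\<Sum>K | length K = p. \<Sum>L | length L = q. cI I K * cJ J L
        * wedge (map dz K @ map dzbar L) vs)"
    proof (rule sum.cong[OF refl])
      fix K
      have "wedge (map dz K @ map (\<lambda>i v. \<Sum>k\<in>UNIV. b i k * dzbar k v) J @ []) vs
          = (\<Sum>L | length L = q. cJ J L * wedge (map dz K @ map dzbar L @ []) vs)"
        unfolding wedge_list_sum cJ_def using that by simp
      then show "cI I K * wedge (map dz K @ map (\<lambda>i v. \<Sum>k\<in>UNIV. b i k * dzbar k v) J @ []) vs
          = (\<Sum>L | length L = q. cI I K * cJ J L * wedge (map dz K @ map dzbar L) vs)"
        by (simp only: sum_distrib_left mult.assoc append_Nil2)
    qed
    finally show ?thesis .
  qed
  have "\<alpha> (map A vs) = (\<Sum>K | length K = p. \<Sum>L | length L = q.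
      (\<Sum>I | length I = p. \<Sum>J | length J = q. f I J * (cI I K * cJ J L)) * wedge (map dz K @ map dzbar L) vs)" for vs
  proof -
    let ?P = "{I :: 'm list. length I = p}" and ?Q = "{J :: 'm list. length J = q}"
    let ?h = "\<lambda>I J K L. f I J * (cI I K * cJ J L) * wedge (map dz K @ map dzbar L) vs"
    have "\<alpha> (map A vs) = (\<Sum>I\<in>?P. \<Sum>J\<in>?Q. \<Sum>K\<in>?P. \<Sum>L\<in>?Q. ?h I J K L)"
      unfolding f by (simp add: w sum_distrib_left mult.assoc)
    also have "\<dots> = (\<Sum>K\<in>?P. \<Sum>L\<in>?Q. \<Sum>I\<in>?P. \<Sum>J\<in>?Q. ?h I J K L)"
      by (rule sum_swap_pairs)
    finally show ?thesis by (simp add: sum_distrib_right)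
  qed
  then show ?thesis
    unfolding forms_at_pq_def
    by (intro CollectI allI exI[of _ "\<lambda>K L. \<Sum>I | length I = p. \<Sum>J | length J = q. f I J * (cI I K
        * cJ J L)"])
qed

lemma forms_at_pq_lincomb:
  assumes "\<alpha> \<in> forms_at_pq p q" "\<beta> \<in> forms_at_pq p q"
  shows "(\<lambda>vs. \<alpha> vs + c * \<beta> vs) \<in> forms_at_pq p q"
proof -
  obtain f g where "\<And>vs. \<alpha> vs = (\<Sum>I | length I = p. \<Sum>J | length J = q. f I J
      * wedge (map dz I @ map dzbar J) vs)"
    "\<And>vs. \<beta> vs = (\<Sum>I | length I = p. \<Sum>J | length J = q. g I J * wedge (map dz I @ map dzbar J) vs)"
    using assms by (auto simp: forms_at_pq_def)
  then have "\<alpha> vs + c * \<beta> vs = (\<Sum>I | length I = p. \<Sum>J | length J = q.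
      (f I J + c * g I J) * wedge (map dz I @ map dzbar J) vs)" for vs
    by (simp add: sum_distrib_left distrib_right sum.distrib mult.assoc)
  then show ?thesis
    unfolding forms_at_pq_def by (intro CollectI exI[of _ "\<lambda>I J. f I J + c * g I J"] allI)
qed

lemma forms_at_pq_zero: "(0 :: (complex^'m::finite) form_at) \<in> forms_at_pq p q"
  unfolding forms_at_pq_def by (auto intro!: exI[of _ "\<lambda>I J. 0"])

section \<open>Eigenspaces are subspaces\<close>

lemma smooth_on_local:
  assumes "\<And>z. z \<in> S \<Longrightarrow> \<exists>N. open N \<and> z \<in> N \<and> smooth_on f N"
  shows "smooth_on f S"
proof -
  have "Ck_on k f S" if "\<And>z. z \<in> S \<Longrightarrow> \<exists>N. open N \<and> z \<in> N \<and> smooth_on f N" for k f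
    using that
  proof (induction k arbitrary: f)
    case 0
    then show ?case
      by (simp, intro continuous_at_imp_continuous_on ballI)
        (meson continuous_on_eq_continuous_at smooth_on_continuous_on)
  next
    case (Suc k)
    have "f differentiable (at z)" if "z \<in> S" for z
      using Suc.prems[OF that] smooth_on_differentiable by blast
    moreover have "Ck_on k (\<lambda>x. fderiv f x v) S" for v
      using Suc.prems smooth_on_derivative by (intro Suc.IH) blast
    ultimately show ?case by simp
  qed
  from this[OF assms] show ?thesis unfolding smooth_on_def by blast
qed

lemma ext_deriv_lincomb:
  fixes \<alpha> \<beta> :: "'v::real_normed_vector \<Rightarrow> 'v form_at"
  assumes z: "z \<in> S" and \<alpha>: "\<And>vs. smooth_on (\<lambda>y. \<alpha> y vs) S" and \<beta>: "\<And>vs. smooth_on (\<lambda>y. \<beta> y vs) S"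
  shows "ext_deriv (\<lambda>y vs. \<alpha> y vs + c * \<beta> y vs) z = (\<lambda>vs. ext_deriv \<alpha> z vs + c * ext_deriv \<beta> z vs)"
proof -
  have "((\<lambda>y. \<alpha> y us + c * \<beta> y us) has_derivative
      (\<lambda>v. fderiv (\<lambda>y. \<alpha> y us) z v + c * fderiv (\<lambda>y. \<beta> y us) z v)) (at z)" for us
    by (intro has_derivative_add has_derivative_mult_right smooth_on_has_derivative[OF _ z] \<alpha> \<beta>)
  note frechet_derivative_eqI[OF this]
  then show ?thesis
    by (simp add: ext_deriv_def fun_eq_iff sum_distrib_left sum.distrib distrib_left mult_ac
        del: take_append drop_append)
qed

lemma hodge_star_lincomb:
  "hodge_star g (\<lambda>vs. \<alpha> vs + c * \<beta> vs) = (\<lambda>vs. hodge_star g \<alpha> vs + c * hodge_star g \<beta> vs)"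
  by (simp add: hodge_star_def Let_def fun_eq_iff sum_distrib_left sum.distrib distrib_left distrib_right
      add_divide_distrib mult_ac)

lemma codifferential_lincomb:
  fixes g :: "complex^'m::finite \<Rightarrow> complex^'m \<Rightarrow> complex^'m \<Rightarrow> real"
  assumes S: "open S" and g: "metric_field g S" and z: "z \<in> S"
    and \<alpha>: "\<And>vs. smooth_on (\<lambda>y. \<alpha> y vs) S" and \<beta>: "\<And>vs. smooth_on (\<lambda>y. \<beta> y vs) S"
  shows "codifferential g (\<lambda>y vs. \<alpha> y vs + c * \<beta> y vs) z
    = (\<lambda>vs. codifferential g \<alpha> z vs + c * codifferential g \<beta> z vs)"
proof -
  have "smooth_on (\<lambda>y. hodge_star (g y) (\<omega> y) vs) S" if "\<And>vs. smooth_on (\<lambda>y. \<omega> y vs) S" for \<omega> vs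
    using smooth_field_hodge_star[OF S g that] by (simp add: smooth_field_def)
  then show ?thesis
    unfolding codifferential_def hodge_star_lincomb
    by (subst ext_deriv_lincomb[OF z]) (auto simp: hodge_star_lincomb fun_eq_iff \<alpha> \<beta>)
qed

lemma laplacian_lincomb:
  fixes g :: "complex^'m::finite \<Rightarrow> complex^'m \<Rightarrow> complex^'m \<Rightarrow> real"
  assumes S: "open S" and g: "metric_field g S" and z: "z \<in> S"
    and \<alpha>: "smooth_field \<alpha> S" and \<beta>: "smooth_field \<beta> S"
  shows "laplacian g (\<lambda>y vs. \<alpha> y vs + c * \<beta> y vs) z
    = (\<lambda>vs. laplacian g \<alpha> z vs + c * laplacian g \<beta> z vs)"
proof -
  have sm: "smooth_on (\<lambda>y. \<alpha> y vs) S" "smooth_on (\<lambda>y. \<beta> y vs) S" for vs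
    using \<alpha> \<beta> by (auto simp: smooth_field_def)
  have d: "smooth_on (\<lambda>y. ext_deriv \<omega> y vs) S" if "smooth_field \<omega> S" for \<omega> vs
    using smooth_field_ext_deriv[OF S that] by (simp add: smooth_field_def)
  have \<delta>: "smooth_on (\<lambda>y. codifferential g \<omega> y vs) S" if "\<And>vs. smooth_on (\<lambda>y. \<omega> y vs) S" for \<omega> vs
    using smooth_field_codifferential(1)[OF S g that] by (simp add: smooth_field_def)
  have "ext_deriv (codifferential g (\<lambda>y vs. \<alpha> y vs + c * \<beta> y vs)) z
      = ext_deriv (\<lambda>y vs. codifferential g \<alpha> y vs + c * codifferential g \<beta> y vs) z"
    by (rule ext_deriv_cong_on_open[OF S z codifferential_lincomb[OF S g _ sm]])
  also have "\<dots> = (\<lambda>vs. ext_deriv (codifferential g \<alpha>) z vs + c * ext_deriv (codifferential g \<beta>) z vs)"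
    by (intro ext_deriv_lincomb[OF z] \<delta> sm)
  finally have 1: "ext_deriv (codifferential g (\<lambda>y vs. \<alpha> y vs + c * \<beta> y vs)) z = \<dots>" .
  have "codifferential g (ext_deriv (\<lambda>y vs. \<alpha> y vs + c * \<beta> y vs)) z
      = codifferential g (\<lambda>y vs. ext_deriv \<alpha> y vs + c * ext_deriv \<beta> y vs) z"
    by (rule codifferential_cong_on_open[OF S z ext_deriv_lincomb[OF _ sm]])
  also have "\<dots> = (\<lambda>vs. codifferential g (ext_deriv \<alpha>) z vs + c * codifferential g (ext_deriv \<beta>) z vs)"
    by (intro codifferential_lincomb[OF S g z] d \<alpha> \<beta>)
  finally show ?thesis
    unfolding laplacian_def 1 by (simp add: fun_eq_iff distrib_left)
qed

lemma alternating_form_lincomb: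
  assumes "alternating_form k \<alpha>" "alternating_form k \<beta>"
  shows "alternating_form k (\<lambda>vs. \<alpha> vs + c * \<beta> vs)"
  using assms unfolding alternating_form_def
  by (auto intro!: linear_compose_add linear_mult_left)

text \<open>What the differential operators see of a manifold. The quotients have this property together
  with \<open>X\<close>, since their charts have the same coordinates.\<close>

definition local_data :: "('i, 'a, 'm::finite) hermitian_data \<Rightarrow> bool" where
  "local_data M \<longleftrightarrow> (\<forall>i\<in>charts M. open (chart_image M i) \<and> metric_field (riem M i) (chart_image M i))"

lemma smooth_forms_field:
  assumes "\<omega> \<in> smooth_forms M k" "i \<in> charts M"
  shows "smooth_field (\<omega> i) (chart_image M i)" "z \<in> chart_image M i \<Longrightarrow> alternating (\<omega> i z)"
  using assms alternating_form_imp_alternating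
  by (fastforce simp: smooth_forms_def smooth_field_def alternating_def)+

lemma hodge_laplacian_eq:
  "hodge_laplacian M \<omega> i z = (if i \<in> charts M \<and> z
      \<in> chart_image M i then laplacian (riem M i) (\<omega> i) z else 0)"
  by (simp add: hodge_laplacian_def laplacian_def)

abbreviation eigenforms :: "('i, 'a, 'm::finite) hermitian_data \<Rightarrow> nat \<Rightarrow> nat \<Rightarrow> complex \<Rightarrow>
    ('i, complex^'m) diff_form set" where
  "eigenforms M p q c \<equiv> eigenspace (hodge_laplacian M) (forms_pq M p q) c"

text \<open>The derivatives in the Laplacian are additive on differentiable families only, so linearity
  is established for forms and not for arbitrary families of functions.\<close>

lemma subspace_eigenforms:
  fixes M :: "('i, 'a, 'm::finite) hermitian_data"
  assumes M: "local_data M"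
  shows "form_space.subspace (eigenforms M p q c)"
proof -
  let ?E = "eigenforms M p q c"
  have lincomb: "\<omega> + scale_form r \<eta> \<in> ?E" if "\<omega> \<in> ?E" "\<eta> \<in> ?E" for \<omega> \<eta> r
  proof -
    have \<omega>: "\<omega> \<in> smooth_forms M (p + q)" "\<And>i z. i \<in> charts M \<Longrightarrow> z \<in> chart_image M i \<Longrightarrow> \<omega> i z
        \<in> forms_at_pq p q"
      "hodge_laplacian M \<omega> = scale_form c \<omega>"
      and \<eta>: "\<eta> \<in> smooth_forms M (p + q)" "\<And>i z. i \<in> charts M \<Longrightarrow> z \<in> chart_image M i \<Longrightarrow> \<eta> i z
          \<in> forms_at_pq p q"
      "hodge_laplacian M \<eta> = scale_form c \<eta>"
      using that by (auto simp: eigenspace_def forms_pq_def)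
    have eq: "(\<omega> + scale_form r \<eta>) i = (\<lambda>z vs. \<omega> i z vs + r * \<eta> i z vs)" for i
      by (simp add: scale_form_def fun_eq_iff)
    have "\<omega> + scale_form r \<eta> \<in> smooth_forms M (p + q)"
      unfolding smooth_forms_def mem_Collect_eq eq
    proof (intro conjI allI ballI impI)
      show "(\<lambda>vs. \<omega> i z vs + r * \<eta> i z vs) = 0" if "i \<notin> charts M \<or> z \<notin> chart_image M i" for i z
        using \<omega>(1) \<eta>(1) that by (auto simp: smooth_forms_def fun_eq_iff)
      show "alternating_form (p + q) (\<lambda>vs. \<omega> i z vs + r * \<eta> i z vs)"
          if "i \<in> charts M" "z \<in> chart_image M i" for i z
        using \<omega>(1) \<eta>(1) that by (intro alternating_form_lincomb) (auto simp: smooth_forms_def)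
      show "smooth_on (\<lambda>z. \<omega> i z vs + r * \<eta> i z vs) (chart_image M i)" if "i \<in> charts M" for i vs
        using \<omega>(1) \<eta>(1) that M
        by (intro smooth_on_add smooth_on_mult smooth_on_const) (auto simp: smooth_forms_def local_data_def)
    next
      fix i j z vs assume "i \<in> charts M" "j \<in> charts M" "z \<in> local_dom M i M j id"
      then show "\<omega> j (local_rep M i M j id z) (map (fderiv (local_rep M i M j id) z) vs)
          + r * \<eta> j (local_rep M i M j id z) (map (fderiv (local_rep M i M j id) z) vs)
          = \<omega> i z vs + r * \<eta> i z vs"
        using \<omega>(1) \<eta>(1) by (simp add: smooth_forms_def)
    qed
    moreover have "(\<omega> + scale_form r \<eta>) i z \<in> forms_at_pq p q" if "i \<in> charts M" "z \<in> chart_image M i"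
        for i z
      unfolding eq using \<omega>(2) \<eta>(2) that by (intro forms_at_pq_lincomb)
    moreover have "hodge_laplacian M (\<omega> + scale_form r \<eta>) i z = scale_form c (\<omega> + scale_form r \<eta>) i z"
        for i z
    proof (cases "i \<in> charts M \<and> z \<in> chart_image M i")
      case True
      then have "hodge_laplacian M (\<omega> + scale_form r \<eta>) i z
          = (\<lambda>vs. laplacian (riem M i) (\<omega> i) z vs + r * laplacian (riem M i) (\<eta> i) z vs)"
        unfolding hodge_laplacian_eq eq
            using M smooth_forms_field(1)[OF \<omega>(1)] smooth_forms_field(1)[OF \<eta>(1)]
        by (auto simp: local_data_def intro!: laplacian_lincomb[where S = "chart_image M i"])
      also have "\<dots> = (\<lambda>vs. scale_form c \<omega> i z vs + r * scale_form c \<eta> i z vs)"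
        using True by (simp add: hodge_laplacian_eq flip: \<omega>(3) \<eta>(3))
      finally show ?thesis by (simp add: scale_form_def fun_eq_iff algebra_simps)
    next
      case False
      then have "\<omega> i z = 0" "\<eta> i z = 0" using \<omega>(1) \<eta>(1) by (auto simp: smooth_forms_def)
      then show ?thesis using False
          by (simp only: hodge_laplacian_eq if_False scale_form_def plus_fun_apply) (simp add: fun_eq_iff)
    qed
    ultimately show ?thesis unfolding eigenspace_def forms_pq_def by (auto simp: fun_eq_iff)
  qed
  have zero: "0 \<in> ?E"
  proof -
    have "(0 :: (complex^'m) form_at) = (\<lambda>vs. 0)" by (simp add: fun_eq_iff)
    have star: "hodge_star g (\<lambda>vs. 0) = (\<lambda>vs. 0)" for g :: "complex^'m \<Rightarrow> complex^'m \<Rightarrow> real"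
      by (simp add: hodge_star_def fun_eq_iff Let_def)
    have d: "ext_deriv (\<lambda>y vs. 0) z = (\<lambda>vs. 0)" for z :: "complex^'m"
      by (simp add: ext_deriv_def fun_eq_iff frechet_derivative_const)
    have "laplacian g (\<lambda>z vs. 0) z = (\<lambda>vs. 0)" for g and z :: "complex^'m"
    proof -
      have neg: "- (\<lambda>vs. 0) = (\<lambda>vs :: (complex^'m) list. 0 :: complex)" by (simp add: fun_eq_iff)
      show ?thesis
        unfolding laplacian_def codifferential_def[abs_def] star d neg by (simp add: fun_eq_iff)
    qed
    then have "hodge_laplacian M 0 = scale_form c 0"
      by (auto simp: hodge_laplacian_eq scale_form_def fun_eq_iff zero_fun_def)
    moreover have "alternating_form (p + q) (\<lambda>vs :: (complex^'m) list. 0)"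
      by (simp add: alternating_form_def module_hom_zero)
    ultimately show ?thesis
      using forms_at_pq_zero[where 'm = 'm, of p q]
          unfolding eigenspace_def forms_pq_def smooth_forms_def
      by (simp add: zero_fun_def smooth_on_const)
  qed
  show ?thesis
    unfolding form_space.subspace_def
  proof (intro conjI zero ballI allI)
    show "x + y \<in> ?E" if "x \<in> ?E" "y \<in> ?E" for x y
      using lincomb[OF that, of 1] by simp
    show "scale_form r x \<in> ?E" if "x \<in> ?E" for r x
      using lincomb[OF zero that, of r] by simp
  qed
qed

section \<open>Pulling forms back along holomorphic isometries\<close>

text \<open>The component of \<open>F\<^sup>*\<omega>\<close> in a chart is computed in any chart around the image point; the
  choice does not matter if the components of \<open>\<omega>\<close> are compatible, see \<open>form_pullback_eq\<close>.\<close>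

definition form_pullback :: "('i, 'a, 'm::finite) hermitian_data \<Rightarrow> ('a \<Rightarrow> 'a) \<Rightarrow>
    ('i, complex^'m) diff_form \<Rightarrow> ('i, complex^'m) diff_form" where
  "form_pullback X F \<omega> i z =
     (if i \<in> charts X \<and> z \<in> chart_image X i then
        let j = SOME j. j \<in> charts X \<and> F (inv_into (chart_dom X i) (chart_map X i) z) \<in> chart_dom X j
        in pullback (local_rep X i X j F) (\<omega> j) z
      else 0)"

lemma pullback_cong:
  "\<alpha> (\<phi> z) = \<beta> (\<phi> z) \<Longrightarrow> pullback \<phi> \<alpha> z = pullback \<phi> \<beta> z"
  by (simp add: pullback_def fun_eq_iff)

lemma pullback_cong_on_open:
  assumes "open S" "z \<in> S" "\<And>y. y \<in> S \<Longrightarrow> \<phi> y = \<psi> y"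
  shows "pullback \<phi> \<alpha> z = pullback \<psi> \<alpha> z"
proof -
  have D: "fderiv \<phi> z = fderiv \<psi> z"
    by (rule frechet_derivative_cong_on_open[OF assms])
  show ?thesis using assms(2,3) by (simp add: pullback_def fun_eq_iff D)
qed

lemma pullback_compose:
  assumes "\<psi> differentiable (at (\<phi> z))" "\<phi> differentiable (at z)"
  shows "pullback (\<lambda>y. \<psi> (\<phi> y)) \<alpha> z = pullback \<phi> (pullback \<psi> \<alpha>) z"
  unfolding pullback_def frechet_derivative_eqI[OF frechet_derivative_compose[OF assms]]
  by (simp add: o_def)

lemma pullback_ident:
  assumes "open S" "z \<in> S" "\<And>y. y \<in> S \<Longrightarrow> \<phi> y = y"
  shows "pullback \<phi> \<alpha> z = \<alpha> z"
  by (subst pullback_cong_on_open[where \<psi> = "\<lambda>y. y", OF assms])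
    (simp_all add: pullback_def fun_eq_iff frechet_derivative_ident)

lemma alternating_form_map:
  assumes A: "linear A" and \<alpha>: "alternating_form k \<alpha>"
  shows "alternating_form k (\<lambda>vs. \<alpha> (map A vs))"
proof -
  have "linear (\<lambda>v. \<alpha> ((map A vs)[j := A v]))" if "length vs = k" "j < k" for vs j
    using \<alpha> that linear_compose[OF A, of "\<lambda>v. \<alpha> ((map A vs)[j := v])"]
    by (simp add: alternating_form_def o_def)
  then show ?thesis using \<alpha> unfolding alternating_form_def by (auto simp: map_update)
qed

locale hermitian_manifold =
  fixes X :: "('i, 'a, 'm::finite) hermitian_data"
  assumes complex: "complex_manifold X" and hermitian: "hermitian_metric X"
begin

abbreviation "cdom \<equiv> chart_dom X"
abbreviation "coord \<equiv> chart_map X"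
abbreviation "rep i j F \<equiv> local_rep X i X j F"

text \<open>This includes the identity, whose coordinate expressions are the transition maps, so the
  facts about coordinate expressions below cover both isometries and changes of charts.\<close>

definition isometric :: "('a \<Rightarrow> 'a) \<Rightarrow> bool" where
  "isometric F \<longleftrightarrow> holomorphic_map X X F \<and> preserves_metric X X F"

lemma isometric_id: "isometric id"
  using complex hermitian
  by (simp add: isometric_def holomorphic_map_def complex_manifold_def hermitian_metric_def)

lemma dom_subset: "i \<in> charts X \<Longrightarrow> cdom i \<subseteq> topspace (mtop X)"
  using complex by (auto simp: complex_manifold_def dest: openin_subset)

lemma openin_dom: "i \<in> charts X \<Longrightarrow> openin (mtop X) (cdom i)"
  using complex by (simp add: complex_manifold_def)

lemma ex_chart: "x \<in> topspace (mtop X) \<Longrightarrow> \<exists>i\<in>charts X. x \<in> cdom i"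
  using complex unfolding complex_manifold_def by blast

lemma coord_homeomorphic:
  "i \<in> charts X \<Longrightarrow> homeomorphic_map (subtopology (mtop X) (cdom i)) (top_of_set (chart_image X i)) (coord i)"
  using complex by (simp add: complex_manifold_def)

lemma coord_inj: "i \<in> charts X \<Longrightarrow> inj_on (coord i) (cdom i)"
  using homeomorphic_imp_injective_map[OF coord_homeomorphic] dom_subset
  by (simp add: Int_absorb1)

lemma coord_inv: "i \<in> charts X \<Longrightarrow> x \<in> cdom i \<Longrightarrow> inv_into (cdom i) (coord i) (coord i x) = x"
  by (rule inv_into_f_f[OF coord_inj])

lemma open_chart_image: "i \<in> charts X \<Longrightarrow> open (chart_image X i)"
  using complex by (simp add: complex_manifold_def)

lemma open_coord_image:
  assumes i: "i \<in> charts X" and U: "openin (mtop X) U" "U \<subseteq> cdom i"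
  shows "open (coord i ` U)"
proof -
  have "openin (subtopology (mtop X) (cdom i)) U"
    using U openin_dom[OF i] by (simp add: openin_open_subtopology)
  then have "openin (top_of_set (chart_image X i)) (coord i ` U)"
    using homeomorphic_imp_open_map[OF coord_homeomorphic[OF i]] by (simp add: open_map_def)
  then show ?thesis using open_chart_image[OF i] openin_open_trans by blast
qed

lemma coord_in_image: "x \<in> cdom i \<Longrightarrow> coord i x \<in> chart_image X i"
  by (simp add: chart_image_def)

lemma rep_coord: "i \<in> charts X \<Longrightarrow> x \<in> cdom i \<Longrightarrow> rep i j F (coord i x) = coord j (F x)"
  by (simp add: local_rep_def coord_inv)

lemma isometric_continuous: "isometric F \<Longrightarrow> continuous_map (mtop X) (mtop X) F"
  by (simp add: isometric_def holomorphic_map_def)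

lemma isometric_topspace: "isometric F \<Longrightarrow> x \<in> topspace (mtop X) \<Longrightarrow> F x \<in> topspace (mtop X)"
  using continuous_map_image_subset_topspace[OF isometric_continuous] by auto

lemma openin_preimage:
  assumes "isometric F" "openin (mtop X) U" "openin (mtop X) V"
  shows "openin (mtop X) {x \<in> V. F x \<in> U}"
proof -
  have "{x \<in> V. F x \<in> U} = V \<inter> {x \<in> topspace (mtop X). F x \<in> U}"
    using openin_subset[OF assms(3)] by auto
  then show ?thesis
    using openin_continuous_map_preimage[OF isometric_continuous[OF assms(1)] assms(2)] assms(3) by auto
qed

lemma metric_field_chart: "i \<in> charts X \<Longrightarrow> metric_field (riem X i) (chart_image X i)"
  using hermitian by (simp add: hermitian_metric_def metric_field_def positive_form_def)

lemma metric_field_subset: "metric_field g S \<Longrightarrow> T \<subseteq> S \<Longrightarrow> metric_field g T" for g S T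
  unfolding metric_field_def by (blast intro: smooth_on_subset)

lemma local_isometry_rep:
  assumes "isometric F" "i \<in> charts X" "j \<in> charts X"
  shows "local_isometry (rep i j F) (local_dom X i X j F) (chart_image X j) (riem X i) (riem X j)"
proof
  show "open (local_dom X i X j F)"
    unfolding local_dom_def using assms
    by (intro open_coord_image openin_preimage openin_dom) auto
  show "rep i j F ` local_dom X i X j F \<subseteq> chart_image X j"
    using assms by (auto simp: local_dom_def rep_coord coord_in_image)
  show "metric_field (riem X i) (local_dom X i X j F)"
    using assms by (intro metric_field_subset[OF metric_field_chart]) (auto simp: local_dom_def chart_image_def)
  show "smooth_on (rep i j F) (local_dom X i X j F)"
    using assms by (simp add: isometric_def holomorphic_map_def holomorphic_vec_def)
  show "riem X j (rep i j F z) (fderiv (rep i j F) z v) (fderiv (rep i j F) z w)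
      = riem X i z v w" if "z \<in> local_dom X i X j F" for z v w
    using assms that by (simp add: isometric_def preserves_metric_def Let_def)
qed (use assms in \<open>auto intro: open_chart_image metric_field_chart\<close>)

lemma rep_differentiable:
  assumes "isometric F" "i \<in> charts X" "j \<in> charts X" "x \<in> cdom i" "F x \<in> cdom j"
  shows "rep i j F differentiable (at (coord i x))"
  using assms(4,5)
  by (intro smooth_on_differentiable[OF local_isometry.\<phi>[OF local_isometry_rep[OF assms(1-3)]]])
    (auto simp: local_dom_def)

text \<open>Coordinate expressions compose wherever the intermediate chart is defined, which is on an open set;
  pullbacks see germs only.\<close>

lemma pullback_rep_compose:
  assumes F: "isometric F" and H: "isometric H" and K: "\<And>y. y \<in> topspace (mtop X) \<Longrightarrow> K y = H (F y)"
    and i: "i \<in> charts X" "j \<in> charts X" "k \<in> charts X"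
        and x: "x \<in> cdom i" "F x \<in> cdom j" "H (F x) \<in> cdom k"
  shows "pullback (rep i k K) \<alpha> (coord i x) = pullback (rep i j F) (pullback (rep j k H) \<alpha>) (coord i x)"
proof -
  let ?U = "{y \<in> cdom i. F y \<in> {w \<in> cdom j. H w \<in> cdom k}}"
  have "pullback (rep i k K) \<alpha> (coord i x) = pullback (\<lambda>y. rep j k H (rep i j F y)) \<alpha> (coord i x)"
  proof (rule pullback_cong_on_open[of "coord i ` ?U"])
    show "open (coord i ` ?U)"
      using i by (intro open_coord_image openin_preimage F H openin_dom) auto
    show "coord i x \<in> coord i ` ?U" using x by blast
    fix y assume "y \<in> coord i ` ?U"
    then show "rep i k K y = rep j k H (rep i j F y)"
      using i K dom_subset[OF i(1)] by (auto simp: rep_coord)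
  qed
  also have "\<dots> = pullback (rep i j F) (pullback (rep j k H) \<alpha>) (coord i x)"
    using rep_differentiable[OF F i(1,2) x(1,2)] rep_differentiable[OF H i(2,3) x(2,3)]
    by (intro pullback_compose) (simp_all add: rep_coord i x)
  finally show ?thesis .
qed

lemma smooth_forms_compatible:
  assumes "\<omega> \<in> smooth_forms X k" "i \<in> charts X" "j \<in> charts X" "x \<in> cdom i" "x \<in> cdom j"
  shows "pullback (rep i j id) (\<omega> j) (coord i x) = \<omega> i (coord i x)"
proof -
  have "coord i x \<in> local_dom X i X j id" using assms by (auto simp: local_dom_def)
  then show ?thesis using assms(1-3) by (simp add: smooth_forms_def pullback_def fun_eq_iff)
qed

text \<open>Compatibility of the components of \<open>\<omega>\<close> means that pullback along the identity turns the
  component in one chart into the component in another, and changing the chart around \<open>F x\<close>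
  composes \<open>F\<close> with the identity.\<close>

lemma form_pullback_eq:
  assumes F: "isometric F" and \<omega>: "\<omega> \<in> smooth_forms X k"
    and i: "i \<in> charts X" "j \<in> charts X" and x: "x \<in> cdom i" "F x \<in> cdom j"
  shows "form_pullback X F \<omega> i (coord i x) = pullback (rep i j F) (\<omega> j) (coord i x)"
proof -
  define j' where "j' = (SOME j. j \<in> charts X \<and> F x \<in> cdom j)"
  have "j \<in> charts X \<and> F x \<in> cdom j" using i x by simp
  then have j': "j' \<in> charts X \<and> F x \<in> cdom j'" unfolding j'_def by (rule someI)
  have "form_pullback X F \<omega> i (coord i x) = pullback (rep i j' F) (\<omega> j') (coord i x)"
    using i x by (simp add: form_pullback_def coord_inv coord_in_image j'_def Let_def)
  also have "\<dots> = pullback (rep i j' F) (pullback (rep j' j id) (\<omega> j)) (coord i x)"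
    using smooth_forms_compatible[OF \<omega>, of j' j "F x"] j' i x
    by (intro pullback_cong) (simp add: rep_coord)
  also have "\<dots> = pullback (rep i j F) (\<omega> j) (coord i x)"
    using j' i x by (intro pullback_rep_compose[OF F isometric_id, symmetric]) auto
  finally show ?thesis .
qed

lemma chart_imageE:
  assumes "z \<in> chart_image X i" "i \<in> charts X" "isometric F"
  obtains x j where "x \<in> cdom i" "z = coord i x" "j \<in> charts X" "F x \<in> cdom j"
  using assms ex_chart[OF isometric_topspace[OF assms(3)]] dom_subset[OF assms(2)]
  unfolding chart_image_def by blast

lemma form_pullback_near:
  assumes "isometric F" "\<omega> \<in> smooth_forms X k" "i \<in> charts X" "j \<in> charts X" "y \<in> local_dom X i X j F"
  shows "form_pullback X F \<omega> i y = pullback (rep i j F) (\<omega> j) y"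
  using assms form_pullback_eq[OF assms(1-4)] by (auto simp: local_dom_def)

lemma form_pullback_forms_pq:
  assumes F: "isometric F" and \<omega>: "\<omega> \<in> forms_pq X p q"
  shows "form_pullback X F \<omega> \<in> forms_pq X p q"
proof -
  have \<omega>s: "\<omega> \<in> smooth_forms X (p + q)"
    and \<omega>pq: "\<And>i z. i \<in> charts X \<Longrightarrow> z \<in> chart_image X i \<Longrightarrow> \<omega> i z \<in> forms_at_pq p q"
    using \<omega> by (auto simp: forms_pq_def)
  have \<omega>alt: "alternating_form (p + q) (\<omega> i z)" if "i \<in> charts X" "z \<in> chart_image X i" for i z
    using \<omega>s that by (simp add: smooth_forms_def)
  have local: "\<exists>j. j \<in> charts X \<and> z \<in> local_dom X i X j F" if "i \<in> charts X" "z \<in> chart_image X i"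
      for i z
    using chart_imageE[OF that(2,1) F] unfolding local_dom_def
        by (metis (mono_tags, lifting) image_eqI mem_Collect_eq)
  have pointwise: "alternating_form (p + q) (form_pullback X F \<omega> i z) \<and> form_pullback X F \<omega> i z
      \<in> forms_at_pq p q"
    if i: "i \<in> charts X" and z: "z \<in> chart_image X i" for i z
  proof -
    obtain j where j: "j \<in> charts X" "z \<in> local_dom X i X j F" using local[OF i z] by blast
    interpret local_isometry "rep i j F" "local_dom X i X j F" "chart_image X j" "riem X i" "riem X j"
      by (rule local_isometry_rep[OF F i j(1)])
    have D: "linear (fderiv (rep i j F) z)" by (rule smooth_on_linear_derivative[OF \<phi> j(2)])
    have "\<And>v. fderiv (rep i j F) z (\<i> *s v) = \<i> *s fderiv (rep i j F) z v"
      using F i j by (simp add: isometric_def holomorphic_map_def holomorphic_vec_def)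
    moreover have "rep i j F z \<in> chart_image X j" using j(2) \<phi>_ST by auto
    ultimately show ?thesis
      unfolding form_pullback_near[OF F \<omega>s i j] pullback_def
      using D j(1) \<omega>pq \<omega>alt by (auto intro: forms_at_pq_pullback alternating_form_map)
  qed
  have "form_pullback X F \<omega> \<in> smooth_forms X (p + q)"
    unfolding smooth_forms_def
  proof (intro CollectI conjI allI ballI impI)
    show "form_pullback X F \<omega> i z = 0" if "i \<notin> charts X \<or> z \<notin> chart_image X i" for i z
      using that by (auto simp: form_pullback_def)
    show "alternating_form (p + q) (form_pullback X F \<omega> i z)" if "i \<in> charts X" "z \<in> chart_image X i"
        for i z
      using pointwise[OF that] by simp
  next
    fix i vs assume i: "i \<in> charts X"
    show "smooth_on (\<lambda>z. form_pullback X F \<omega> i z vs) (chart_image X i)"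
    proof (rule smooth_on_local)
      fix z assume "z \<in> chart_image X i"
      then obtain j where j: "j \<in> charts X" "z \<in> local_dom X i X j F" using local[OF i] by blast
      interpret local_isometry "rep i j F" "local_dom X i X j F" "chart_image X j" "riem X i" "riem X j"
        by (rule local_isometry_rep[OF F i j(1)])
      have "smooth_field (\<lambda>y. \<omega> j (rep i j F y)) (local_dom X i X j F)"
        using smooth_forms_field(1)[OF \<omega>s j(1)] \<phi>_ST \<phi> S smooth_on_compose
        unfolding smooth_field_def by blast
      then have "smooth_on (\<lambda>y. \<omega> j (rep i j F y) (map (\<lambda>w. w y)
          (map (\<lambda>u y. fderiv (rep i j F) y u) vs))) (local_dom X i X j F)"
        by (rule smooth_on_multilinear[OF S]) (auto intro: smooth_on_derivative[OF \<phi>])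
      then have "smooth_on (\<lambda>y. pullback (rep i j F) (\<omega> j) y vs) (local_dom X i X j F)"
        by (simp add: pullback_def o_def)
      then have "smooth_on (\<lambda>y. form_pullback X F \<omega> i y vs) (local_dom X i X j F)"
        by (subst smooth_on_cong[OF S, of _ "\<lambda>y. pullback (rep i j F) (\<omega> j) y vs"])
          (simp_all add: form_pullback_near[OF F \<omega>s i j(1)])
      then show "\<exists>N. open N \<and> z \<in> N \<and> smooth_on (\<lambda>y. form_pullback X F \<omega> i y vs) N"
        using S j(2) by blast
    qed
  next
    fix i j z vs assume i: "i \<in> charts X" "j \<in> charts X" and "z \<in> local_dom X i X j id"
    then obtain x where x: "x \<in> cdom i" "x \<in> cdom j" "z = coord i x" by (auto simp: local_dom_def)
    obtain k where k: "k \<in> charts X" "F x \<in> cdom k"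
      using ex_chart[OF isometric_topspace[OF F]] dom_subset[OF i(1)] x(1) by blast
    have "pullback (rep i j id) (form_pullback X F \<omega> j) (coord i x)
        = pullback (rep i j id) (pullback (rep j k F) (\<omega> k)) (coord i x)"
      using form_pullback_eq[OF F \<omega>s i(2) k(1) x(2) k(2)]
          by (intro pullback_cong) (simp add: rep_coord i x)
    also have "\<dots> = pullback (rep i k F) (\<omega> k) (coord i x)"
      using i k x by (intro pullback_rep_compose[symmetric] F isometric_id) auto
    also have "\<dots> = form_pullback X F \<omega> i (coord i x)"
      using form_pullback_eq[OF F \<omega>s i(1) k(1) x(1) k(2)] by simp
    finally show "form_pullback X F \<omega> j (rep i j id z) (map (fderiv (rep i j id) z) vs)
        = form_pullback X F \<omega> i z vs"
      by (simp add: x(3) pullback_def fun_eq_iff)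
  qed
  then show ?thesis using pointwise by (simp add: forms_pq_def)
qed

lemma form_pullback_compose:
  assumes F: "isometric F" and H: "isometric H" and K: "\<And>y. y \<in> topspace (mtop X) \<Longrightarrow> K y = H (F y)"
    and K': "isometric K" and \<omega>: "\<omega> \<in> forms_pq X p q"
  shows "form_pullback X K \<omega> = form_pullback X F (form_pullback X H \<omega>)"
proof (intro ext)
  fix i z vs
  have \<omega>s: "\<omega> \<in> smooth_forms X (p + q)" "form_pullback X H \<omega> \<in> smooth_forms X (p + q)"
    using \<omega> form_pullback_forms_pq[OF H \<omega>] by (auto simp: forms_pq_def)
  show "form_pullback X K \<omega> i z vs = form_pullback X F (form_pullback X H \<omega>) i z vs"
  proof (cases "i \<in> charts X \<and> z \<in> chart_image X i")
    case True
    then obtain x j where x: "x \<in> cdom i" "z = coord i x" "j \<in> charts X" "F x \<in> cdom j"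
      using chart_imageE[OF _ _ F] by blast
    have xt: "x \<in> topspace (mtop X)" using x True dom_subset by blast
    obtain k where k: "k \<in> charts X" "H (F x) \<in> cdom k"
      using ex_chart isometric_topspace H F xt by metis
    have "form_pullback X K \<omega> i z = pullback (rep i k K) (\<omega> k) z"
      unfolding x(2) using True x k K[OF xt] by (intro form_pullback_eq[OF K' \<omega>s(1)]) auto
    also have "\<dots> = pullback (rep i j F) (pullback (rep j k H) (\<omega> k)) z"
      unfolding x(2) using True x k by (intro pullback_rep_compose F H K) auto
    also have "\<dots> = pullback (rep i j F) (form_pullback X H \<omega> j) z"
      using form_pullback_eq[OF H \<omega>s(1) x(3) k(1) x(4) k(2)] True x
      by (intro pullback_cong) (simp add: rep_coord)
    also have "\<dots> = form_pullback X F (form_pullback X H \<omega>) i z"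
      unfolding x(2) using True x by (intro form_pullback_eq[OF F \<omega>s(2), symmetric]) auto
    finally show ?thesis by simp
  qed (auto simp: form_pullback_def)
qed

lemma form_pullback_ident:
  assumes F: "isometric F" "\<And>y. y \<in> topspace (mtop X) \<Longrightarrow> F y = y" and \<omega>: "\<omega> \<in> smooth_forms X k"
  shows "form_pullback X F \<omega> = \<omega>"
proof (intro ext)
  fix i z vs
  show "form_pullback X F \<omega> i z vs = \<omega> i z vs"
  proof (cases "i \<in> charts X \<and> z \<in> chart_image X i")
    case True
    then obtain x where x: "x \<in> cdom i" "z = coord i x" by (auto simp: chart_image_def)
    have Fx: "F y = y" if "y \<in> cdom i" for y using F(2) True dom_subset that by blast
    have "form_pullback X F \<omega> i z = pullback (rep i i F) (\<omega> i) z"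
      unfolding x(2) using True x Fx by (intro form_pullback_eq[OF F(1) \<omega>]) auto
    also have "\<dots> = \<omega> i z"
      using True Fx by (intro pullback_ident[OF open_chart_image]) (auto simp: chart_image_def rep_coord)
    finally show ?thesis by simp
  qed (use \<omega> in \<open>auto simp: form_pullback_def smooth_forms_def\<close>)
qed

text \<open>Near each point the pullback is the pullback along one coordinate expression, and the
  Laplacian depends on germs only.\<close>

lemma form_pullback_eigenforms:
  assumes F: "isometric F" and \<omega>: "\<omega> \<in> eigenforms X p q c"
  shows "form_pullback X F \<omega> \<in> eigenforms X p q c"
proof -
  have pq: "\<omega> \<in> forms_pq X p q" and eig: "hodge_laplacian X \<omega> = scale_form c \<omega>"
    using \<omega> by (auto simp: eigenspace_def)
  have \<omega>s: "\<omega> \<in> smooth_forms X (p + q)" using pq by (simp add: forms_pq_def)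
  have "hodge_laplacian X (form_pullback X F \<omega>) i z = scale_form c (form_pullback X F \<omega>) i z" for i z
  proof (cases "i \<in> charts X \<and> z \<in> chart_image X i")
    case True
    then obtain x j where x: "x \<in> cdom i" "z = coord i x" "j \<in> charts X" "F x \<in> cdom j"
      using chart_imageE[OF _ _ F] by blast
    then have z: "z \<in> local_dom X i X j F" by (auto simp: local_dom_def)
    have i: "i \<in> charts X" using True by simp
    interpret local_isometry "rep i j F" "local_dom X i X j F" "chart_image X j" "riem X i" "riem X j"
      by (rule local_isometry_rep[OF F i x(3)])
    have "hodge_laplacian X (form_pullback X F \<omega>) i z = laplacian (riem X i) (form_pullback X F \<omega> i) z"
      using True by (simp add: hodge_laplacian_eq)
    also have "\<dots> = laplacian (riem X i) (pullback (rep i j F) (\<omega> j)) z"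
      by (rule laplacian_cong_on_open[OF S z form_pullback_near[OF F \<omega>s i x(3)]])
    also have "\<dots> = pullback (rep i j F) (laplacian (riem X j) (\<omega> j)) z"
      by (rule laplacian_pullback[OF z smooth_forms_field[OF \<omega>s x(3)]])
    also have "\<dots> = pullback (rep i j F) (scale_form c \<omega> j) z"
    proof (rule pullback_cong)
      have "rep i j F z \<in> chart_image X j" using z \<phi>_ST by auto
      then show "laplacian (riem X j) (\<omega> j) (rep i j F z) = scale_form c \<omega> j (rep i j F z)"
        using x(3) by (simp add: hodge_laplacian_eq flip: eig)
    qed
    also have "\<dots> = scale_form c (form_pullback X F \<omega>) i z"
      by (simp add: scale_form_def pullback_def fun_eq_iff form_pullback_near[OF F \<omega>s i x(3) z])
    finally show ?thesis .
  next
    case False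
    then show ?thesis by (auto simp: hodge_laplacian_eq scale_form_def form_pullback_def fun_eq_iff)
  qed
  then show ?thesis using form_pullback_forms_pq[OF F pq] by (simp add: eigenspace_def fun_eq_iff)
qed

lemma linear_form_pullback: "Vector_Spaces.linear scale_form scale_form (form_pullback X F)"
  unfolding Vector_Spaces.linear_iff
  by (intro conjI form_space.vector_space_axioms)
    (auto simp: form_pullback_def pullback_def scale_form_def fun_eq_iff Let_def)

lemma local_data: "local_data X"
  by (simp add: local_data_def open_chart_image metric_field_chart)

end

section \<open>Forms on quotients by free actions\<close>

lemma smooth_forms_zero:
  "\<omega> \<in> smooth_forms M k \<Longrightarrow> \<not> (i \<in> charts M \<and> z \<in> chart_image M i) \<Longrightarrow> \<omega> i z = 0"
  by (auto simp: smooth_forms_def)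

locale free_quotient = hermitian_manifold X
  for X :: "('i, 'a, 'm::finite) hermitian_data" +
  fixes \<Gamma> :: "('a \<Rightarrow> 'a) set"
  assumes subgroup: "subgroup \<Gamma> (BijGroup (topspace (mtop X)))"
    and finite: "finite \<Gamma>"
    and isometries: "\<And>\<gamma>. \<gamma> \<in> \<Gamma> \<Longrightarrow> isometric \<gamma>"
    and free: "acts_freely X \<Gamma>"
begin

abbreviation "Q \<equiv> quotient_manifold X \<Gamma>"
abbreviation "ident \<equiv> (\<lambda>x\<in>topspace (mtop X). x)"

lemma one_mem: "ident \<in> \<Gamma>"
  using subgroup.one_closed[OF subgroup] by (simp add: BijGroup_def)

lemma compose_mem:
  assumes "\<gamma> \<in> \<Gamma>" "\<delta> \<in> \<Gamma>" shows "compose (topspace (mtop X)) \<gamma> \<delta> \<in> \<Gamma>"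
proof -
  have "\<gamma> \<in> Bij (topspace (mtop X))" "\<delta> \<in> Bij (topspace (mtop X))"
    using subgroup.subset[OF subgroup] assms by (auto simp: BijGroup_def)
  then show ?thesis using subgroup.m_closed[OF subgroup assms] by (simp add: BijGroup_def)
qed

lemma inverse_mem:
  assumes "\<gamma> \<in> \<Gamma>" obtains \<delta> where "\<delta> \<in> \<Gamma>" "\<And>x. x \<in> topspace (mtop X) \<Longrightarrow> \<delta> (\<gamma> x) = x"
proof -
  let ?B = "BijGroup (topspace (mtop X))"
  have mem: "\<gamma> \<in> carrier ?B" "inv\<^bsub>?B\<^esub> \<gamma> \<in> carrier ?B" "inv\<^bsub>?B\<^esub> \<gamma> \<in> \<Gamma>"
    using assms subgroup.subset[OF subgroup] subgroup.m_inv_closed[OF subgroup] by auto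
  have "inv\<^bsub>?B\<^esub> \<gamma> \<otimes>\<^bsub>?B\<^esub> \<gamma> = \<one>\<^bsub>?B\<^esub>" by (rule group.l_inv[OF group_BijGroup mem(1)])
  then have "compose (topspace (mtop X)) (inv\<^bsub>?B\<^esub> \<gamma>) \<gamma> = ident" using mem by (simp add: BijGroup_def)
  then have "(inv\<^bsub>?B\<^esub> \<gamma>) (\<gamma> x) = x" if "x \<in> topspace (mtop X)" for x
    using that by (metis compose_eq restrict_apply')
  then show ?thesis using that mem(3) by blast
qed

lemma fixes_point: "\<gamma> \<in> \<Gamma> \<Longrightarrow> x \<in> topspace (mtop X) \<Longrightarrow> \<gamma> x = x \<Longrightarrow> \<gamma> = ident"
  using free unfolding acts_freely_def transformation_group_def BijGroup_def by simp blast

lemma proj_eq: "proj X \<Gamma> x = (\<lambda>\<gamma>. \<gamma> x) ` \<Gamma>"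
  by (auto simp: proj_def orbit_def transformation_group_def)

lemma proj_eq_iff:
  assumes x: "x \<in> topspace (mtop X)" and y: "y \<in> topspace (mtop X)"
  shows "proj X \<Gamma> x = proj X \<Gamma> y \<longleftrightarrow> (\<exists>\<gamma>\<in>\<Gamma>. \<gamma> x = y)"
proof
  assume "proj X \<Gamma> x = proj X \<Gamma> y"
  moreover have "y \<in> proj X \<Gamma> y" unfolding proj_eq using y by (intro image_eqI[OF _ one_mem]) simp
  ultimately have "y \<in> proj X \<Gamma> x" by simp
  then show "\<exists>\<gamma>\<in>\<Gamma>. \<gamma> x = y" by (auto simp: proj_eq)
next
  have sub: "proj X \<Gamma> (\<gamma> w) \<subseteq> proj X \<Gamma> w" if "\<gamma> \<in> \<Gamma>" "w \<in> topspace (mtop X)" for \<gamma> w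
  proof
    fix u assume "u \<in> proj X \<Gamma> (\<gamma> w)"
    then obtain \<delta> where \<delta>: "\<delta> \<in> \<Gamma>" "u = \<delta> (\<gamma> w)" by (auto simp: proj_eq)
    then have "u = compose (topspace (mtop X)) \<delta> \<gamma> w" using that by (simp add: compose_eq)
    then show "u \<in> proj X \<Gamma> w" using compose_mem[OF \<delta>(1) that(1)] by (auto simp: proj_eq)
  qed
  assume "\<exists>\<gamma>\<in>\<Gamma>. \<gamma> x = y"
  then obtain \<gamma> where \<gamma>: "\<gamma> \<in> \<Gamma>" "\<gamma> x = y" by blast
  obtain \<delta> where "\<delta> \<in> \<Gamma>" "\<delta> y = x" using inverse_mem[OF \<gamma>(1)] x \<gamma>(2) by metis
  then show "proj X \<Gamma> x = proj X \<Gamma> y" using sub[OF \<gamma>(1) x] sub[of \<delta> y] \<gamma> y by auto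
qed

lemma mem_charts_Q:
  "(i, U) \<in> charts Q \<longleftrightarrow> i \<in> charts X \<and> openin (mtop X) U \<and> U \<subseteq> cdom i \<and> inj_on (proj X \<Gamma>) U"
  by (simp add: quotient_manifold_def)

lemma charts_Q_dest:
  assumes "(i, U) \<in> charts Q"
  shows "i \<in> charts X" "openin (mtop X) U" "U \<subseteq> cdom i" "inj_on (proj X \<Gamma>) U" "U \<subseteq> topspace (mtop X)"
  using assms dom_subset by (auto simp: mem_charts_Q)

lemma chart_dom_Q: "chart_dom Q (i, U) = proj X \<Gamma> ` U"
  by (simp add: quotient_manifold_def)

lemma chart_map_Q:
  assumes "(i, U) \<in> charts Q" "u \<in> U" shows "chart_map Q (i, U) (proj X \<Gamma> u) = coord i u"
  using assms by (simp add: quotient_manifold_def the_inv_into_f_f mem_charts_Q)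

lemma chart_image_Q: "(i, U) \<in> charts Q \<Longrightarrow> chart_image Q (i, U) = coord i ` U"
  using chart_map_Q by (force simp: chart_image_def chart_dom_Q)

lemma riem_Q: "riem Q (i, U) = riem X i"
  by (simp add: quotient_manifold_def)

lemma inv_chart_map_Q:
  assumes U: "(i, U) \<in> charts Q" and u: "u \<in> U"
  shows "inv_into (chart_dom Q (i, U)) (chart_map Q (i, U)) (coord i u) = proj X \<Gamma> u"
proof -
  have "inj_on (chart_map Q (i, U)) (chart_dom Q (i, U))"
    unfolding chart_dom_Q
  proof (rule inj_onI)
    fix a b assume "a \<in> proj X \<Gamma> ` U" "b \<in> proj X \<Gamma> ` U" "chart_map Q (i, U) a = chart_map Q (i, U) b"
    then obtain x y where xy: "x \<in> U" "y \<in> U" "a = proj X \<Gamma> x" "b = proj X \<Gamma> y" "coord i x = coord i y"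
      by (auto simp: chart_map_Q[OF U])
    then have "x = y"
      using inj_onD[OF coord_inj[OF charts_Q_dest(1)[OF U]]] charts_Q_dest(3)[OF U] by blast
    then show "a = b" using xy by simp
  qed
  from inv_into_f_f[OF this, of "proj X \<Gamma> u"] show ?thesis
    using u by (simp add: chart_dom_Q chart_map_Q[OF U])
qed

lemma local_rep_Q:
  assumes U: "(i, U) \<in> charts Q" and V: "(j, V) \<in> charts Q" and u: "u \<in> U" "\<gamma> \<in> \<Gamma>" "\<gamma> u \<in> V"
  shows "local_rep Q (i, U) Q (j, V) id (coord i u) = coord j (\<gamma> u)"
proof -
  have "proj X \<Gamma> u = proj X \<Gamma> (\<gamma> u)"
    using u charts_Q_dest(5)[OF U] charts_Q_dest(5)[OF V] by (subst proj_eq_iff) auto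
  then show ?thesis
    using chart_map_Q[OF V u(3)] by (simp add: local_rep_def inv_chart_map_Q[OF U u(1)])
qed

lemma local_dom_Q:
  assumes U: "(i, U) \<in> charts Q" and V: "(j, V) \<in> charts Q" and z: "z \<in> local_dom Q (i, U) Q (j, V) id"
  obtains u \<gamma> where "u \<in> U" "z = coord i u" "\<gamma> \<in> \<Gamma>" "\<gamma> u \<in> V"
proof -
  obtain u v where uv: "u \<in> U" "v \<in> V" "z = chart_map Q (i, U) (proj X \<Gamma> u)" "proj X \<Gamma> u = proj X \<Gamma> v"
    using z by (auto simp: local_dom_def chart_dom_Q)
  then obtain \<gamma> where "\<gamma> \<in> \<Gamma>" "\<gamma> u = v"
    using proj_eq_iff charts_Q_dest(5)[OF U] charts_Q_dest(5)[OF V] by blast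
  then show ?thesis using that uv chart_map_Q[OF U uv(1)] by simp
qed

lemma coord_mem_local_dom_Q:
  assumes U: "(i, U) \<in> charts Q" and V: "(j, V) \<in> charts Q" and u: "u \<in> U" "\<gamma> \<in> \<Gamma>" "\<gamma> u \<in> V"
  shows "coord i u \<in> local_dom Q (i, U) Q (j, V) id"
proof -
  have "proj X \<Gamma> u = proj X \<Gamma> (\<gamma> u)"
    using u charts_Q_dest(5)[OF U] charts_Q_dest(5)[OF V] by (subst proj_eq_iff) auto
  then have "proj X \<Gamma> u \<in> proj X \<Gamma> ` V" using u(3) by simp
  then have "proj X \<Gamma> u \<in> {x \<in> chart_dom Q (i, U). id x \<in> chart_dom Q (j, V)}"
    using u(1) by (simp add: chart_dom_Q)
  then show ?thesis unfolding local_dom_def chart_map_Q[OF U u(1), symmetric] by blast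
qed

text \<open>If \<open>\<gamma>\<close> moves \<open>u\<close> into \<open>V\<close>, then it also moves the points near \<open>u\<close> into \<open>V\<close>, and as the
  projection is injective on \<open>V\<close>, the change of coordinates is the coordinate expression of \<open>\<gamma>\<close>
  there.\<close>

lemma pullback_local_rep_Q:
  assumes U: "(i, U) \<in> charts Q" and V: "(j, V) \<in> charts Q" and u: "u \<in> U" "\<gamma> \<in> \<Gamma>" "\<gamma> u \<in> V"
  shows "pullback (local_rep Q (i, U) Q (j, V) id) \<alpha> (coord i u) = pullback (rep i j \<gamma>) \<alpha> (coord i u)"
proof (rule pullback_cong_on_open[of "coord i ` {y \<in> U. \<gamma> y \<in> V}"])
  show "open (coord i ` {y \<in> U. \<gamma> y \<in> V})"
    using charts_Q_dest[OF U] charts_Q_dest[OF V] u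
    by (intro open_coord_image openin_preimage isometries) auto
  show "coord i u \<in> coord i ` {y \<in> U. \<gamma> y \<in> V}" using u by blast
  fix y assume "y \<in> coord i ` {y \<in> U. \<gamma> y \<in> V}"
  then show "local_rep Q (i, U) Q (j, V) id y = rep i j \<gamma> y"
    using local_rep_Q[OF U V] u(2) charts_Q_dest(1,3)[OF U] by (auto simp: rep_coord subset_iff)
qed

lemma smooth_forms_Q_compatible:
  assumes \<eta>: "\<eta> \<in> smooth_forms Q k"
    and U: "(i, U) \<in> charts Q" and V: "(j, V) \<in> charts Q" and u: "u \<in> U" "\<gamma> \<in> \<Gamma>" "\<gamma> u \<in> V"
  shows "pullback (rep i j \<gamma>) (\<eta> (j, V)) (coord i u) = \<eta> (i, U) (coord i u)"
proof -
  have "pullback (local_rep Q (i, U) Q (j, V) id) (\<eta> (j, V)) (coord i u) = \<eta> (i, U) (coord i u)"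
    using \<eta> U V coord_mem_local_dom_Q[OF U V u] by (simp add: smooth_forms_def pullback_def fun_eq_iff)
  then show ?thesis by (simp add: pullback_local_rep_Q[OF U V u])
qed

lemma local_data_Q: "local_data Q"
proof -
  have "open (chart_image Q (i, U)) \<and> metric_field (riem Q (i, U)) (chart_image Q (i, U))"
    if U: "(i, U) \<in> charts Q" for i U
  proof -
    have "coord i ` U \<subseteq> chart_image X i" using charts_Q_dest(3)[OF U] by (auto simp: chart_image_def)
    then show ?thesis
      unfolding chart_image_Q[OF U] riem_Q using charts_Q_dest[OF U]
      by (intro conjI open_coord_image metric_field_subset[OF metric_field_chart])
  qed
  then show ?thesis by (auto simp: local_data_def)
qed

text \<open>A point is moved by every nontrivial element of the finite group, so by separation it has a
  neighbourhood which is disjoint from all its nontrivial translates.\<close>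

lemma evenly_covered:
  assumes i: "i \<in> charts X" and x: "x \<in> cdom i"
  obtains U where "(i, U) \<in> charts Q" "x \<in> U"
proof -
  have xt: "x \<in> topspace (mtop X)" using i x dom_subset by blast
  have sep: "\<exists>W. openin (mtop X) W \<and> x \<in> W \<and> (\<forall>y\<in>W. \<gamma> y \<notin> W)" if \<gamma>: "\<gamma> \<in> \<Gamma> - {ident}" for \<gamma>
  proof -
    have "\<gamma> x \<noteq> x" using fixes_point[OF _ xt] \<gamma> by blast
    then obtain A B where AB: "openin (mtop X) A" "openin (mtop X) B" "x \<in> A" "\<gamma> x \<in> B" "disjnt A B"
      using complex isometric_topspace[OF isometries xt] \<gamma> xt
      unfolding complex_manifold_def Hausdorff_space_def by (metis DiffD1)
    then have "openin (mtop X) {y \<in> A. \<gamma> y \<in> B}" using \<gamma> by (intro openin_preimage isometries) auto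
    then show ?thesis using AB by (intro exI[of _ "{y \<in> A. \<gamma> y \<in> B}"]) (auto simp: disjnt_iff)
  qed
  then obtain W where W: "\<And>\<gamma>. \<gamma> \<in> \<Gamma> - {ident} \<Longrightarrow> openin (mtop X) (W \<gamma>)"
    "\<And>\<gamma>. \<gamma> \<in> \<Gamma> - {ident} \<Longrightarrow> x \<in> W \<gamma>" "\<And>\<gamma> y. \<gamma> \<in> \<Gamma> - {ident} \<Longrightarrow> y \<in> W \<gamma> \<Longrightarrow> \<gamma> y \<notin> W \<gamma>"
    by metis
  define U where "U = cdom i \<inter> \<Inter> (W ` (\<Gamma> - {ident}))"
  have "openin (mtop X) U"
    unfolding U_def using finite W(1) openin_dom[OF i] by (intro openin_Int_Inter) auto
  moreover have "inj_on (proj X \<Gamma>) U"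
  proof (rule inj_onI)
    fix y w assume yw: "y \<in> U" "w \<in> U" "proj X \<Gamma> y = proj X \<Gamma> w"
    then have t: "y \<in> topspace (mtop X)" "w \<in> topspace (mtop X)" using dom_subset[OF i]
        by (auto simp: U_def)
    then obtain \<gamma> where \<gamma>: "\<gamma> \<in> \<Gamma>" "\<gamma> y = w" using yw proj_eq_iff by blast
    have "\<gamma> = ident"
    proof (rule ccontr)
      assume "\<gamma> \<noteq> ident"
      then have "\<gamma> \<in> \<Gamma> - {ident}" using \<gamma> by simp
      then show False using W(3)[of \<gamma> y] \<gamma> yw by (auto simp: U_def)
    qed
    then show "y = w" using \<gamma>(2) t by simp
  qed
  ultimately have "(i, U) \<in> charts Q" using i by (auto simp: mem_charts_Q U_def)
  moreover have "x \<in> U" using x W(2) by (auto simp: U_def)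
  ultimately show ?thesis using that by blast
qed

text \<open>Pullback along the covering map and its inverse on invariant forms. As a chart of the
  quotient has the same coordinates as a chart of \<open>X\<close>, the components remain the same functions.\<close>

definition lift :: "('i \<times> 'a set, complex^'m) diff_form \<Rightarrow> ('i, complex^'m) diff_form" where
  "lift \<eta> i z = (if i \<in> charts X \<and> z \<in> chart_image X i
     then \<eta> (i, SOME U. (i, U) \<in> charts Q \<and> z \<in> coord i ` U) z else 0)"

definition descend :: "('i, complex^'m) diff_form \<Rightarrow> ('i \<times> 'a set, complex^'m) diff_form" where
  "descend \<omega> c z = (if c \<in> charts Q \<and> z \<in> chart_image Q c then \<omega> (fst c) z else 0)"

lemma linear_lift: "Vector_Spaces.linear scale_form scale_form lift"
  unfolding Vector_Spaces.linear_iff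
  by (intro conjI form_space.vector_space_axioms) (auto simp: lift_def scale_form_def fun_eq_iff)

lemma linear_descend: "Vector_Spaces.linear scale_form scale_form descend"
  unfolding Vector_Spaces.linear_iff
  by (intro conjI form_space.vector_space_axioms) (auto simp: descend_def scale_form_def fun_eq_iff)

lemma pullback_rep_agree:
  assumes "i \<in> charts X" "x \<in> cdom i" "\<And>y. y \<in> topspace (mtop X) \<Longrightarrow> F y = H y"
  shows "pullback (rep i j F) \<alpha> (coord i x) = pullback (rep i j H) \<alpha> (coord i x)"
  using assms dom_subset[OF assms(1)]
  by (intro pullback_cong_on_open[OF open_chart_image]) (auto simp: chart_image_def rep_coord subset_iff)

lemma lift_eq:
  assumes \<eta>: "\<eta> \<in> smooth_forms Q k" and U: "(i, U) \<in> charts Q" and u: "u \<in> U"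
  shows "lift \<eta> i (coord i u) = \<eta> (i, U) (coord i u)"
proof -
  note U' = charts_Q_dest[OF U]
  define V where "V = (SOME V. (i, V) \<in> charts Q \<and> coord i u \<in> coord i ` V)"
  have "(i, U) \<in> charts Q \<and> coord i u \<in> coord i ` U" using U u by blast
  then have V: "(i, V) \<in> charts Q \<and> coord i u \<in> coord i ` V" unfolding V_def by (rule someI)
  then obtain v where "v \<in> V" "coord i u = coord i v" by blast
  then have uV: "u \<in> V"
    using inj_onD[OF coord_inj[OF U'(1)], of u v] U'(3) charts_Q_dest(3)[of i V] V u by auto
  have "ident u = u" using u U'(5) by auto
  then have "pullback (rep i i ident) (\<eta> (i, V)) (coord i u) = \<eta> (i, U) (coord i u)"
    using V uV by (intro smooth_forms_Q_compatible[OF \<eta> U _ u one_mem]) auto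
  moreover have "pullback (rep i i ident) (\<eta> (i, V)) (coord i u) = \<eta> (i, V) (coord i u)"
    using U' u dom_subset[OF U'(1)]
    by (intro pullback_ident[OF open_chart_image]) (auto simp: chart_image_def rep_coord)
  ultimately show ?thesis
    using U' u by (auto simp: lift_def V_def[symmetric] coord_in_image)
qed

lemma descend_eq: "(i, U) \<in> charts Q \<Longrightarrow> u \<in> U \<Longrightarrow> descend \<omega> (i, U) (coord i u) = \<omega> i (coord i u)"
  by (simp add: descend_def chart_image_Q)

lemma chart_image_coveredE:
  assumes "i \<in> charts X" "z \<in> chart_image X i"
  obtains x U where "z = coord i x" "x \<in> cdom i" "x \<in> U" "(i, U) \<in> charts Q"
proof -
  obtain x where x: "x \<in> cdom i" "z = coord i x" using assms(2) by (auto simp: chart_image_def)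
  obtain U where "(i, U) \<in> charts Q" "x \<in> U" by (rule evenly_covered[OF assms(1) x(1)])
  with x show ?thesis by (intro that)
qed

text \<open>The transition maps of the quotient contain the coordinate expressions of the elements of
  \<open>\<Gamma>\<close>: compatibility of \<open>\<eta>\<close> with those of the neutral element makes its lift a form on \<open>X\<close>, and
  with the others makes it invariant.\<close>

lemma lift_eigenforms:
  assumes \<eta>: "\<eta> \<in> eigenforms Q p q c"
  shows "lift \<eta> \<in> eigenforms X p q c"
    and "\<gamma> \<in> \<Gamma> \<Longrightarrow> form_pullback X \<gamma> (lift \<eta>) = lift \<eta>"
proof -
  have \<eta>s: "\<eta> \<in> smooth_forms Q (p + q)" and eig: "hodge_laplacian Q \<eta> = scale_form c \<eta>"
    and \<eta>pq: "\<And>d z. d \<in> charts Q \<Longrightarrow> z \<in> chart_image Q d \<Longrightarrow> \<eta> d z \<in> forms_at_pq p q"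
    using \<eta> by (auto simp: eigenspace_def forms_pq_def)
  have near: "lift \<eta> i z = \<eta> (i, U) z" if "(i, U) \<in> charts Q" "z \<in> coord i ` U" for i U z
    using that(2) lift_eq[OF \<eta>s that(1)] by auto
  have U_open: "open (coord i ` U)" if "(i, U) \<in> charts Q" for i U
    using charts_Q_dest[OF that] by (intro open_coord_image)
  have smooth: "lift \<eta> \<in> smooth_forms X (p + q)"
    unfolding smooth_forms_def
  proof (intro CollectI conjI allI ballI impI)
    show "lift \<eta> i z = 0" if "i \<notin> charts X \<or> z \<notin> chart_image X i" for i z
      using that by (auto simp: lift_def)
  next
    fix i z assume i: "i \<in> charts X" and z: "z \<in> chart_image X i"
    then obtain x U where x: "z = coord i x" "x \<in> U" "(i, U) \<in> charts Q" by (rule chart_image_coveredE)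
    then show "alternating_form (p + q) (lift \<eta> i z)"
      using \<eta>s near[OF x(3)] by (auto simp: smooth_forms_def chart_image_Q)
  next
    fix i vs assume i: "i \<in> charts X"
    show "smooth_on (\<lambda>z. lift \<eta> i z vs) (chart_image X i)"
    proof (rule smooth_on_local)
      fix z assume "z \<in> chart_image X i"
      with i obtain x U where x: "z = coord i x" "x \<in> U" "(i, U) \<in> charts Q"
          by (rule chart_image_coveredE)
      have "smooth_on (\<lambda>z. \<eta> (i, U) z vs) (coord i ` U)"
        using \<eta>s x by (auto simp: smooth_forms_def chart_image_Q[symmetric])
      then have "smooth_on (\<lambda>z. lift \<eta> i z vs) (coord i ` U)"
        by (subst smooth_on_cong[OF U_open[OF x(3)], of _ "\<lambda>z. \<eta> (i, U) z vs"]) (simp_all add: near[OF x(3)])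
      then show "\<exists>N. open N \<and> z \<in> N \<and> smooth_on (\<lambda>z. lift \<eta> i z vs) N"
        using U_open[OF x(3)] x by blast
    qed
  next
    fix i j z vs assume i: "i \<in> charts X" and j: "j \<in> charts X" and z: "z \<in> local_dom X i X j id"
    then obtain x where x: "x \<in> cdom i" "x \<in> cdom j" "z = coord i x" by (auto simp: local_dom_def)
    obtain U where U: "(i, U) \<in> charts Q" "x \<in> U" using evenly_covered[OF i x(1)] by blast
    obtain V where V: "(j, V) \<in> charts Q" "x \<in> V" using evenly_covered[OF j x(2)] by blast
    have ident: "ident x = x" using U charts_Q_dest(5) by auto
    have "pullback (rep i j id) (lift \<eta> j) z = pullback (rep i j id) (\<eta> (j, V)) z"
      unfolding x(3) using lift_eq[OF \<eta>s V] by (intro pullback_cong) (simp add: rep_coord i x)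
    also have "\<dots> = pullback (rep i j ident) (\<eta> (j, V)) z"
      unfolding x(3) using i x(1) by (intro pullback_rep_agree) auto
    also have "\<dots> = \<eta> (i, U) z"
      unfolding x(3) using V(2) ident
          by (intro smooth_forms_Q_compatible[OF \<eta>s U(1) V(1) U(2) one_mem]) simp
    also have "\<dots> = lift \<eta> i z" unfolding x(3) by (rule lift_eq[OF \<eta>s U, symmetric])
    finally show "lift \<eta> j (rep i j id z) (map (fderiv (rep i j id) z) vs) = lift \<eta> i z vs"
      by (simp add: pullback_def fun_eq_iff)
  qed
  have pointwise: "lift \<eta> i z \<in> forms_at_pq p q \<and> hodge_laplacian X (lift \<eta>) i z
      = scale_form c (lift \<eta>) i z"
    if i: "i \<in> charts X" and z: "z \<in> chart_image X i" for i z
  proof -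
    from i z obtain x U where x: "z = coord i x" "x \<in> U" "(i, U) \<in> charts Q"
        by (rule chart_image_coveredE)
    then have zU: "z \<in> coord i ` U" by blast
    have "laplacian (riem X i) (lift \<eta> i) z = laplacian (riem X i) (\<eta> (i, U)) z"
      by (rule laplacian_cong_on_open[OF U_open[OF x(3)] zU near[OF x(3)]])
    also have "\<dots> = hodge_laplacian Q \<eta> (i, U) z"
      using x(3) zU by (simp add: hodge_laplacian_eq riem_Q chart_image_Q)
    finally show ?thesis
      using i z \<eta>pq[of "(i, U)" z] x(3) zU
      by (simp add: hodge_laplacian_eq[of X] near[OF x(3)] chart_image_Q eig scale_form_def)
  qed
  have "hodge_laplacian X (lift \<eta>) i z = scale_form c (lift \<eta>) i z" for i z
    using pointwise[of i z] by (cases "i \<in> charts X \<and> z \<in> chart_image X i")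
      (auto simp: hodge_laplacian_eq lift_def scale_form_def fun_eq_iff)
  then show "lift \<eta> \<in> eigenforms X p q c"
    using smooth pointwise by (simp add: eigenspace_def forms_pq_def fun_eq_iff)
  assume \<gamma>: "\<gamma> \<in> \<Gamma>"
  show "form_pullback X \<gamma> (lift \<eta>) = lift \<eta>"
  proof (intro ext)
    fix i z vs
    show "form_pullback X \<gamma> (lift \<eta>) i z vs = lift \<eta> i z vs"
    proof (cases "i \<in> charts X \<and> z \<in> chart_image X i")
      case True
      then obtain x U where x: "z = coord i x" "x \<in> cdom i" "x \<in> U" "(i, U) \<in> charts Q"
        using chart_image_coveredE by blast
      have "\<gamma> x \<in> topspace (mtop X)"
        using isometric_topspace[OF isometries[OF \<gamma>]] x charts_Q_dest(5) by blast
      then obtain j where j: "j \<in> charts X" "\<gamma> x \<in> cdom j" using ex_chart by blast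
      then obtain V where V: "(j, V) \<in> charts Q" "\<gamma> x \<in> V" using evenly_covered by blast
      have "form_pullback X \<gamma> (lift \<eta>) i z = pullback (rep i j \<gamma>) (lift \<eta> j) z"
        unfolding x(1) using True j x by (intro form_pullback_eq[OF isometries[OF \<gamma>] smooth]) auto
      also have "\<dots> = pullback (rep i j \<gamma>) (\<eta> (j, V)) z"
        unfolding x(1) using lift_eq[OF \<eta>s V] True x by (intro pullback_cong) (simp add: rep_coord)
      also have "\<dots> = \<eta> (i, U) z"
        unfolding x(1) by (rule smooth_forms_Q_compatible[OF \<eta>s x(4) V(1) x(3) \<gamma> V(2)])
      also have "\<dots> = lift \<eta> i z" unfolding x(1) by (rule lift_eq[OF \<eta>s x(4,3), symmetric])
      finally show ?thesis by simp
    qed (auto simp: form_pullback_def lift_def)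
  qed
qed

lemma lift_inj: "inj_on lift (smooth_forms Q k)"
proof (rule inj_onI, rule ext, rule ext)
  fix \<eta> \<eta>' :: "('i \<times> 'a set, complex^'m) diff_form" and d :: "'i \<times> 'a set" and z
  assume \<eta>: "\<eta> \<in> smooth_forms Q k" "\<eta>' \<in> smooth_forms Q k" "lift \<eta> = lift \<eta>'"
  obtain i U where d: "d = (i, U)" by (cases d)
  show "\<eta> d z = \<eta>' d z"
  proof (cases "d \<in> charts Q \<and> z \<in> chart_image Q d")
    case True
    then obtain u where "u \<in> U" "z = coord i u" using d chart_image_Q by auto
    then show ?thesis using True lift_eq[OF \<eta>(1), of i U u] lift_eq[OF \<eta>(2), of i U u] \<eta>(3) d by simp
  next
    case False
    show ?thesis by (simp only: smooth_forms_zero[OF \<eta>(1) False] smooth_forms_zero[OF \<eta>(2) False])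
  qed
qed

text \<open>Conversely, invariance under \<open>\<Gamma>\<close> is the compatibility of the components with the transition
  maps of the quotient.\<close>

lemma descend_eigenforms:
  assumes \<omega>: "\<omega> \<in> eigenforms X p q c"
    and inv: "\<And>\<gamma>. \<gamma> \<in> \<Gamma> \<Longrightarrow> form_pullback X \<gamma> \<omega> = \<omega>"
  shows "descend \<omega> \<in> eigenforms Q p q c"
proof -
  have \<omega>s: "\<omega> \<in> smooth_forms X (p + q)" and eig: "hodge_laplacian X \<omega> = scale_form c \<omega>"
    and \<omega>pq: "\<And>i z. i \<in> charts X \<Longrightarrow> z \<in> chart_image X i \<Longrightarrow> \<omega> i z \<in> forms_at_pq p q"
    using \<omega> by (auto simp: eigenspace_def forms_pq_def)
  have image: "i \<in> charts X" "chart_image Q (i, U) \<subseteq> chart_image X i" "open (chart_image Q (i, U))"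
    if U: "(i, U) \<in> charts Q" for i U
    unfolding chart_image_Q[OF U] using charts_Q_dest[OF U] open_coord_image[of i U]
    by (auto simp: chart_image_def)
  have near: "descend \<omega> (i, U) z = \<omega> i z" if "(i, U) \<in> charts Q" "z \<in> chart_image Q (i, U)" for i U z
    using that by (simp add: descend_def)
  have smooth: "descend \<omega> \<in> smooth_forms Q (p + q)"
    unfolding smooth_forms_def
  proof (intro CollectI conjI allI ballI impI)
    show "descend \<omega> d z = 0" if "d \<notin> charts Q \<or> z \<notin> chart_image Q d" for d z
      using that by (auto simp: descend_def)
  next
    fix d z assume d: "d \<in> charts Q" and z: "z \<in> chart_image Q d"
    obtain i U where iU: "d = (i, U)" by (cases d)
    have "i \<in> charts X" "z \<in> chart_image X i" using d z image(1,2)[of i U] iU by auto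
    then have "alternating_form (p + q) (\<omega> i z)" using \<omega>s by (simp add: smooth_forms_def)
    then show "alternating_form (p + q) (descend \<omega> d z)" using near[of i U z] d z iU by simp
  next
    fix d vs assume d: "d \<in> charts Q"
    obtain i U where iU: "d = (i, U)" by (cases d)
    have "smooth_on (\<lambda>z. \<omega> i z vs) (chart_image Q d)"
    proof (rule smooth_on_subset[of _ "chart_image X i"])
      show "smooth_on (\<lambda>z. \<omega> i z vs) (chart_image X i)"
        using \<omega>s image(1)[of i U] d iU by (simp add: smooth_forms_def)
      show "chart_image Q d \<subseteq> chart_image X i" using image(2)[of i U] d iU by simp
    qed
    then show "smooth_on (\<lambda>z. descend \<omega> d z vs) (chart_image Q d)"
      using d iU image(3)[of i U] near[of i U] by (subst smooth_on_cong[of _ _ "\<lambda>z. \<omega> i z vs"]) auto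
  next
    fix d e z vs assume d: "d \<in> charts Q" and e: "e \<in> charts Q" and z: "z \<in> local_dom Q d Q e id"
    obtain i U j V where iU: "d = (i, U)" "e = (j, V)" by (cases d, cases e)
    have U: "(i, U) \<in> charts Q" and V: "(j, V) \<in> charts Q" using d e iU by auto
    obtain u \<gamma> where u: "u \<in> U" "z = coord i u" "\<gamma> \<in> \<Gamma>" "\<gamma> u \<in> V"
      using local_dom_Q[OF U V] z iU by metis
    have "pullback (local_rep Q d Q e id) (descend \<omega> e) z = pullback (rep i j \<gamma>) (descend \<omega> (j, V)) z"
      unfolding iU u(2) by (rule pullback_local_rep_Q[OF U V u(1,3,4)])
    also have "\<dots> = pullback (rep i j \<gamma>) (\<omega> j) z"
      unfolding u(2) using descend_eq[OF V u(4)] charts_Q_dest(1,3)[OF U] u(1)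
      by (intro pullback_cong) (auto simp: rep_coord)
    also have "\<dots> = form_pullback X \<gamma> \<omega> i z"
      unfolding u(2) using charts_Q_dest[OF U] charts_Q_dest[OF V] u
      by (intro form_pullback_eq[OF isometries[OF u(3)] \<omega>s, symmetric]) auto
    also have "\<dots> = descend \<omega> d z"
      unfolding inv[OF u(3)] iU u(2) by (rule descend_eq[OF U u(1), symmetric])
    finally show "descend \<omega> e (local_rep Q d Q e id z) (map (fderiv (local_rep Q d Q e id) z) vs)
        = descend \<omega> d z vs"
      by (simp add: pullback_def fun_eq_iff)
  qed
  have pointwise: "descend \<omega> d z \<in> forms_at_pq p q \<and> hodge_laplacian Q (descend \<omega>) d z
      = scale_form c (descend \<omega>) d z"
    if d: "d \<in> charts Q" and z: "z \<in> chart_image Q d" for d z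
  proof -
    obtain i U where iU: "d = (i, U)" by (cases d)
    have U: "(i, U) \<in> charts Q" "z \<in> chart_image Q (i, U)" using d z iU by auto
    have "laplacian (riem X i) (descend \<omega> (i, U)) z = laplacian (riem X i) (\<omega> i) z"
      by (rule laplacian_cong_on_open[OF image(3)[OF U(1)] U(2) near[OF U(1)]])
    also have "\<dots> = hodge_laplacian X \<omega> i z"
      using image[OF U(1)] U(2) by (auto simp: hodge_laplacian_eq)
    finally show ?thesis
      using d z \<omega>pq[of i z] image[OF U(1)] U
      by (auto simp: hodge_laplacian_eq[of Q] near[OF U] iU riem_Q eig scale_form_def)
  qed
  have "hodge_laplacian Q (descend \<omega>) d z = scale_form c (descend \<omega>) d z" for d z
    using pointwise[of d z] by (cases "d \<in> charts Q \<and> z \<in> chart_image Q d")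
      (auto simp: hodge_laplacian_eq descend_def scale_form_def fun_eq_iff)
  then show ?thesis
    using smooth pointwise by (simp add: eigenspace_def forms_pq_def fun_eq_iff)
qed

lemma descend_inj: "inj_on descend (smooth_forms X k)"
proof (rule inj_onI, rule ext, rule ext)
  fix \<omega> \<omega>' :: "('i, complex^'m) diff_form" and i z
  assume \<omega>: "\<omega> \<in> smooth_forms X k" "\<omega>' \<in> smooth_forms X k" "descend \<omega> = descend \<omega>'"
  show "\<omega> i z = \<omega>' i z"
  proof (cases "i \<in> charts X \<and> z \<in> chart_image X i")
    case True
    then obtain x U where "z = coord i x" "x \<in> U" "(i, U) \<in> charts Q" using chart_image_coveredE
        by blast
    then show ?thesis using descend_eq[of i U x \<omega>] descend_eq[of i U x \<omega>'] \<omega>(3) by simp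
  next
    case False
    show ?thesis by (simp only: smooth_forms_zero[OF \<omega>(1) False] smooth_forms_zero[OF \<omega>(2) False])
  qed
qed

end

section \<open>Isospectrality\<close>

lemma independent_image:
  assumes f: "Vector_Spaces.linear scale_form scale_form f" and D: "form_space.independent D"
    and E: "D \<subseteq> E" "form_space.subspace E" "inj_on f E"
  shows "form_space.independent (f ` D)" "card (f ` D) = card D"
proof -
  interpret f: Vector_Spaces.linear scale_form scale_form f by (rule f)
  have "inj_on f (form_space.span D)"
    using E by (meson form_space.span_minimal inj_on_subset)
  then show "form_space.independent (f ` D)" by (rule f.independent_injective_image[OF D])
  show "card (f ` D) = card D" using E by (intro card_image) (rule inj_on_subset)
qed

lemma almost_conjugate_sym: "almost_conjugate G \<Gamma>1 \<Gamma>2 \<Longrightarrow> almost_conjugate G \<Gamma>2 \<Gamma>1"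
  by (simp add: almost_conjugate_def)

text \<open>Lift to \<open>X\<close>, compare the fixed spaces of the two subgroups there, and descend to the other
  quotient.\<close>

lemma almost_conjugate_quotient_independent:
  fixes X :: "('i, 'a, 'm::finite) hermitian_data"
  assumes X1: "free_quotient X \<Gamma>1" and X2: "free_quotient X \<Gamma>2"
    and G: "subgroup G (BijGroup (topspace (mtop X)))" "finite G"
      "\<And>\<gamma>. \<gamma> \<in> G \<Longrightarrow> holomorphic_isometry X \<gamma>"
    and H: "subgroup \<Gamma>1 (transformation_group X G)" "subgroup \<Gamma>2 (transformation_group X G)"
      "almost_conjugate (transformation_group X G) \<Gamma>1 \<Gamma>2"
    and D: "finite D" "form_space.independent D"
      "D \<subseteq> eigenforms (quotient_manifold X \<Gamma>1) p q c"
  shows "\<exists>E. finite E \<and> card E = card D \<and> form_space.independent E \<and>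
      E \<subseteq> eigenforms (quotient_manifold X \<Gamma>2) p q c"
proof -
  interpret X1: free_quotient X \<Gamma>1 by (rule X1)
  interpret X2: free_quotient X \<Gamma>2 by (rule X2)
  let ?V = "eigenforms X p q c"
  let ?E1 = "eigenforms X1.Q p q c"
  have iso: "X1.isometric \<gamma>" if "\<gamma> \<in> G" for \<gamma>
    using G(3)[OF that] by (simp add: holomorphic_isometry_def X1.isometric_def)
  interpret T: group "transformation_group X G"
    unfolding transformation_group_def
    by (rule subgroup.subgroup_is_group[OF G(1) group_BijGroup])
  have T: "carrier (transformation_group X G) = G"
    "\<one>\<^bsub>transformation_group X G\<^esub> = (\<lambda>x\<in>topspace (mtop X). x)"
    by (simp_all add: transformation_group_def BijGroup_def)
  have G_Bij: "G \<subseteq> Bij (topspace (mtop X))"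
    using subgroup.subset[OF G(1)] by (simp add: BijGroup_def)
  have T_mult: "(\<gamma> \<otimes>\<^bsub>transformation_group X G\<^esub> \<delta>) y = \<gamma> (\<delta> y)"
    if "\<gamma> \<in> G" "\<delta> \<in> G" "y \<in> topspace (mtop X)" for \<gamma> \<delta> y
    using that G_Bij by (auto simp: transformation_group_def BijGroup_def compose_eq)
  have subE1: "form_space.subspace ?E1" by (rule subspace_eigenforms[OF X1.local_data_Q])
  have subV: "form_space.subspace ?V" by (rule subspace_eigenforms[OF X1.local_data])
  have smooth: "eigenspace S (forms_pq M p q) c \<subseteq> smooth_forms M (p + q)" for S
      and M :: "('x, 'y, 'm) hermitian_data"
    by (auto simp: eigenspace_def forms_pq_def)
  note lift_D = independent_image[OF X1.linear_lift D(2,3) subE1 inj_on_subset[OF X1.lift_inj smooth]]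
  obtain B where B: "finite B" "card B = card (X1.lift ` D)" "form_space.independent B"
    "B \<subseteq> {\<omega> \<in> ?V. \<forall>\<gamma>\<in>\<Gamma>2. form_pullback X \<gamma> \<omega> = \<omega>}"
  proof (rule almost_conjugate_fixed_independent[OF form_space.vector_space_axioms T.is_group _ H subV])
    show "finite (carrier (transformation_group X G))" using G(2) by (simp add: T)
    show "Vector_Spaces.linear scale_form scale_form (form_pullback X \<gamma>)" for \<gamma> :: "'a \<Rightarrow> 'a"
      by (rule X1.linear_form_pullback)
    show "form_pullback X \<gamma> \<omega> \<in> ?V" if "\<gamma> \<in> carrier (transformation_group X G)" "\<omega> \<in> ?V" for \<gamma> \<omega>
      using X1.form_pullback_eigenforms[OF iso that(2)] that(1) by (simp add: T)
    show "form_pullback X (\<gamma> \<otimes>\<^bsub>transformation_group X G\<^esub> \<delta>) \<omega> = form_pullback X \<delta> (form_pullback X \<gamma> \<omega>)"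
      if "\<gamma> \<in> carrier (transformation_group X G)" "\<delta> \<in> carrier (transformation_group X G)" "\<omega> \<in> ?V"
          for \<gamma> \<delta> \<omega>
      using that T.m_closed[OF that(1,2)] T_mult[of \<gamma> \<delta>]
      by (intro X1.form_pullback_compose iso) (auto simp: T eigenspace_def)
    show "form_pullback X \<one>\<^bsub>transformation_group X G\<^esub> \<omega> = \<omega>" if "\<omega> \<in> ?V" for \<omega>
      using that smooth T.one_closed unfolding T
      by (intro X1.form_pullback_ident[of _ _ "p + q"] iso) auto
    show "finite (X1.lift ` D)" using D(1) by simp
    show "form_space.independent (X1.lift ` D)" by (rule lift_D(1))
    show "X1.lift ` D \<subseteq> {\<omega> \<in> ?V. \<forall>\<gamma>\<in>\<Gamma>1. form_pullback X \<gamma> \<omega> = \<omega>}"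
      using X1.lift_eigenforms D(3) by blast
  qed
  have BV: "B \<subseteq> ?V" using B(4) by blast
  note descend_B = independent_image[OF X2.linear_descend B(3) BV subV inj_on_subset[OF X2.descend_inj smooth]]
  show ?thesis
  proof (intro exI conjI)
    show "finite (X2.descend ` B)" using B(1) by simp
    show "card (X2.descend ` B) = card D" using descend_B(2) B(2) lift_D(2) by simp
    show "form_space.independent (X2.descend ` B)" by (rule descend_B(1))
    show "X2.descend ` B \<subseteq> eigenforms X2.Q p q c"
      using X2.descend_eigenforms B(4) by blast
  qed
qed

theorem theorem1p3:
  fixes X :: "('i, 'a, 'm::finite) hermitian_data"
    and G \<Gamma>1 \<Gamma>2 :: "('a \<Rightarrow> 'a) set"
    and n p q :: nat
  assumes "kahler_manifold X"
    and "compact_space (mtop X)"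
    and "n = 2 * CARD('m)"
    and "subgroup G (BijGroup (topspace (mtop X)))"
    and "finite G"
    and "\<And>\<gamma>. \<gamma> \<in> G \<Longrightarrow> holomorphic_isometry X \<gamma>"
    and "subgroup \<Gamma>1 (transformation_group X G)"
    and "subgroup \<Gamma>2 (transformation_group X G)"
    and "almost_conjugate (transformation_group X G) \<Gamma>1 \<Gamma>2"
    and "acts_freely X \<Gamma>1"
    and "acts_freely X \<Gamma>2"
    and "p + q \<le> n"
  shows "isospectral
           (hodge_laplacian (quotient_manifold X \<Gamma>1)) (forms_pq (quotient_manifold X \<Gamma>1) p q)
           (hodge_laplacian (quotient_manifold X \<Gamma>2)) (forms_pq (quotient_manifold X \<Gamma>2) p q)"
proof -
  interpret hermitian_manifold X
    using assms(1) by unfold_locales (simp_all add: kahler_manifold_def)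
  have quotient: "free_quotient X \<Gamma>"
    if \<Gamma>: "subgroup \<Gamma> (transformation_group X G)" "acts_freely X \<Gamma>" for \<Gamma>
  proof (intro free_quotient.intro free_quotient_axioms.intro hermitian_manifold_axioms)
    show "subgroup \<Gamma> (BijGroup (topspace (mtop X)))"
      using group.incl_subgroup[OF group_BijGroup assms(4)] \<Gamma>(1) by (simp add: transformation_group_def)
    have sub: "\<Gamma> \<subseteq> G" using subgroup.subset[OF \<Gamma>(1)] by (simp add: transformation_group_def)
    then show "finite \<Gamma>" using assms(5) finite_subset by blast
    show "isometric \<gamma>" if "\<gamma> \<in> \<Gamma>" for \<gamma>
      using assms(6) sub that by (auto simp: holomorphic_isometry_def isometric_def)
  qed (rule \<Gamma>(2))
  note X1 = quotient[OF assms(7,10)] and X2 = quotient[OF assms(8,11)]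
  show ?thesis
    by (intro isospectralI
        almost_conjugate_quotient_independent[OF X1 X2 assms(4-9)]
        almost_conjugate_quotient_independent[OF X2 X1 assms(4-6,8,7) almost_conjugate_sym[OF assms(9)]])
qed

end
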